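(* Let $(z,z')\in\mathbb C^2$ be admissible and $\xi=1-\varepsilon\in(0,1)$. As $\xi\to1$, that is, $\varepsilon\to0$, the push-forwards $\iota_\varepsilon(P_{z,z',1-\varepsilon})$ of the mixed z-measures converge to the measure $\widetilde P_{z,z'}$ on arbitrary continuous, polynomially bounded test functions on the Thoma cone $\widetilde\Omega$; that is, for every continuous polynomially bounded function $F:\widetilde\Omega\to\mathbb R$, $$\lim_{\varepsilon\to0}\ \sum_{\lambda\in\mathbb Y}F(\iota_\varepsilon(\lambda))\,P_{z,z',1-\varepsilon}(\lambda)=\int_{\widetilde\Omega}F(\widetilde\omega)\,\widetilde P_{z,z'}(d\widetilde\omega).$$
   Context: $\mathbb Y$ is the set of all partitions (Young diagrams); $|\nu|$ is the number of boxes of $\nu$. For a box $\square=(i,j)$ (row $i$, column $j$), $c(\square)=j-i$; $(z)_\nu=\prod_{\square\in\nu}(z+c(\square))$; $(x)_n=x(x+1)\cdots(x+n-1)$; $\dim\nu$ is the number of standard tableaux of shape $\nu$. $\mathrm{Sym}$ is the algebra of symmetric functions over $\mathbb R$, freely generated by the power sums $p_k$; $S_\nu$ are the Schur functions. Admissibility: $(z,z')\in\mathbb C^2$ is admissible if $z\ne0$, $z'\ne0$ and $(z)_\nu(z')_\nu\ge0$ for all $\nu\in\mathbb Y$ (then $zz'>0$). The (mixed) z-measure on $\mathbb Y$ is $P_{z,z',\xi}(\lambda)=(1-\xi)^{zz'}(z)_\lambda(z')_\lambda\,\xi^{|\lambda|}\left(\frac{\dim\lambda}{|\lambda|!}\right)^2$;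 it is a probability measure for admissible $(z,z')$ and $\xi\in(0,1)$. The Thoma cone $\widetilde\Omega$ is the set of triples $\widetilde\omega=(\alpha,\beta,r)\in\mathbb R_+^\infty\times\mathbb R_+^\infty\times\mathbb R_+$ with $\alpha_1\ge\alpha_2\ge\dots\ge0$, $\beta_1\ge\beta_2\ge\dots\ge0$, $\sum\alpha_i+\sum\beta_i\le r$, with the topology induced by the product topology. The Thoma simplex $\Omega$ is the (compact) subset of triples with $r=1$, whose points are written $\omega=(\alpha,\beta)$. Elements of $\mathrm{Sym}$ are realized as functions on $\widetilde\Omega$ (and, by restriction, on $\Omega$) via the algebra morphism defined by $p_1(\alpha,\beta,r)=r$ and $p_k(\alpha,\beta,r)=\sum_i\alpha_i^k+(-1)^{k-1}\sum_i\beta_i^k$ for $k\ge2$. A function $F$ on $\widetilde\Omega$ is polynomially bounded if $|F(\alpha,\beta,r)|\le C_1(1+r)^{C_2}$ for some constants $C_1,C_2$. All measures are Borel. Embeddings $\iota_\varepsilon:\mathbb Y\to\widetilde\Omega$, $\varepsilon>0$: for $\lambda\in\mathbb Y$ with $d$ diagonal boxes let $a_i=\lambda_i-i+\frac12$, $b_i=\lambda'_i-i+\frac12$, $1\le i\le d$ ($\lambda'$ the transposed diagram); then $\iota_\varepsilon(\lambda)=(\alpha,\beta,r)$ with $\alpha=(\varepsilon a_1,\dots,\varepsilon a_d,0,0,\dots)$, $\beta=(\varepsilon b_1,\dots,\varepsilon b_d,0,0,\dots)$, $r=\varepsilon|\lambda|$. Measure $P_{z,z'}$: for admissible $(z,z')$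 there exists a unique probability measure $P_{z,z'}$ on $\Omega$ such that $$\int_\Omega S_\nu(\omega)P_{z,z'}(d\omega)=\frac{(z)_\nu(z')_\nu}{(zz')_{|\nu|}}\frac{\dim\nu}{|\nu|!}\qquad\text{for all }\nu\in\mathbb Y.$$ The measure $\widetilde P_{z,z'}$ is its lifting with parameter $c=zz'$: the push-forward of $P_{z,z'}\otimes\gamma_c$ under the map $\Omega\times\mathbb R_{>0}\to\widetilde\Omega$, $((\alpha,\beta),r)\mapsto(r\alpha,r\beta,r)$, where $\gamma_c(dr)=\frac1{\Gamma(c)}r^{c-1}e^{-r}dr$ on $\mathbb R_{>0}$. *)

theory Defs
  imports
    "HOL-Probability.Probability"
    "HOL-Library.Poly_Mapping"
    "Jordan_Normal_Form.Determinant"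
begin

text \<open>All row, column and sequence indices are 0-based: \<open>\<lambda> ! i\<close> is the row length usually written
  \<open>\<lambda>\<close> with index \<open>i + 1\<close>, and likewise for boxes and for the coordinates of the Thoma cone.
  A partition is the list of its nonzero parts.\<close>

definition partitions :: "nat list set" where
  "partitions = {\<nu>. sorted_wrt (\<ge>) \<nu> \<and> 0 \<notin> set \<nu>}"

definition boxes :: "nat list \<Rightarrow> (nat \<times> nat) set" where
  "boxes \<nu> = {(i, j). i < length \<nu> \<and> j < \<nu> ! i}"

definition col_length :: "nat list \<Rightarrow> nat \<Rightarrow> nat" where
  "col_length \<nu> j = card {i. (i, j) \<in> boxes \<nu>}"

definition standard_tableaux :: "nat list \<Rightarrow> (nat \<times> nat \<Rightarrow> nat) set" where
  "standard_tableaux \<nu> =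
     {T \<in> extensional (boxes \<nu>).
        bij_betw T (boxes \<nu>) {1..sum_list \<nu>} \<and>
        (\<forall>i j. (i, Suc j) \<in> boxes \<nu> \<longrightarrow> T (i, j) < T (i, Suc j)) \<and>
        (\<forall>i j. (Suc i, j) \<in> boxes \<nu> \<longrightarrow> T (i, j) < T (Suc i, j))}"

definition num_tableaux :: "nat list \<Rightarrow> nat" where
  "num_tableaux \<nu> = card (standard_tableaux \<nu>)"

definition content_poch :: "complex \<Rightarrow> nat list \<Rightarrow> complex" where
  "content_poch z \<nu> = (\<Prod>(i, j)\<in>boxes \<nu>. z + of_nat j - of_nat i)"

definition admissible :: "complex \<Rightarrow> complex \<Rightarrow> bool" where
  "admissible z z' \<longleftrightarrow> z \<noteq> 0 \<and> z' \<noteq> 0 \<and>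
     (\<forall>\<nu>\<in>partitions. content_poch z \<nu> * content_poch z' \<nu> \<in> \<real>\<^sub>\<ge>\<^sub>0)"

text \<open>For admissible parameters \<open>z * z'\<close> and \<open>content_poch z \<nu> * content_poch z' \<nu>\<close> are real, so
  taking real parts loses nothing.\<close>

definition mixed_z_measure :: "complex \<Rightarrow> complex \<Rightarrow> real \<Rightarrow> nat list \<Rightarrow> real" where
  "mixed_z_measure z z' \<xi> \<nu> =
     (1 - \<xi>) powr Re (z * z') * Re (content_poch z \<nu> * content_poch z' \<nu>) * \<xi> ^ sum_list \<nu> *
     (real (num_tableaux \<nu>) / fact (sum_list \<nu>)) ^ 2"

text \<open>The free commutative real algebra on the power sums, as polynomials with exponent vectors
  \<open>nat \<Rightarrow>\<^sub>0 nat\<close>; the variable with index \<open>i\<close> is the power sum of degree \<open>i + 1\<close>.\<close>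

type_synonym sym = "(nat \<Rightarrow>\<^sub>0 nat) \<Rightarrow>\<^sub>0 real"

definition sym_const :: "real \<Rightarrow> sym" where
  "sym_const c = Poly_Mapping.single 0 c"

definition power_sum :: "nat \<Rightarrow> sym" where
  "power_sum k = Poly_Mapping.single (Poly_Mapping.single (k - 1) 1) 1"

text \<open>Complete homogeneous functions through Newton's identity
  \<open>n h(n) = p(1) h(n-1) + \<dots> + p(n) h(0)\<close>.\<close>

context
  notes sum.cong [fundef_cong]
begin

fun complete_sym :: "nat \<Rightarrow> sym" where
  "complete_sym n =
     (if n = 0 then 1
      else sym_const (1 / real n) * (\<Sum>k\<in>{1..n}. power_sum k * complete_sym (n - k)))"

end

declare complete_sym.simps [simp del]

text \<open>Schur functions by the Jacobi--Trudi determinant of \<open>h(\<nu>(i) - i + j)\<close>, where \<open>h\<close> vanishes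
  at negative indices.\<close>

definition schur :: "nat list \<Rightarrow> sym" where
  "schur \<nu> = Determinant.det (mat (length \<nu>) (length \<nu>)
     (\<lambda>(i, j). if i \<le> \<nu> ! i + j then complete_sym (\<nu> ! i + j - i) else 0))"

definition sym_eval :: "(nat \<Rightarrow> real) \<Rightarrow> sym \<Rightarrow> real" where
  "sym_eval x f = (\<Sum>m\<in>Poly_Mapping.keys f. Poly_Mapping.lookup f m *
     (\<Prod>i\<in>Poly_Mapping.keys m. x (Suc i) ^ Poly_Mapping.lookup m i))"

text \<open>\<open>sym_eval x\<close> is the algebra morphism sending the power sum of degree \<open>k \<ge> 1\<close> to \<open>x k\<close>.\<close>

context
  fixes x :: "nat \<Rightarrow> real"
begin

lemma sym_eval_superset:
  assumes "finite A" "Poly_Mapping.keys f \<subseteq> A"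
  shows "sym_eval x f = (\<Sum>m\<in>A. Poly_Mapping.lookup f m *
     (\<Prod>i\<in>Poly_Mapping.keys m. x (Suc i) ^ Poly_Mapping.lookup m i))"
  unfolding sym_eval_def
  by (rule sum.mono_neutral_left) (use assms in \<open>auto simp: in_keys_iff\<close>)

lemma sym_eval_add: "sym_eval x (f + g) = sym_eval x f + sym_eval x g"
proof -
  let ?A = "Poly_Mapping.keys f \<union> Poly_Mapping.keys g"
  have "Poly_Mapping.keys (f + g) \<subseteq> ?A" by (rule Poly_Mapping.keys_add)
  then show ?thesis
    by (simp add: sym_eval_superset[of ?A] lookup_add distrib_right sum.distrib)
qed

lemma sym_eval_zero: "sym_eval x 0 = 0"
  by (simp add: sym_eval_def)

lemma sym_eval_sum: "sym_eval x (sum h A) = (\<Sum>a\<in>A. sym_eval x (h a))"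
  by (induction A rule: infinite_finite_induct) (auto simp: sym_eval_zero sym_eval_add)

lemma sym_eval_single:
  "sym_eval x (Poly_Mapping.single m c) =
     c * (\<Prod>i\<in>Poly_Mapping.keys m. x (Suc i) ^ Poly_Mapping.lookup m i)"
  by (subst sym_eval_superset[of "{m}"]) auto

lemma sym_eval_const: "sym_eval x (sym_const c) = c"
  by (simp add: sym_const_def sym_eval_single)

lemma sym_eval_one: "sym_eval x 1 = 1"
  using sym_eval_const[of 1] by (simp add: sym_const_def)

lemma sym_eval_power_sum: "k \<ge> 1 \<Longrightarrow> sym_eval x (power_sum k) = x k"
  by (simp add: power_sum_def sym_eval_single)

lemma sym_eval_single_mult:
  "sym_eval x (Poly_Mapping.single m c * Poly_Mapping.single n d) =
     sym_eval x (Poly_Mapping.single m c) * sym_eval x (Poly_Mapping.single n d)"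
proof -
  let ?A = "Poly_Mapping.keys m \<union> Poly_Mapping.keys n"
  have sup: "(\<Prod>i\<in>Poly_Mapping.keys l. x (Suc i) ^ Poly_Mapping.lookup l i) =
      (\<Prod>i\<in>?A. x (Suc i) ^ Poly_Mapping.lookup l i)"
    if "Poly_Mapping.keys l \<subseteq> ?A" for l :: "nat \<Rightarrow>\<^sub>0 nat"
    by (rule prod.mono_neutral_left) (use that in \<open>auto simp: in_keys_iff\<close>)
  have "(\<Prod>i\<in>Poly_Mapping.keys (m + n). x (Suc i) ^ Poly_Mapping.lookup (m + n) i) =
      (\<Prod>i\<in>Poly_Mapping.keys m. x (Suc i) ^ Poly_Mapping.lookup m i) *
      (\<Prod>i\<in>Poly_Mapping.keys n. x (Suc i) ^ Poly_Mapping.lookup n i)"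
    unfolding sup[OF Poly_Mapping.keys_add] sup[OF Un_upper1] sup[OF Un_upper2]
    by (simp add: lookup_add power_add prod.distrib)
  then show ?thesis
    by (simp add: mult_single sym_eval_single)
qed

lemma sym_eval_mult: "sym_eval x (f * g) = sym_eval x f * sym_eval x g"
proof -
  let ?s = "\<lambda>f m. Poly_Mapping.single m (Poly_Mapping.lookup f m)"
  have f: "f = (\<Sum>m\<in>Poly_Mapping.keys f. ?s f m)" for f :: sym
    by (rule poly_mapping_eqI)
      (auto simp: lookup_sum lookup_single when_def in_keys_iff
        intro!: sum.remove[THEN trans])
  have "sym_eval x (f * g) =
      (\<Sum>m\<in>Poly_Mapping.keys f. \<Sum>n\<in>Poly_Mapping.keys g. sym_eval x (?s f m * ?s g n))"
    by (subst f[of f], subst f[of g]) (simp add: sum_product sym_eval_sum)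
  also have "\<dots> = (\<Sum>m\<in>Poly_Mapping.keys f. sym_eval x (?s f m)) *
      (\<Sum>n\<in>Poly_Mapping.keys g. sym_eval x (?s g n))"
    by (simp add: sym_eval_single_mult sum_product)
  also have "\<dots> = sym_eval x f * sym_eval x g"
    by (metis f sym_eval_sum)
  finally show ?thesis .
qed

end

type_synonym thoma_point = "(nat \<Rightarrow> real) \<times> (nat \<Rightarrow> real) \<times> real"

definition thoma_cone :: "thoma_point set" where
  "thoma_cone = {(\<alpha>, \<beta>, r).
     decseq \<alpha> \<and> (\<forall>i. 0 \<le> \<alpha> i) \<and> decseq \<beta> \<and> (\<forall>i. 0 \<le> \<beta> i) \<and> 0 \<le> r \<and>
     summable \<alpha> \<and> summable \<beta> \<and> suminf \<alpha> + suminf \<beta> \<le> r}"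

definition thoma_simplex :: "thoma_point set" where
  "thoma_simplex = {(\<alpha>, \<beta>, r) \<in> thoma_cone. r = 1}"

fun thoma_power_sum :: "thoma_point \<Rightarrow> nat \<Rightarrow> real" where
  "thoma_power_sum (\<alpha>, \<beta>, r) k =
     (if k = 1 then r else suminf (\<lambda>i. \<alpha> i ^ k) + (- 1) ^ (k - 1) * suminf (\<lambda>i. \<beta> i ^ k))"

definition sym_at :: "sym \<Rightarrow> thoma_point \<Rightarrow> real" where
  "sym_at f \<omega> = sym_eval (thoma_power_sum \<omega>) f"

definition polynomially_bounded :: "(thoma_point \<Rightarrow> real) \<Rightarrow> bool" where
  "polynomially_bounded F \<longleftrightarrow>
     (\<exists>C1 C2. \<forall>(\<alpha>, \<beta>, r)\<in>thoma_cone. \<bar>F (\<alpha>, \<beta>, r)\<bar> \<le> C1 * (1 + r) powr C2)"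

text \<open>Modified Frobenius coordinates. With 0-based indices \<open>\<lambda>(i) - i + 1/2\<close> becomes
  \<open>\<lambda> ! i - i - 1/2\<close>, and similarly for the columns.\<close>

definition thoma_embed :: "real \<Rightarrow> nat list \<Rightarrow> thoma_point" where
  "thoma_embed \<epsilon> \<nu> =
     ((\<lambda>i. if (i, i) \<in> boxes \<nu> then \<epsilon> * (real (\<nu> ! i) - real i - 1/2) else 0),
      (\<lambda>i. if (i, i) \<in> boxes \<nu> then \<epsilon> * (real (col_length \<nu> i) - real i - 1/2) else 0),
      \<epsilon> * real (sum_list \<nu>))"

text \<open>The defining property of the measure on the Thoma simplex with parameters \<open>z\<close>, \<open>z'\<close>;
  for admissible parameters exactly one measure has it.\<close>

definition is_boundary_z_measure :: "complex \<Rightarrow> complex \<Rightarrow> thoma_point measure \<Rightarrow> bool" where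
  "is_boundary_z_measure z z' P \<longleftrightarrow>
     prob_space P \<and>
     sets P = sets (restrict_space borel thoma_simplex) \<and>
     (\<forall>\<nu>\<in>partitions. complex_of_real (\<integral>\<omega>. sym_at (schur \<nu>) \<omega> \<partial>P) =
        content_poch z \<nu> * content_poch z' \<nu> / pochhammer (z * z') (sum_list \<nu>) *
        (of_nat (num_tableaux \<nu>) / fact (sum_list \<nu>)))"

definition gamma_measure :: "real \<Rightarrow> real measure" where
  "gamma_measure c = density (restrict_space lborel {0<..})
     (\<lambda>r. ennreal (r powr (c - 1) * exp (- r) / Gamma c))"

definition thoma_lift :: "real \<Rightarrow> thoma_point measure \<Rightarrow> thoma_point measure" where
  "thoma_lift c P = distr (P \<Otimes>\<^sub>M gamma_measure c) (restrict_space borel thoma_cone)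
     (\<lambda>((\<alpha>, \<beta>, _), r). (\<lambda>i. r * \<alpha> i, \<lambda>i. r * \<beta> i, r))"

end

theory Submission
  imports Defs
begin

text \<open>On the simplex \<open>p\<^sub>1 = 1\<close>, so the integral against \<open>P\<close> of a product \<open>p\<close> of power sums, of degree \<open>m\<close>,
  is that of \<open>p p\<^sub>1\<^sup>n\<^sup>-\<^sup>m\<close>. Expanded in Schur functions by the Murnaghan--Nakayama rule (in the language of
  beta-sets), it becomes the expectation, under the weights \<open>M\<^sub>n(\<nu>) = dim \<nu> \<integral> S\<^sub>\<nu> dP\<close> with \<open>|\<nu>| = n\<close>, of a
  normalized signed count of tableaux of \<open>\<nu>\<close> with ribbons removed. By partial fractions this count is
  the same product \<open>p\<close> evaluated at the modified Frobenius coordinates of \<open>\<nu>\<close>, up to terms of lower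
  degree. Hence the moments of the image of \<open>M\<^sub>n\<close> under the embedding with parameter \<open>1/n\<close> converge to
  those of \<open>P\<close>, and Stone--Weierstrass on the compact Thoma simplex gives weak convergence.

  The mixed z-measure is the mixture of the \<open>M\<^sub>n\<close> by the negative binomial distribution with parameter
  \<open>c = z z'\<close>. Scaled by \<open>\<epsilon>\<close>, that distribution converges to the Gamma distribution with parameter \<open>c\<close>
  under a majorant with all polynomial moments, and dominated convergence concludes.\<close>

section \<open>Moments of the ribbon weights\<close>

unbundle no vec_syntax
no_notation vec_index (infixl "$" 100)
unbundle fps_syntax

text \<open>The signs of the Murnaghan--Nakayama rule do not behave polynomially. They disappear
  when the Jacobi--Trudi determinant is multiplied by the Vandermonde product of the beta-set: both
  alternate, so the product depends on the set only, and each ribbon carries the rational factor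
  \<open>rho\<close>. Sums of \<open>rho\<close> times powers of the nodes are residues, that is,
  coefficients of the product \<open>rho_gf\<close>, whose logarithmic derivative is linear in power
  sums. Each product of two coefficients costs one degree, so only the linear term survives at the
  top. Multiplication by a power sum is exact only if the beta-set has enough empty rows to receive
  the ribbon, which forces many beads. The errors stay uniform because power sums are taken relative
  to the staircase, and the half-integer shift in \<open>node\<close> turns them into the power sums
  of the modified Frobenius coordinates. Admissibility enters through positivity: the
  \<open>M_n\<close> become probability weights, so an error that is small at each partition is
  small in the mean.\<close>

definition geom :: "real \<Rightarrow> real fps" where
  "geom a = Abs_fps (\<lambda>n. a ^ n)"

definition lin :: "real \<Rightarrow> real fps" where
  "lin q = 1 - fps_const q * fps_X"

lemma geom_nth [simp]: "geom a $ n = a ^ n"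
  by (simp add: geom_def)

lemma lin_mult_nth: "(lin q * F) $ n = F $ n - (if n = 0 then 0 else q * F $ (n - 1))"
  by (simp add: lin_def left_diff_distrib mult.assoc)

lemma lin_geom: "lin a * geom a = 1"
  by (rule fps_ext) (simp add: lin_mult_nth power_eq_if)

text \<open>The coefficients on the left are divided differences. Dropping a point w multiplies the
  coefficient at a by a - w, so the sums without v and without u differ by (u - v) times the full
  sum. The product side obeys the same recursion because \<open>lin v - lin u\<close> is (u - v) X,
  which is also the source of the power of X.\<close>

lemma partial_fractions_geom:
  assumes "finite A" "A \<noteq> {}"
  shows "(\<Sum>a\<in>A. fps_const (1 / (\<Prod>b\<in>A - {a}. a - b)) * geom a) =
    fps_X ^ (card A - 1) * (\<Prod>a\<in>A. geom a)"
  using assms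
proof (induction "card A" arbitrary: A rule: less_induct)
  case less
  define L where "L = (\<lambda>A. \<Sum>a\<in>A. fps_const (1 / (\<Prod>b\<in>A - {a}. a - b)) * geom a)"
  show ?case
  proof (cases "card A = 1")
    case True
    then obtain a where "A = {a}" by (auto simp: card_1_singleton_iff)
    then show ?thesis by simp
  next
    case False
    with less.prems have "card A \<ge> 2"
      by (metis One_nat_def Suc_leI card_gt_0_iff le_neq_implies_less numeral_2_eq_2)
    then obtain u v where uv: "u \<in> A" "v \<in> A" "u \<noteq> v"
      by (metis card_le_Suc0_iff_eq less.prems(1) not_less_eq_eq numeral_2_eq_2)
    have fin: "finite A" by fact
    have IH: "L (A - {w}) = fps_X ^ (card A - 2) * (\<Prod>a\<in>A - {w}. geom a)" if "w \<in> A" for w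
    proof -
      have "card (A - {w}) < card A" using that fin by (rule card_Diff1_less[rotated])
      moreover have "A - {w} \<noteq> {}" using \<open>card A \<ge> 2\<close> that fin
        by (metis False card_1_singleton_iff insert_Diff One_nat_def)
      ultimately show ?thesis using less.hyps[of "A - {w}"] fin that
        by (simp add: L_def diff_diff_eq numeral_2_eq_2)
    qed
    have coeff: "1 / (\<Prod>b\<in>(A - {w}) - {a}. a - b) = (a - w) * (1 / (\<Prod>b\<in>A - {a}. a - b))"
      if "w \<in> A" "a \<in> A - {w}" for a w :: real
    proof -
      have "(\<Prod>b\<in>A - {a}. a - b) = (a - w) * (\<Prod>b\<in>(A - {a}) - {w}. a - b)"
        by (rule prod.remove) (use that fin in auto)
      moreover have "(A - {w}) - {a} = (A - {a}) - {w}" by auto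
      ultimately show ?thesis using that by simp
    qed
    have Lw: "L (A - {w}) = (\<Sum>a\<in>A. fps_const ((a - w) * (1 / (\<Prod>b\<in>A - {a}. a - b))) * geom a)"
      if "w \<in> A" for w
    proof -
      have "L (A - {w}) =
          (\<Sum>a\<in>A - {w}. fps_const ((a - w) * (1 / (\<Prod>b\<in>A - {a}. a - b))) * geom a)"
        unfolding L_def by (intro sum.cong) (simp_all only: coeff[OF that])
      also have "\<dots> = (\<Sum>a\<in>A. fps_const ((a - w) * (1 / (\<Prod>b\<in>A - {a}. a - b))) * geom a)"
        by (rule sum.mono_neutral_left) (use fin in auto)
      finally show ?thesis .
    qed
    have LA: "L A = (\<Sum>a\<in>A. fps_const (1 / (\<Prod>b\<in>A - {a}. a - b)) * geom a)"
      by (simp add: L_def)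
    have "L (A - {v}) - L (A - {u}) = fps_const (u - v) * L A"
      unfolding Lw[OF uv(1)] Lw[OF uv(2)] sum_subtractf[symmetric] LA sum_distrib_left
    proof (intro sum.cong refl)
      fix a
      let ?c = "1 / (\<Prod>b\<in>A - {a}. a - b)"
      have "fps_const ((a - v) * ?c) - fps_const ((a - u) * ?c) = fps_const ((u - v) * ?c)"
        unfolding fps_const_sub left_diff_distrib[symmetric] by simp
      then show "fps_const ((a - v) * ?c) * geom a - fps_const ((a - u) * ?c) * geom a =
          fps_const (u - v) * (fps_const ?c * geom a)"
        unfolding left_diff_distrib[symmetric] by (simp add: mult.assoc[symmetric])
    qed
    moreover have "L (A - {v}) - L (A - {u}) =
        fps_X ^ (card A - 2) * ((\<Prod>a\<in>A. geom a) * (lin v - lin u))"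
    proof -
      have "(\<Prod>a\<in>A - {w}. geom a) = (\<Prod>a\<in>A. geom a) * lin w" if "w \<in> A" for w
        using prod.remove[OF fin that, of geom] lin_geom[of w]
        by (simp add: mult.commute mult.left_commute)
      then show ?thesis using uv by (simp add: IH algebra_simps)
    qed
    moreover have "lin v - lin u = fps_const (u - v) * fps_X"
      by (simp add: lin_def algebra_simps flip: fps_const_sub)
    ultimately have "fps_const (u - v) * L A =
        fps_X ^ (card A - 2) * ((\<Prod>a\<in>A. geom a) * (fps_const (u - v) * fps_X))"
      by metis
    also have "\<dots> = fps_const (u - v) * (fps_X ^ Suc (card A - 2) * (\<Prod>a\<in>A. geom a))"
      by (simp add: mult_ac)
    also have "Suc (card A - 2) = card A - 1"
      using \<open>card A \<ge> 2\<close> by simp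
    finally have "fps_const (u - v) * L A =
        fps_const (u - v) * (fps_X ^ (card A - 1) * (\<Prod>a\<in>A. geom a))" .
    then show ?thesis using uv(3) by (simp add: L_def)
  qed
qed

text \<open>A linear factor multiplies a geometric tail by \<open>a - q i\<close> and delays its
  start by one index. As only the tail matters, groups of factors can be applied one after the
  other.\<close>

lemma lin_prod_nth:
  assumes "finite I" "\<And>r. F $ (m + r) = C * a ^ r"
  shows "((\<Prod>i\<in>I. lin (q i)) * F) $ (m + card I + r) = C * a ^ r * (\<Prod>i\<in>I. a - q i)"
  using assms(1)
proof (induction I arbitrary: r)
  case empty
  then show ?case by (simp add: assms(2))
next
  case (insert i I)
  show ?case
    using insert.IH[of "Suc r"] insert.IH[of r] insert.hyps
    by (simp add: mult.assoc lin_mult_nth) (simp add: algebra_simps)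
qed

text \<open>For the beta-set of a partition this is row length minus row index minus 1/2 (0-based),
  whatever the number of beads.\<close>

definition node :: "nat set \<Rightarrow> nat \<Rightarrow> real" where
  "node X x = real x - real (card X) + 1 / 2"

text \<open>The factor by which the product of the \<open>1 / x!\<close> and the Vandermonde product of a beta-set change
  when \<open>x\<close> is lowered to \<open>x - k\<close>, i.e. when a ribbon of size \<open>k\<close> is removed. It vanishes if \<open>x < k\<close> or
  \<open>x - k\<close> is already taken.\<close>

definition rho :: "nat \<Rightarrow> nat set \<Rightarrow> nat \<Rightarrow> real" where
  "rho k X x = (\<Prod>t<k. real x - real t) *
     (\<Prod>y\<in>X - {x}. (real x - real k - real y) / (real x - real y))"

definition rho_moment :: "nat \<Rightarrow> nat \<Rightarrow> nat set \<Rightarrow> real" where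
  "rho_moment k r X = (\<Sum>x\<in>X. rho k X x * node X x ^ r)"

text \<open>At a node the linear factors produce the numerator of \<open>rho\<close>:
  \<open>real t + 1/2 - N\<close> is the node of a bead at t, and subtracting
  \<open>node X y + real k\<close> gives x - k - y. The geometric factors supply the denominators
  through partial fractions.\<close>

definition rho_gf :: "nat \<Rightarrow> nat set \<Rightarrow> real fps" where
  "rho_gf k X = (\<Prod>t<k. lin (real t + 1 / 2 - real (card X))) *
     ((\<Prod>x\<in>X. lin (node X x + real k)) * (\<Prod>x\<in>X. geom (node X x)))"

lemma node_inj: "inj_on (node X) A"
  by (auto simp: inj_on_def node_def)

text \<open>Each partial fraction is a geometric series whose ratio is a node x, and the N + k
  linear factors turn it into the numerator of \<open>rho\<close> there. The one factor that
  \<open>rho\<close> lacks, y = x, equals -k. The power X^(N-1) from the partial fractions moves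
  index N + k + r to k + r + 1.\<close>

lemma rho_moment_eq:
  assumes "finite X" "X \<noteq> {}"
  shows "rho_gf k X $ (k + r + 1) = - real k * rho_moment k r X"
proof -
  let ?N = "card X"
  let ?c = "\<lambda>x. 1 / (\<Prod>y\<in>X - {x}. node X x - node X y)"
  let ?P = "(\<Prod>t<k. lin (real t + 1 / 2 - real ?N))"
  let ?Q = "(\<Prod>x\<in>X. lin (node X x + real k))"
  have N: "?N \<ge> 1" using assms by (simp add: Suc_le_eq card_gt_0_iff)
  have pf: "(\<Sum>x\<in>X. fps_const (?c x) * geom (node X x)) =
      fps_X ^ (?N - 1) * (\<Prod>x\<in>X. geom (node X x))"
  proof -
    have "(\<Prod>b\<in>node X ` X - {node X x}. node X x - b) = (\<Prod>y\<in>X - {x}. node X x - node X y)"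
      if "x \<in> X" for x
    proof -
      have "node X ` X - {node X x} = node X ` (X - {x})"
        using that node_inj[of X X] by (auto simp: inj_on_def)
      then show ?thesis by (simp add: prod.reindex node_inj)
    qed
    then show ?thesis
      using partial_fractions_geom[of "node X ` X"] assms
      by (simp add: sum.reindex prod.reindex node_inj card_image)
  qed
  have "rho_gf k X $ (k + r + 1) = (fps_X ^ (?N - 1) * rho_gf k X) $ (?N + k + r)"
    using N by (simp add: fps_X_power_mult_nth)
  also have "fps_X ^ (?N - 1) * rho_gf k X =
      (\<Sum>x\<in>X. fps_const (?c x) * (?P * (?Q * geom (node X x))))"
    using arg_cong[OF pf, of "\<lambda>F. ?P * (?Q * F)"]
    by (simp add: rho_gf_def sum_distrib_left mult_ac)
  also have "\<dots> $ (?N + k + r) = (\<Sum>x\<in>X. ?c x * (?P * (?Q * geom (node X x))) $ (?N + k + r))"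
    by (simp add: fps_sum_nth)
  also have "\<dots> = (\<Sum>x\<in>X. - real k * (rho k X x * node X x ^ r))"
  proof (rule sum.cong)
    fix x assume x: "x \<in> X"
    let ?a = "node X x"
    have "(?Q * geom ?a) $ (?N + r) = (\<Prod>y\<in>X. ?a - (node X y + real k)) * ?a ^ r" for r
      using lin_prod_nth[OF assms(1), of "geom ?a" 0 1 ?a "\<lambda>x. node X x + real k" r] by simp
    then have "(?P * (?Q * geom ?a)) $ (?N + k + r) =
        (\<Prod>y\<in>X. ?a - (node X y + real k)) * ?a ^ r * (\<Prod>t<k. ?a - (real t + 1 / 2 - real ?N))"
      using lin_prod_nth[of "{..<k}" "?Q * geom ?a" ?N _ ?a "\<lambda>t. real t + 1 / 2 - real ?N" r]
      by simp
    also have "(\<Prod>y\<in>X. ?a - (node X y + real k)) =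
        - real k * (\<Prod>y\<in>X - {x}. real x - real k - real y)"
      by (subst prod.remove[OF assms(1) x]) (simp add: node_def algebra_simps)
    finally show "?c x * (?P * (?Q * geom ?a)) $ (?N + k + r) = - real k * (rho k X x * ?a ^ r)"
      by (simp add: rho_def node_def prod_dividef)
  qed simp
  also have "\<dots> = - real k * rho_moment k r X"
    by (simp add: rho_moment_def sum_distrib_left)
  finally show ?thesis .
qed

text \<open>\<open>b\<close> is X F'/F, multiplied out. It adds up over products and is a geometric
  series for each linear factor, so its coefficients are power sums.\<close>

definition is_logderiv :: "real fps \<Rightarrow> real fps \<Rightarrow> bool" where
  "is_logderiv F b \<longleftrightarrow> fps_X * fps_deriv F = F * b"

lemma is_logderiv_1: "is_logderiv 1 0"
  by (simp add: is_logderiv_def)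

lemma is_logderiv_mult:
  "is_logderiv F b \<Longrightarrow> is_logderiv G c \<Longrightarrow> is_logderiv (F * G) (b + c)"
proof -
  assume "is_logderiv F b" "is_logderiv G c"
  then have "F * (fps_X * fps_deriv G) + (fps_X * fps_deriv F) * G = F * (G * c) + (F * b) * G"
    by (simp add: is_logderiv_def)
  then show "is_logderiv (F * G) (b + c)"
    by (simp add: is_logderiv_def algebra_simps)
qed

lemma is_logderiv_prod:
  assumes "\<And>i. i \<in> I \<Longrightarrow> is_logderiv (F i) (b i)"
  shows "is_logderiv (\<Prod>i\<in>I. F i) (\<Sum>i\<in>I. b i)"
  using assms by (induction I rule: infinite_finite_induct) (auto simp: is_logderiv_1 is_logderiv_mult)

lemma is_logderiv_lin: "is_logderiv (lin q) (1 - geom q)"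
proof -
  have "lin q * (1 - geom q) = lin q - 1" by (simp add: right_diff_distrib lin_geom)
  then show ?thesis by (simp add: is_logderiv_def lin_def mult.commute)
qed

lemma is_logderiv_geom: "is_logderiv (geom q) (geom q - 1)"
proof -
  have "lin q * fps_deriv (geom q) + fps_deriv (lin q) * geom q = 0"
    using arg_cong[OF lin_geom[of q], of fps_deriv] by simp
  then have "geom q * fps_X * (lin q * fps_deriv (geom q) + fps_deriv (lin q) * geom q) = 0"
    by simp
  then have "geom q * (fps_X * fps_deriv (lin q) * geom q + lin q * (fps_X * fps_deriv (geom q))) = 0"
    by (simp add: algebra_simps)
  moreover have "fps_X * fps_deriv (lin q) = lin q * (1 - geom q)"
    using is_logderiv_lin by (simp add: is_logderiv_def)
  ultimately have "(geom q * lin q) * ((1 - geom q) * geom q + fps_X * fps_deriv (geom q)) = 0"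
    by (simp add: algebra_simps)
  then have "(1 - geom q) * geom q + fps_X * fps_deriv (geom q) = 0"
    using lin_geom[of q] by (auto simp: mult.commute)
  then show ?thesis
    by (simp add: is_logderiv_def algebra_simps)
qed

lemma is_logderiv_nth:
  assumes "is_logderiv F b"
  shows "real n * F $ n = (\<Sum>i\<le>n. F $ i * b $ (n - i))"
proof -
  have "(fps_X * fps_deriv F) $ n = real n * F $ n" by (cases n) simp_all
  with assms show ?thesis by (simp add: is_logderiv_def fps_mult_nth atMost_atLeast0)
qed

text \<open>Power sum of the nodes relative to the staircase 0, ..., N - 1, the beta-set of the
  empty partition. The subtraction removes the dependence on the number of beads (compare
  \<open>psum_beta_set\<close>).\<close>

definition psum :: "nat \<Rightarrow> nat set \<Rightarrow> real" where
  "psum s X = (\<Sum>x\<in>X. node X x ^ s) - (\<Sum>i<card X. (real i - real (card X) + 1 / 2) ^ s)"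

definition rho_log :: "nat \<Rightarrow> nat set \<Rightarrow> real fps" where
  "rho_log k X = (\<Sum>t<k. 1 - geom (real t + 1 / 2 - real (card X))) +
     ((\<Sum>x\<in>X. 1 - geom (node X x + real k)) + (\<Sum>x\<in>X. geom (node X x) - 1))"

lemma is_logderiv_rho_gf: "is_logderiv (rho_gf k X) (rho_log k X)"
  unfolding rho_gf_def rho_log_def
  by (intro is_logderiv_mult is_logderiv_prod is_logderiv_lin is_logderiv_geom)

lemma binomial_diff:
  fixes a c :: real
  shows "(a + c) ^ m - a ^ m = (\<Sum>s<m. real (m choose s) * c ^ (m - s) * a ^ s)"
proof -
  have "(a + c) ^ m = (\<Sum>s\<le>m. real (m choose s) * a ^ s * c ^ (m - s))"
    by (rule binomial_ring)
  also have "\<dots> = (\<Sum>s<m. real (m choose s) * a ^ s * c ^ (m - s)) + a ^ m"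
    by (simp add: lessThan_Suc_atMost[symmetric])
  finally show ?thesis by (simp add: mult_ac)
qed


lemma sum_shift_diff:
  fixes f :: "nat \<Rightarrow> real"
  shows "(\<Sum>i<N. f (i + k) - f i) = (\<Sum>t<k. f (N + t) - f t)"
proof (induction N)
  case 0
  then show ?case by simp
next
  case (Suc N)
  have "(\<Sum>t<k. f (Suc N + t) - f (N + t)) = f (N + k) - f N"
    using sum_lessThan_telescope[of "\<lambda>t. f (N + t)" k] by simp
  then show ?case using Suc by (simp add: sum_subtractf)
qed

text \<open>Why N enters through \<open>psum\<close> alone: completing the node sums to
  \<open>psum\<close> costs the same sums over the staircase, and these telescope in steps of k to k
  terms at each end. The terms (t + 1/2 - N)^m cancel against the first product of
  \<open>rho_gf\<close>; the terms (t + 1/2)^m remain as constants.\<close>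

lemma rho_log_nth:
  assumes "m \<ge> 1"
  shows "rho_log k X $ m =
    - (\<Sum>s<m. real (m choose s) * real k ^ (m - s) * psum s X) - (\<Sum>t<k. (real t + 1 / 2) ^ m)"
proof -
  let ?N = "card X"
  let ?f = "\<lambda>i. (real i - real ?N + 1 / 2) ^ m"
  let ?e = "\<lambda>i::nat. real i - real ?N + 1 / 2"
  have "(\<Sum>i<?N. (?e i + real k) ^ m - ?e i ^ m) = (\<Sum>i<?N. ?f (i + k) - ?f i)"
    by (intro sum.cong) (simp_all add: algebra_simps)
  also have "\<dots> = (\<Sum>t<k. ?f (?N + t) - ?f t)"
    by (rule sum_shift_diff)
  finally have e: "(\<Sum>i<?N. (?e i + real k) ^ m - ?e i ^ m) =
      (\<Sum>t<k. (real t + 1 / 2) ^ m) - (\<Sum>t<k. (real t + 1 / 2 - real ?N) ^ m)"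
    by (simp add: sum_subtractf algebra_simps)
  have "(\<Sum>s<m. real (m choose s) * real k ^ (m - s) * psum s X) =
      (\<Sum>x\<in>X. \<Sum>s<m. real (m choose s) * real k ^ (m - s) * node X x ^ s) -
      (\<Sum>i<?N. \<Sum>s<m. real (m choose s) * real k ^ (m - s) * ?e i ^ s)"
    unfolding sum.swap[of _ "{..<m}"]
    by (simp add: psum_def right_diff_distrib sum_subtractf sum_distrib_left)
  also have "\<dots> = (\<Sum>x\<in>X. (node X x + real k) ^ m - node X x ^ m) -
      (\<Sum>i<?N. (?e i + real k) ^ m - ?e i ^ m)"
    unfolding binomial_diff ..
  finally show ?thesis
    using assms e by (simp add: rho_log_def fps_sum_nth sum_subtractf sum_negf)
qed

text \<open>The coefficients must not depend on the size of the set, since beta-sets grow with \<open>n\<close>.\<close>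

inductive psum_poly :: "nat \<Rightarrow> (nat set \<Rightarrow> real) \<Rightarrow> bool" where
  const: "psum_poly d (\<lambda>X. c)"
| psum: "psum_poly d f \<Longrightarrow> s \<ge> 1 \<Longrightarrow> psum_poly (s + d) (\<lambda>X. psum s X * f X)"
| add: "psum_poly d f \<Longrightarrow> psum_poly d g \<Longrightarrow> psum_poly d (\<lambda>X. f X + g X)"
| mono: "psum_poly d f \<Longrightarrow> d \<le> e \<Longrightarrow> psum_poly e f"
| cong: "psum_poly d f \<Longrightarrow> (\<And>X. finite X \<Longrightarrow> X \<noteq> {} \<Longrightarrow> g X = f X) \<Longrightarrow> psum_poly d g"

lemma psum_poly_mult:
  assumes "psum_poly d f" "psum_poly e g"
  shows "psum_poly (d + e) (\<lambda>X. f X * g X)"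
  using assms
proof (induction rule: psum_poly.induct)
  case (const d c)
  have "psum_poly e (\<lambda>X. c * g X)"
    using const
  proof (induction rule: psum_poly.induct)
    case (const d c')
    show ?case by (rule psum_poly.const)
  next
    case (psum d f s)
    then show ?case
      using psum_poly.psum[of d "\<lambda>X. c * f X" s] by (simp add: mult_ac)
  next
    case (add d f g)
    then show ?case using psum_poly.add by (simp add: distrib_left)
  next
    case (mono d f e)
    then show ?case using psum_poly.mono by blast
  next
    case (cong d f g)
    from cong.IH show ?case by (rule psum_poly.cong) (simp add: cong.hyps)
  qed
  then show ?case by (rule psum_poly.mono) simp
next
  case (psum d f s)
  then show ?case using psum_poly.psum[of "d + e" "\<lambda>X. f X * g X" s] by (simp add: mult_ac add_ac)
next
  case (add d f h)
  then show ?case using psum_poly.add by (simp add: distrib_right)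
next
  case (mono d f d')
  then show ?case using psum_poly.mono by (meson add_le_mono1)
next
  case (cong d f h)
  from cong.IH[OF cong.prems] show ?case by (rule psum_poly.cong) (simp add: cong.hyps)
qed

lemma psum_poly_mult_le:
  "psum_poly d f \<Longrightarrow> psum_poly e g \<Longrightarrow> d + e \<le> n \<Longrightarrow> psum_poly n (\<lambda>X. f X * g X)"
  using psum_poly.mono psum_poly_mult by blast

lemma psum_poly_cmult: "psum_poly d f \<Longrightarrow> psum_poly d (\<lambda>X. c * f X)"
  using psum_poly_mult[OF psum_poly.const[of 0 c]] by simp

lemma psum_poly_uminus: "psum_poly d f \<Longrightarrow> psum_poly d (\<lambda>X. - f X)"
  using psum_poly_cmult[of d f "-1"] by simp

lemma psum_poly_diff:
  "psum_poly d f \<Longrightarrow> psum_poly d g \<Longrightarrow> psum_poly d (\<lambda>X. f X - g X)"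
  using psum_poly.add[of d f "\<lambda>X. - g X"] psum_poly_uminus by simp

lemma psum_poly_sum:
  assumes "\<And>i. i \<in> I \<Longrightarrow> psum_poly d (f i)"
  shows "psum_poly d (\<lambda>X. \<Sum>i\<in>I. f i X)"
  using assms by (induction I rule: infinite_finite_induct) (auto intro: psum_poly.const psum_poly.add)

lemma psum_poly_psum: "psum_poly s (psum s)"
proof (cases "s = 0")
  case True
  have "psum_poly 0 (\<lambda>X. 0)" by (rule psum_poly.const)
  then show ?thesis
    unfolding True by (rule psum_poly.cong) (simp add: psum_def)
next
  case False
  then show ?thesis using psum_poly.psum[OF psum_poly.const[of 0 1], of s] by simp
qed

text \<open>With weight s for \<open>psum s\<close>, weight d means growth of order n^d. One
  constant serves sets of all sizes. The premise on \<open>psum\<close> is met by the beta-sets of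
  partitions of n (\<open>psum_beta_set_bound\<close>).\<close>

lemma psum_poly_bound:
  assumes "psum_poly d f"
  shows "\<exists>C. \<forall>X n. finite X \<longrightarrow> X \<noteq> {} \<longrightarrow> n \<ge> 1 \<longrightarrow> (\<forall>s\<ge>1. \<bar>psum s X\<bar> \<le> real n ^ s) \<longrightarrow>
    \<bar>f X\<bar> \<le> C * real n ^ d"
  using assms
proof (induction rule: psum_poly.induct)
  case (const d c)
  show ?case
    by (rule exI[of _ "\<bar>c\<bar>"]) (simp add: mult_le_cancel_left1)
next
  case (psum d f s)
  then obtain C where C: "\<And>X n. finite X \<Longrightarrow> X \<noteq> {} \<Longrightarrow> n \<ge> 1 \<Longrightarrow>
      (\<forall>s\<ge>1. \<bar>psum s X\<bar> \<le> real n ^ s) \<Longrightarrow> \<bar>f X\<bar> \<le> C * real n ^ d"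
    by blast
  show ?case
  proof (intro exI[of _ C] allI impI)
    fix X :: "nat set" and n :: nat
    assume X: "finite X" "X \<noteq> {}" "n \<ge> 1" "\<forall>s\<ge>1. \<bar>psum s X\<bar> \<le> real n ^ s"
    have "\<bar>psum s X\<bar> * \<bar>f X\<bar> \<le> real n ^ s * (C * real n ^ d)"
      by (rule mult_mono) (use X psum.hyps C[OF X] in auto)
    then show "\<bar>psum s X * f X\<bar> \<le> C * real n ^ (s + d)"
      by (simp add: abs_mult power_add mult_ac)
  qed
next
  case (add d f g)
  then obtain C D where C: "\<And>X n. finite X \<Longrightarrow> X \<noteq> {} \<Longrightarrow> n \<ge> 1 \<Longrightarrow>
      (\<forall>s\<ge>1. \<bar>psum s X\<bar> \<le> real n ^ s) \<Longrightarrow> \<bar>f X\<bar> \<le> C * real n ^ d"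
    "\<And>X n. finite X \<Longrightarrow> X \<noteq> {} \<Longrightarrow> n \<ge> 1 \<Longrightarrow>
      (\<forall>s\<ge>1. \<bar>psum s X\<bar> \<le> real n ^ s) \<Longrightarrow> \<bar>g X\<bar> \<le> D * real n ^ d"
    by metis
  show ?case
    by (rule exI[of _ "C + D"], intro allI impI, rule order_trans[OF abs_triangle_ineq])
      (use C in \<open>simp add: distrib_right add_mono\<close>)
next
  case (mono d f e)
  then obtain C where C: "\<And>X n. finite X \<Longrightarrow> X \<noteq> {} \<Longrightarrow> n \<ge> 1 \<Longrightarrow>
      (\<forall>s\<ge>1. \<bar>psum s X\<bar> \<le> real n ^ s) \<Longrightarrow> \<bar>f X\<bar> \<le> C * real n ^ d"
    by blast
  show ?case
  proof (intro exI[of _ "\<bar>C\<bar>"] allI impI)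
    fix X :: "nat set" and n :: nat
    assume X: "finite X" "X \<noteq> {}" "n \<ge> 1" "\<forall>s\<ge>1. \<bar>psum s X\<bar> \<le> real n ^ s"
    have "C * real n ^ d \<le> \<bar>C\<bar> * real n ^ e"
      by (rule mult_mono) (use X mono.hyps in \<open>auto intro: power_increasing\<close>)
    with C[OF X] show "\<bar>f X\<bar> \<le> \<bar>C\<bar> * real n ^ e" by simp
  qed
next
  case (cong d f g)
  then obtain C where C: "\<And>X n. finite X \<Longrightarrow> X \<noteq> {} \<Longrightarrow> n \<ge> 1 \<Longrightarrow>
      (\<forall>s\<ge>1. \<bar>psum s X\<bar> \<le> real n ^ s) \<Longrightarrow> \<bar>f X\<bar> \<le> C * real n ^ d"
    by blast
  show ?case
    by (rule exI[of _ C]) (use C cong.hyps(2) in simp)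
qed

text \<open>The top term of the binomial sum in \<open>rho_log_nth\<close> is s = m - 1, with
  coefficient -m k; without it the sum stops at s = m - 2. For m = 1 only the constants remain,
  which fits the truncated weight 0.\<close>

lemma psum_poly_rho_log:
  assumes "m \<ge> 1"
  shows "psum_poly (m - 1) (\<lambda>X. rho_log k X $ m)"
    and "psum_poly (m - 2) (\<lambda>X. rho_log k X $ m + real m * real k * psum (m - 1) X)"
proof -
  show "psum_poly (m - 1) (\<lambda>X. rho_log k X $ m)"
    unfolding rho_log_nth[OF assms]
    by (intro psum_poly_diff psum_poly_uminus psum_poly_sum psum_poly.const psum_poly_cmult
        psum_poly.mono[OF psum_poly_psum]) auto
  have "rho_log k X $ m + real m * real k * psum (m - 1) X =
      - (\<Sum>s<m - 1. real (m choose s) * real k ^ (m - s) * psum s X) - (\<Sum>t<k. (real t + 1 / 2) ^ m)"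
    for X
  proof -
    obtain j where j: "m = Suc j" using assms by (cases m) auto
    show ?thesis unfolding rho_log_nth[OF assms] by (simp add: j)
  qed
  then show "psum_poly (m - 2) (\<lambda>X. rho_log k X $ m + real m * real k * psum (m - 1) X)"
    by (simp only:) (intro psum_poly_diff psum_poly_uminus psum_poly_sum psum_poly.const psum_poly_cmult
        psum_poly.mono[OF psum_poly_psum], auto)
qed

lemma rho_gf_0: "rho_gf k X $ 0 = 1"
proof -
  have "(\<Prod>i\<in>I. F i) $ 0 = (\<Prod>i\<in>I. F i $ 0)" for F :: "nat \<Rightarrow> real fps" and I
    by (induction I rule: infinite_finite_induct) simp_all
  then show ?thesis by (simp add: rho_gf_def lin_def)
qed

lemma rho_gf_rec:
  assumes "m \<ge> 1"
  shows "real m * rho_gf k X $ m =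
    rho_log k X $ m + (\<Sum>i\<in>{1..<m}. rho_gf k X $ i * rho_log k X $ (m - i))"
proof -
  have 0: "rho_log k X $ 0 = 0"
    by (simp add: rho_log_def fps_sum_nth)
  have "{..m} = insert 0 (insert m {1..<m})" using assms by auto
  then show ?thesis
    using is_logderiv_nth[OF is_logderiv_rho_gf, of m k X] assms by (simp add: 0 rho_gf_0)
qed

text \<open>In both series the coefficient of index i >= 1 has weight i - 1, so a product with
  indices adding up to m has weight m - 2, one below the linear term of \<open>rho_gf_rec\<close>.
  To leading order the exponential is therefore linear.\<close>

lemma psum_poly_rho_gf_tail:
  "psum_poly (m - 2) (\<lambda>X. \<Sum>i\<in>{1..<m}. rho_gf k X $ i * rho_log k X $ (m - i))"
proof -
  have tail: "psum_poly (m - 2) (\<lambda>X. \<Sum>i\<in>{1..<m}. rho_gf k X $ i * rho_log k X $ (m - i))"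
    if "\<And>i. i < m \<Longrightarrow> psum_poly (i - 1) (\<lambda>X. rho_gf k X $ i)" for m
    by (rule psum_poly_sum, rule psum_poly_mult_le[OF that psum_poly_rho_log(1)]) auto
  have main: "psum_poly (m - 1) (\<lambda>X. rho_gf k X $ m)" for m
  proof (induction m rule: less_induct)
    case (less m)
    show ?case
    proof (cases "m = 0")
      case True
      then show ?thesis by (simp add: rho_gf_0 psum_poly.const)
    next
      case False
      have "psum_poly (m - 1) (\<lambda>X. (1 / real m) *
          (rho_log k X $ m + (\<Sum>i\<in>{1..<m}. rho_gf k X $ i * rho_log k X $ (m - i))))"
        by (intro psum_poly_cmult psum_poly.add psum_poly_rho_log psum_poly.mono[OF tail] less.IH)
          (use False in auto)
      then show ?thesis
        by (rule psum_poly.cong) (use False rho_gf_rec[of m k] in \<open>simp add: field_simps\<close>)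
    qed
  qed
  show ?thesis
    by (rule tail, rule main)
qed

text \<open>In the coefficient of index m = k + r + 1 only the top term -k \<open>psum\<close> (m -
  1) of the logarithmic derivative counts, after division by m. Its factor -k cancels the one in
  \<open>rho_moment_eq\<close>.\<close>

lemma psum_poly_rho_moment:
  assumes "k \<ge> 1"
  shows "psum_poly (k + r - 1) (\<lambda>X. rho_moment k r X - psum (k + r) X)"
proof -
  let ?m = "k + r + 1"
  have alg: "M - P = (- 1 / (c * m)) * ((L + m * c * P) + R)"
    if "c \<noteq> 0" "m \<noteq> 0" "L + R = - (c * m) * M" for L R M P c m :: real
  proof -
    have "(L + m * c * P) + R = (L + R) + m * c * P" by simp
    also have "\<dots> = - (c * m) * (M - P)" unfolding that(3) by (simp add: algebra_simps)
    finally show ?thesis using that(1,2) by simp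
  qed
  have "psum_poly (?m - 2) (\<lambda>X. (- 1 / (real k * real ?m)) *
      ((rho_log k X $ ?m + real ?m * real k * psum (?m - 1) X) +
       (\<Sum>i\<in>{1..<?m}. rho_gf k X $ i * rho_log k X $ (?m - i))))"
    by (intro psum_poly_cmult psum_poly.add psum_poly_rho_log(2) psum_poly_rho_gf_tail) auto
  then have "psum_poly (?m - 2) (\<lambda>X. rho_moment k r X - psum (k + r) X)"
  proof (rule psum_poly.cong)
    fix X :: "nat set" assume X: "finite X" "X \<noteq> {}"
    let ?R = "\<Sum>i\<in>{1..<?m}. rho_gf k X $ i * rho_log k X $ (?m - i)"
    have "real ?m * (- real k * rho_moment k r X) = rho_log k X $ ?m + ?R"
      using rho_gf_rec[of ?m k X] unfolding rho_moment_eq[OF X, of k r] by simp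
    then have "rho_log k X $ ?m + ?R = real ?m * (- real k * rho_moment k r X)"
      by (rule sym)
    also have "\<dots> = - (real k * real ?m) * rho_moment k r X"
      by (simp only: mult_minus_left mult_minus_right mult_ac)
    finally have "rho_log k X $ ?m + ?R = - (real k * real ?m) * rho_moment k r X" .
    moreover have "?m - 1 = k + r" by simp
    ultimately show "rho_moment k r X - psum (k + r) X = (- 1 / (real k * real ?m)) *
      ((rho_log k X $ ?m + real ?m * real k * psum (?m - 1) X) + ?R)"
      using assms by (simp only:) (rule alg, simp_all)
  qed
  then show ?thesis by simp
qed

text \<open>In this case there is no error term: only the coefficient of index 2 is involved, and
  its constants 1/4 cancel. The exact value drives both the dimension formula for tableaux and the
  total mass of a level.\<close>

lemma rho_moment_1:
  assumes "finite X" "X \<noteq> {}"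
  shows "rho_moment 1 0 X = psum 1 X"
proof -
  have "rho_gf 1 X $ 1 = rho_log 1 X $ 1"
    using rho_gf_rec[of 1 1 X] by simp
  also have "\<dots> = - 1 / 2"
    by (simp add: rho_log_nth psum_def)
  finally have "2 * rho_gf 1 X $ 2 = rho_log 1 X $ 2 + 1 / 4"
    using rho_gf_rec[of 2 1 X] by (simp add: rho_log_nth psum_def atLeastLessThan_nat_numeral)
  also have "rho_log 1 X $ 2 = - 2 * psum 1 X - 1 / 4"
    by (simp add: rho_log_nth psum_def numeral_2_eq_2)
  finally show ?thesis
    using rho_moment_eq[OF assms, of 1 0] by (simp add: numeral_2_eq_2)
qed

section \<open>Removing ribbons from beta-sets\<close>

definition lower :: "nat \<Rightarrow> nat set \<Rightarrow> nat \<Rightarrow> nat set" where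
  "lower k X x = insert (x - k) (X - {x})"

text \<open>Makes two defaults of \<open>lower\<close> harmless, the truncated subtraction for x < k
  and the collapse of two beads into one: in both cases the weight vanishes, so a sum over all beads
  is a sum over legal removals.\<close>

lemma rho_eq_0:
  assumes "finite X" "x < k \<or> x - k \<in> X - {x}" "k \<ge> 1"
  shows "rho k X x = 0"
proof (cases "x < k")
  case True
  then have "(\<Prod>t<k. real x - real t) = 0" by (intro prod_zero) auto
  then show ?thesis by (simp add: rho_def)
next
  case False
  with assms have "(\<Prod>y\<in>X - {x}. (real x - real k - real y) / (real x - real y)) = 0"
    by (intro prod_zero) (auto intro!: bexI[of _ "x - k"])
  then show ?thesis by (simp add: rho_def)
qed

lemma card_lower:
  assumes "finite X" "x \<in> X" "x - k \<notin> X - {x}"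
  shows "card (lower k X x) = card X"
  using assms by (simp add: lower_def card.insert_remove card_Diff_singleton)
    (metis Suc_pred card_gt_0_iff empty_iff)

lemma psum_lower:
  assumes "finite X" "x \<in> X" "x - k \<notin> X - {x}" "k \<le> x"
  shows "psum s (lower k X x) = psum s X + (\<Sum>t<s. real (s choose t) * (- real k) ^ (s - t) * node X x ^ t)"
proof -
  have c: "card (lower k X x) = card X" by (rule card_lower) fact+
  have "(\<Sum>y\<in>lower k X x. node (lower k X x) y ^ s) =
      (node X x - real k) ^ s + (\<Sum>y\<in>X - {x}. node X y ^ s)"
    using assms c by (simp add: lower_def node_def of_nat_diff algebra_simps)
  also have "(\<Sum>y\<in>X - {x}. node X y ^ s) = (\<Sum>y\<in>X. node X y ^ s) - node X x ^ s"
    using assms by (simp add: sum_diff1)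
  finally show ?thesis
    using binomial_diff[of "node X x" "- real k" s] by (simp add: psum_def c)
qed

text \<open>For r = 0 this is the transpose of multiplication by the k-th power sum, see
  \<open>power_sum_level_sum\<close>. The power r of the node serves the induction in
  \<open>psum_poly_lower_op\<close>.\<close>

definition lower_op :: "nat \<Rightarrow> nat \<Rightarrow> (nat set \<Rightarrow> real) \<Rightarrow> nat set \<Rightarrow> real" where
  "lower_op k r f X = (\<Sum>x\<in>X. rho k X x * node X x ^ r * f (lower k X x))"

text \<open>Lowering a bead changes \<open>psum s\<close> by a polynomial of degree below s in its
  node (\<open>psum_lower\<close>). Such a term trades the weight s for t < s additional powers of
  the node, so f can be pulled out of the sum at the cost of one unit of weight. As r grows in the
  process, the induction runs over all r at once.\<close>

lemma psum_poly_lower_op: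
  assumes "psum_poly d f" "k \<ge> 1"
  shows "psum_poly (k + r + d - 1) (\<lambda>X. lower_op k r f X - rho_moment k r X * f X)"
  using assms(1)
proof (induction arbitrary: r rule: psum_poly.induct)
  case (const d c)
  have "lower_op k r (\<lambda>X. c) X - rho_moment k r X * c = 0" for X
    unfolding lower_op_def rho_moment_def sum_distrib_right by simp
  then show ?case by (simp add: psum_poly.const)
next
  case (psum d f s)
  let ?c = "\<lambda>t. real (s choose t) * (- real k) ^ (s - t)"
  have rho_m: "psum_poly (k + t) (rho_moment k t)" for t
  proof -
    have "psum_poly (k + t) (\<lambda>X. (rho_moment k t X - psum (k + t) X) + psum (k + t) X)"
      by (intro psum_poly.add psum_poly_psum psum_poly.mono[OF psum_poly_rho_moment]) (use assms in auto)
    then show ?thesis by simp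
  qed
  have "psum_poly (k + r + (s + d) - 1) (\<lambda>X. psum s X * (lower_op k r f X - rho_moment k r X * f X) +
      (\<Sum>t<s. ?c t * ((lower_op k (r + t) f X - rho_moment k (r + t) X * f X) +
                       rho_moment k (r + t) X * f X)))"
  proof (intro psum_poly.add psum_poly_sum psum_poly_cmult)
    show "psum_poly (k + r + (s + d) - 1) (\<lambda>X. psum s X * (lower_op k r f X - rho_moment k r X * f X))"
      by (rule psum_poly_mult_le[OF psum_poly_psum psum.IH]) (use assms in auto)
    fix t assume "t \<in> {..<s}"
    then show "psum_poly (k + r + (s + d) - 1) (\<lambda>X. lower_op k (r + t) f X - rho_moment k (r + t) X * f X)"
      "psum_poly (k + r + (s + d) - 1) (\<lambda>X. rho_moment k (r + t) X * f X)"
      by (auto intro!: psum_poly.mono[OF psum.IH] psum_poly_mult_le[OF rho_m psum.hyps(1)])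
  qed
  then show ?case
  proof (rule psum_poly.cong)
    fix X :: "nat set" assume X: "finite X" "X \<noteq> {}"
    have "lower_op k r (\<lambda>X. psum s X * f X) X =
        (\<Sum>x\<in>X. rho k X x * node X x ^ r * ((psum s X + (\<Sum>t<s. ?c t * node X x ^ t)) * f (lower k X x)))"
      unfolding lower_op_def
    proof (rule sum.cong)
      fix x assume "x \<in> X"
      then show "rho k X x * node X x ^ r * (psum s (lower k X x) * f (lower k X x)) =
        rho k X x * node X x ^ r * ((psum s X + (\<Sum>t<s. ?c t * node X x ^ t)) * f (lower k X x))"
        using psum_lower[OF X(1), of x k s] rho_eq_0[OF X(1), of x k] assms(2)
        by (cases "x < k \<or> x - k \<in> X - {x}") (auto simp: not_less)
    qed simp
    also have "\<dots> = psum s X * lower_op k r f X + (\<Sum>t<s. ?c t * lower_op k (r + t) f X)"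
      unfolding lower_op_def sum_distrib_left sum.swap[of _ _ X]
      by (simp add: sum.distrib distrib_left distrib_right sum_distrib_left sum_distrib_right
          power_add mult_ac) (rule sum.swap)
    finally show "lower_op k r (\<lambda>X. psum s X * f X) X - rho_moment k r X * (psum s X * f X) =
      psum s X * (lower_op k r f X - rho_moment k r X * f X) +
      (\<Sum>t<s. ?c t * ((lower_op k (r + t) f X - rho_moment k (r + t) X * f X) +
                       rho_moment k (r + t) X * f X))"
      by (simp add: algebra_simps)
  qed
next
  case (add d f g)
  have "lower_op k r (\<lambda>X. f X + g X) X = lower_op k r f X + lower_op k r g X" for X
    by (simp add: lower_op_def distrib_left sum.distrib)
  then show ?case
    using psum_poly.add[OF add.IH(1)[of r] add.IH(2)[of r]] by (simp add: algebra_simps)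
next
  case (mono d f e)
  from mono.IH[of r] show ?case by (rule psum_poly.mono) (use mono.hyps in simp)
next
  case (cong d f g)
  from cong.IH[of r] show ?case
  proof (rule psum_poly.cong)
    fix X :: "nat set" assume X: "finite X" "X \<noteq> {}"
    \<comment> \<open>Agreement is known on nonempty finite sets only; lowering a bead stays inside
      this class.\<close>
    have "g (lower k X x) = f (lower k X x)" for x
      by (rule cong.hyps) (use X in \<open>auto simp: lower_def\<close>)
    then show "lower_op k r g X - rho_moment k r X * g X = lower_op k r f X - rho_moment k r X * f X"
      using cong.hyps(2)[OF X] by (simp add: lower_op_def)
  qed
qed

fun lower_ops :: "nat list \<Rightarrow> nat set \<Rightarrow> real" where
  "lower_ops [] = (\<lambda>X. 1)"
| "lower_ops (k # ks) = lower_op k 0 (lower_ops ks)"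

lemma psum_poly_prod_list: "psum_poly (sum_list ks) (\<lambda>X. \<Prod>k\<leftarrow>ks. psum k X)"
  by (induction ks) (auto intro: psum_poly.const psum_poly_mult psum_poly_psum)

text \<open>Each operator acts to leading order as multiplication by \<open>psum k\<close>. The
  error splits into three parts: pulling out the inner function, replacing \<open>rho_moment\<close>
  by \<open>psum\<close>, and the inner error from the induction.\<close>

lemma psum_poly_lower_ops:
  assumes "\<forall>k\<in>set ks. k \<ge> 1"
  shows "psum_poly (sum_list ks - 1) (\<lambda>X. lower_ops ks X - (\<Prod>k\<leftarrow>ks. psum k X))"
  using assms
proof (induction ks)
  case Nil
  then show ?case by (simp add: psum_poly.const)
next
  case (Cons k ks)
  let ?Q = "\<lambda>X. \<Prod>k\<leftarrow>ks. psum k X"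
  have k: "k \<ge> 1" using Cons.prems by simp
  have IH: "psum_poly (sum_list ks - 1) (\<lambda>X. lower_ops ks X - ?Q X)"
    using Cons by simp
  have ops: "psum_poly (sum_list ks) (lower_ops ks)"
    using psum_poly.add[OF psum_poly.mono[OF IH, of "sum_list ks"] psum_poly_prod_list[of ks]] by simp
  have "psum_poly (k + sum_list ks - 1) (\<lambda>X. psum k X * (lower_ops ks X - ?Q X))"
  \<comment> \<open>For the empty list \<open>sum_list ks - 1\<close> truncates to 0 and no weight
    is gained, but then the difference itself is 0.\<close>
  proof (cases "ks = []")
    case True
    then show ?thesis by (simp add: psum_poly.const)
  next
    case False
    then have "sum_list ks \<ge> 1"
      using Cons.prems by (cases ks) auto
    then show ?thesis
      by (intro psum_poly_mult_le[OF psum_poly_psum IH]) auto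
  qed
  moreover have "psum_poly (k + sum_list ks - 1)
      (\<lambda>X. (rho_moment k 0 X - psum k X) * lower_ops ks X)"
    using psum_poly_mult_le[OF psum_poly_rho_moment[OF k, of 0] ops] k by simp
  moreover have "psum_poly (k + sum_list ks - 1)
      (\<lambda>X. lower_op k 0 (lower_ops ks) X - rho_moment k 0 X * lower_ops ks X)"
    using psum_poly_lower_op[OF ops k, of 0] by simp
  ultimately have "psum_poly (k + sum_list ks - 1)
      (\<lambda>X. (lower_op k 0 (lower_ops ks) X - rho_moment k 0 X * lower_ops ks X) +
        ((rho_moment k 0 X - psum k X) * lower_ops ks X + psum k X * (lower_ops ks X - ?Q X)))"
    by (intro psum_poly.add)
  then show ?case by (simp add: algebra_simps)
qed

section \<open>Jacobi--Trudi determinants\<close>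

lemma det_replace_col:
  fixes A :: "'a :: comm_ring_1 mat"
  assumes "A \<in> carrier_mat n n" "j < n"
  shows "det (mat n n (\<lambda>(a, b). if b = j then v a else A $$ (a, b))) = (\<Sum>i<n. v i * cofactor A i j)"
proof -
  let ?B = "mat n n (\<lambda>(a, b). if b = j then v a else A $$ (a, b))"
  have "det ?B = (\<Sum>i<n. ?B $$ (i, j) * cofactor ?B i j)"
    by (rule laplace_expansion_column) (use assms in auto)
  also have "\<dots> = (\<Sum>i<n. v i * cofactor A i j)"
  proof (intro sum.cong refl)
    fix i assume "i \<in> {..<n}"
    then have "mat_delete ?B i j = mat_delete A i j"
      using assms unfolding mat_delete_def by (intro eq_matI) auto
    with \<open>i \<in> {..<n}\<close> assms show "?B $$ (i, j) * cofactor ?B i j = v i * cofactor A i j"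
      by (simp add: cofactor_def)
  qed
  finally show ?thesis .
qed

lemma det_replace_row:
  fixes A :: "'a :: comm_ring_1 mat"
  assumes "A \<in> carrier_mat n n" "i < n"
  shows "det (mat n n (\<lambda>(a, b). if a = i then v b else A $$ (a, b))) = (\<Sum>j<n. v j * cofactor A i j)"
proof -
  let ?B = "mat n n (\<lambda>(a, b). if a = i then v b else A $$ (a, b))"
  have "det ?B = (\<Sum>j<n. ?B $$ (i, j) * cofactor ?B i j)"
    by (rule laplace_expansion_row) (use assms in auto)
  also have "\<dots> = (\<Sum>j<n. v j * cofactor A i j)"
  proof (intro sum.cong refl)
    fix j assume "j \<in> {..<n}"
    then have "mat_delete ?B i j = mat_delete A i j"
      using assms unfolding mat_delete_def by (intro eq_matI) auto
    with \<open>j \<in> {..<n}\<close> assms show "?B $$ (i, j) * cofactor ?B i j = v j * cofactor A i j"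
      by (simp add: cofactor_def)
  qed
  finally show ?thesis .
qed

lemma det_equal_cols:
  fixes A :: "'a :: comm_ring_1 mat"
  assumes "A \<in> carrier_mat n n" "j < n" "b < n" "b \<noteq> j" "\<And>i. i < n \<Longrightarrow> v i = A $$ (i, b)"
  shows "(\<Sum>i<n. v i * cofactor A i j) = 0"
proof -
  let ?B = "mat n n (\<lambda>(a, c). if c = j then v a else A $$ (a, c))"
  have "col ?B b = col ?B j"
    by (rule eq_vecI) (use assms in auto)
  then have "det ?B = 0"
    using det_identical_columns[of ?B n b j] assms by auto
  then show ?thesis using det_replace_col[OF assms(1,2), of v] by simp
qed

text \<open>Pigeonhole in the Leibniz formula: no permutation sends the rows R into the fewer
  columns C, so every term contains a zero.\<close>

lemma det_eq_0_if_zero_block: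
  fixes A :: "'a :: comm_ring_1 mat"
  assumes A: "A \<in> carrier_mat n n" and RC: "R \<subseteq> {0..<n}" "finite C" "card C < card R"
    and zero: "\<And>r c. r \<in> R \<Longrightarrow> c < n \<Longrightarrow> c \<notin> C \<Longrightarrow> A $$ (r, c) = 0"
  shows "det A = 0"
proof -
  have "(\<Prod>i = 0..<n. A $$ (i, \<pi> i)) = 0" if \<pi>: "\<pi> permutes {0..<n}" for \<pi>
  proof -
    have "\<not> \<pi> ` R \<subseteq> C"
    proof
      assume "\<pi> ` R \<subseteq> C"
      then have "card (\<pi> ` R) \<le> card C" by (rule card_mono[OF RC(2)])
      moreover have "card (\<pi> ` R) = card R"
        using \<pi> by (metis card_image inj_on_subset permutes_inj subset_UNIV)
      ultimately show False using RC(3) by simp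
    qed
    then obtain r where r: "r \<in> R" "\<pi> r \<notin> C" by auto
    moreover have "\<pi> r < n" using r RC(1) permutes_in_image[OF \<pi>, of r] by auto
    ultimately show ?thesis
      using zero[of r "\<pi> r"] RC(1) by (intro prod_zero) auto
  qed
  then show ?thesis by (simp add: det_def'[OF A])
qed

section \<open>Power sums acting on Jacobi--Trudi determinants\<close>

definition newton_pair :: "(nat \<Rightarrow> real) \<Rightarrow> (nat \<Rightarrow> real) \<Rightarrow> bool" where
  "newton_pair h p \<longleftrightarrow> h 0 = 1 \<and> (\<forall>n\<ge>1. real n * h n = (\<Sum>k\<in>{1..n}. p k * h (n - k)))"

text \<open>With the bead x = R i + (N - 1 - i) the index is R i - i + j, as in Jacobi--Trudi. In
  terms of the bead the entry no longer refers to its row, so adding a ribbon changes x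
  alone.\<close>

definition jt_entry :: "(nat \<Rightarrow> real) \<Rightarrow> nat \<Rightarrow> nat \<Rightarrow> nat \<Rightarrow> real" where
  "jt_entry h N x j = (if N \<le> x + j + 1 then h (x + j + 1 - N) else 0)"

definition jt_det :: "(nat \<Rightarrow> real) \<Rightarrow> nat \<Rightarrow> (nat \<Rightarrow> nat) \<Rightarrow> real" where
  "jt_det h N f = det (mat N N (\<lambda>(i, j). jt_entry h N (f i) j))"

text \<open>Up to alternating sign, the elementary symmetric functions.\<close>

definition hinv :: "(nat \<Rightarrow> real) \<Rightarrow> nat \<Rightarrow> real" where
  "hinv h = fps_nth (inverse (Abs_fps h))"

lemma hinv_conv:
  assumes "h 0 = 1"
  shows "(\<Sum>i\<le>n. h i * hinv h (n - i)) = (if n = 0 then 1 else 0)"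
proof -
  have "Abs_fps h * inverse (Abs_fps h) = 1"
    by (rule inverse_mult_eq_1') (use assms in simp)
  then have "fps_nth (Abs_fps h * inverse (Abs_fps h)) n = fps_nth 1 n" by simp
  then show ?thesis by (simp add: fps_mult_nth hinv_def atLeast0AtMost)
qed

text \<open>Newton's identities read X H' = P H for the generating series; dividing by H solves them
  for the power sums.\<close>

lemma newton_hinv:
  assumes "newton_pair h p" "k \<ge> 1"
  shows "(\<Sum>d<k. hinv h d * (real (k - d) * h (k - d))) = p k"
proof -
  let ?H = "Abs_fps h" and ?P = "Abs_fps (\<lambda>n. if n = 0 then 0 else p n)"
  have h0: "h 0 = 1" using assms by (simp add: newton_pair_def)
  have XH: "fps_nth (fps_X * fps_deriv ?H) n = real n * h n" for n
    by (cases n) simp_all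
  have "fps_X * fps_deriv ?H = ?P * ?H"
  proof (rule fps_ext)
    fix n
    have "(\<Sum>i = 0..n. (if i = 0 then 0 else p i) * h (n - i)) = (\<Sum>i\<in>{1..n}. p i * h (n - i))"
      by (rule sum.mono_neutral_cong_right) auto
    moreover have "real n * h n = (\<Sum>i\<in>{1..n}. p i * h (n - i))"
      using assms(1) by (cases "n = 0") (auto simp: newton_pair_def)
    ultimately show "fps_nth (fps_X * fps_deriv ?H) n = fps_nth (?P * ?H) n"
      unfolding XH by (simp add: fps_mult_nth)
  qed
  then have "inverse ?H * (fps_X * fps_deriv ?H) = ?P * (?H * inverse ?H)"
    by (simp add: mult_ac)
  also have "?H * inverse ?H = 1"
    by (rule inverse_mult_eq_1') (use h0 in simp)
  finally have "fps_nth (inverse ?H * (fps_X * fps_deriv ?H)) k = p k"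
    using assms(2) by simp
  then have "(\<Sum>d = 0..k. hinv h d * (real (k - d) * h (k - d))) = p k"
    unfolding fps_mult_nth[of "inverse ?H"] XH by (simp add: hinv_def)
  moreover have "{0..k} = insert k {..<k}" by auto
  ultimately show ?thesis by simp
qed

text \<open>Summed over all rows, raising one row by \<open>k\<close> equals raising one column by \<open>k\<close>, summed over all
  columns. Only the last \<open>k\<close> columns contribute, and there the unitriangular lower right block reduces the sum to a
  trace.\<close>

lemma jt_det_mult_power_sum:
  assumes np: "newton_pair h p" and k: "k \<ge> 1" "k \<le> N"
    and f: "\<And>t. t < k \<Longrightarrow> f (N - 1 - t) = t"
  shows "p k * jt_det h N f = (\<Sum>i<N. jt_det h N (f(i := f i + k)))"
proof -
  define M where "M = mat N N (\<lambda>(i, j). jt_entry h N (f i) j)"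
  have M: "M \<in> carrier_mat N N" by (simp add: M_def)
  have h0: "h 0 = 1" using np by (simp add: newton_pair_def)
  define B where "B = (\<lambda>i j. jt_entry h N (f i) (j + k))"
  have rows: "jt_det h N (f(i := f i + k)) = (\<Sum>j<N. B i j * cofactor M i j)" if "i < N" for i
  proof -
    have "jt_det h N (f(i := f i + k)) = det (mat N N (\<lambda>(a, b). if a = i then B i b else M $$ (a, b)))"
      unfolding jt_det_def by (intro arg_cong[of _ _ det] eq_matI)
        (auto simp: M_def B_def jt_entry_def add_ac)
    then show ?thesis using det_replace_row[OF M that] by simp
  qed
  \<comment> \<open>Raised by k, column j becomes column j + k, which the matrix already
    contains.\<close>
  have col_small: "(\<Sum>i<N. B i j * cofactor M i j) = 0" if "j < N - k" for j
    by (rule det_equal_cols[OF M, of _ "j + k"]) (use that k in \<open>auto simp: B_def M_def\<close>)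
  \<comment> \<open>The last k rows and columns form a unitriangular block with entries h(a - s),
    whose inverse has entries \<open>hinv h (c - a)\<close>. \<open>K\<close> holds the coefficients
    that express the raised last columns, in the last k rows, through the columns of this
    block.\<close>
  define K where "K = (\<lambda>a b. \<Sum>c\<in>{a..<k}. hinv h (c - a) * h (b + k - c))"
  have col_large: "(\<Sum>i<N. B i (N - k + b) * cofactor M i (N - k + b)) = K b b * det M" if b: "b < k" for b
  proof -
    let ?j = "N - k + b"
    have j: "?j < N" using b k by simp
    define u where "u = (\<lambda>i. B i ?j - (\<Sum>a<k. M $$ (i, N - k + a) * K a b))"
    have trail: "u r = 0" if r: "N - k \<le> r" "r < N" for r
    proof -
      define s where "s = r - (N - k)"
      have s: "s < k" "r = N - k + s" using r by (auto simp: s_def)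
      have fr: "f r = N - 1 - r" using f[of "N - 1 - r"] r k by simp
      have entry: "jt_entry h N (f r) (N - k + a) = (if s \<le> a then h (a - s) else 0)" for a
      proof -
        define x where "x = f r + (N - k + a) + 1"
        have "x + s = N + a" unfolding x_def fr using s r k by simp
        then have "N \<le> x \<longleftrightarrow> s \<le> a" "x - N = a - s" by auto
        then show ?thesis unfolding jt_entry_def x_def[symmetric] by simp
      qed
      have Mr: "M $$ (r, N - k + a) = (if s \<le> a then h (a - s) else 0)" if "a < k" for a
        using that s r k entry[of a] by (simp add: M_def)
      have "(\<Sum>a<k. M $$ (r, N - k + a) * K a b) = (\<Sum>a\<in>{s..<k}. h (a - s) * K a b)"
        by (rule sum.mono_neutral_cong_right) (auto simp: Mr)
      also have "\<dots> = (\<Sum>a\<in>{s..<k}. \<Sum>c\<in>{a..<k}. h (b + k - c) * (h (a - s) * hinv h (c - a)))"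
        by (simp add: K_def sum_distrib_left mult_ac)
      also have "\<dots> = (\<Sum>c\<in>{s..<k}. \<Sum>a\<in>{s..c}. h (b + k - c) * (h (a - s) * hinv h (c - a)))"
        by (simp add: sum.Sigma) (rule sum.reindex_bij_witness[of _ prod.swap prod.swap]; auto)
      also have "\<dots> = (\<Sum>c\<in>{s..<k}. h (b + k - c) * (if c = s then 1 else 0))"
      proof (intro sum.cong refl)
        fix c assume c: "c \<in> {s..<k}"
        have "(\<Sum>a\<in>{s..c}. h (a - s) * hinv h (c - a)) = (\<Sum>i\<le>c - s. h i * hinv h (c - s - i))"
          by (rule sum.reindex_bij_witness[of _ "\<lambda>i. i + s" "\<lambda>a. a - s"]) (use c in auto)
        also have "\<dots> = (if c = s then 1 else 0)"
          using c hinv_conv[of h "c - s", OF h0] by (cases "c = s") auto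
        finally show "(\<Sum>a\<in>{s..c}. h (b + k - c) * (h (a - s) * hinv h (c - a))) =
            h (b + k - c) * (if c = s then 1 else 0)"
          by (simp flip: sum_distrib_left)
      qed
      also have "\<dots> = h (b + k - s)" using s by (simp add: if_distrib cong: if_cong)
      also have "\<dots> = B r ?j" using s entry[of "b + k"] by (simp add: B_def add.assoc)
      finally show ?thesis by (simp add: u_def)
    qed
    have "(\<Sum>i<N. u i * cofactor M i ?j) =
        det (mat N N (\<lambda>(a, c). if c = ?j then u a else M $$ (a, c)))"
      using det_replace_col[OF M j] by simp
    also have "\<dots> = 0"
    \<comment> \<open>\<open>u\<close> vanishes in the last k rows, and there the matrix is
      supported in the last k columns. With \<open>u\<close> in place of one of them, k rows are
      left with k - 1 columns.\<close>
    proof (rule det_eq_0_if_zero_block[where R = "{N - k..<N}" and C = "{N - k..<N} - {?j}"])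
      show "card ({N - k..<N} - {?j}) < card {N - k..<N}"
        by (rule card_Diff1_less) (use j in auto)
      fix r c assume "r \<in> {N - k..<N}" "c < N" "c \<notin> {N - k..<N} - {?j}"
      then show "mat N N (\<lambda>(a, c). if c = ?j then u a else M $$ (a, c)) $$ (r, c) = 0"
        using trail[of r] f[of "N - 1 - r"] by (auto simp: M_def jt_entry_def)
    qed auto
    finally have u0: "(\<Sum>i<N. u i * cofactor M i ?j) = 0" .
    have "(\<Sum>i<N. B i ?j * cofactor M i ?j) =
        (\<Sum>i<N. \<Sum>a<k. M $$ (i, N - k + a) * K a b * cofactor M i ?j)"
      using u0 by (simp add: u_def left_diff_distrib sum_subtractf sum_distrib_right)
    also have "\<dots> = (\<Sum>a<k. K a b * (\<Sum>i<N. M $$ (i, N - k + a) * cofactor M i ?j))"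
      by (subst sum.swap) (simp add: sum_distrib_left mult_ac)
    \<comment> \<open>A column paired with the cofactors of another column gives 0, so only the
      diagonal entry of \<open>K\<close> survives; this is how the trace arises.\<close>
    also have "\<dots> = (\<Sum>a<k. K a b * (if a = b then det M else 0))"
    proof (intro sum.cong refl)
      fix a assume "a \<in> {..<k}"
      then show "K a b * (\<Sum>i<N. M $$ (i, N - k + a) * cofactor M i ?j) =
          K a b * (if a = b then det M else 0)"
        using det_equal_cols[OF M j, of "N - k + a" "\<lambda>i. M $$ (i, N - k + a)"]
          laplace_expansion_column[OF M j] k by auto
    qed
    also have "\<dots> = K b b * det M" using b by (simp add: if_distrib cong: if_cong)
    finally show ?thesis .
  qed
  have "(\<Sum>i<N. jt_det h N (f(i := f i + k))) = (\<Sum>i<N. \<Sum>j<N. B i j * cofactor M i j)"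
    by (intro sum.cong) (auto simp: rows)
  also have "\<dots> = (\<Sum>j<N. \<Sum>i<N. B i j * cofactor M i j)"
    by (rule sum.swap)
  also have "\<dots> = (\<Sum>j\<in>{N - k..<N}. \<Sum>i<N. B i j * cofactor M i j)"
    by (rule sum.mono_neutral_right) (use col_small in auto)
  also have "\<dots> = (\<Sum>b<k. \<Sum>i<N. B i (N - k + b) * cofactor M i (N - k + b))"
    by (rule sum.reindex_bij_witness[of _ "\<lambda>b. N - k + b" "\<lambda>j. j - (N - k)"]) (use k in auto)
  also have "\<dots> = (\<Sum>b<k. K b b * det M)"
    using col_large by (intro sum.cong) auto
  also have "(\<Sum>b<k. K b b * det M) = (\<Sum>b<k. K b b) * det M"
    by (simp add: sum_distrib_right)
  also have "(\<Sum>b<k. K b b) = (\<Sum>b<k. \<Sum>d<k - b. hinv h d * h (k - d))"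
  proof (intro sum.cong refl)
    fix b assume "b \<in> {..<k}"
    then show "K b b = (\<Sum>d<k - b. hinv h d * h (k - d))"
      unfolding K_def by (intro sum.reindex_bij_witness[of _ "\<lambda>d. d + b" "\<lambda>c. c - b"])
        (auto simp: add.commute[of b k])
  qed
  \<comment> \<open>For fixed d there are k - d values of b, which is the multiplicity in
    \<open>newton_hinv\<close>.\<close>
  also have "\<dots> = (\<Sum>d<k. \<Sum>b<k - d. hinv h d * h (k - d))"
    by (simp add: sum.Sigma del: sum_constant) (rule sum.reindex_bij_witness[of _ prod.swap prod.swap]; auto)
  also have "\<dots> = (\<Sum>d<k. hinv h d * (real (k - d) * h (k - d)))"
    by (simp add: mult_ac)
  also have "\<dots> = p k" by (rule newton_hinv[OF np k(1)])
  finally show ?thesis by (simp add: jt_det_def M_def)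
qed

section \<open>Independence of the order of the beads\<close>

definition vandermonde :: "nat \<Rightarrow> (nat \<Rightarrow> nat) \<Rightarrow> real" where
  "vandermonde N f = (\<Prod>(i, j) | i < j \<and> j < N. real (f i) - real (f j))"

lemma finite_pairs: "finite {(i, j). i < j \<and> j < (N :: nat)}"
  by (rule finite_subset[of _ "{..<N} \<times> {..<N}"]) auto

lemma vandermonde_swap:
  assumes "Suc i < N"
  shows "vandermonde N (f \<circ> Transposition.transpose i (Suc i)) = - vandermonde N f"
proof -
  let ?\<tau> = "Transposition.transpose i (Suc i)"
  let ?S = "{(a, b). a < b \<and> b < N}" and ?d = "\<lambda>(a, b). real (f a) - real (f b)"
  have mem: "(i, Suc i) \<in> ?S" using assms by simp
  have "vandermonde N (f \<circ> ?\<tau>) = (real (f (Suc i)) - real (f i)) *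
      (\<Prod>(a, b)\<in>?S - {(i, Suc i)}. real (f (?\<tau> a)) - real (f (?\<tau> b)))"
    unfolding vandermonde_def by (subst prod.remove[OF finite_pairs mem]) simp
  also have "(\<Prod>(a, b)\<in>?S - {(i, Suc i)}. real (f (?\<tau> a)) - real (f (?\<tau> b))) =
      (\<Prod>(a, b)\<in>?S - {(i, Suc i)}. real (f a) - real (f b))"
    by (rule prod.reindex_bij_witness[of _ "map_prod ?\<tau> ?\<tau>" "map_prod ?\<tau> ?\<tau>"])
      (use assms in \<open>auto simp: Transposition.transpose_def split: if_splits\<close>)
  also have "(real (f (Suc i)) - real (f i)) * \<dots> = - vandermonde N f"
    using prod.remove[OF finite_pairs mem, of ?d] by (simp add: vandermonde_def algebra_simps)
  finally show ?thesis .
qed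

lemma jt_det_swap:
  assumes "Suc i < N"
  shows "jt_det h N (f \<circ> Transposition.transpose i (Suc i)) = - jt_det h N f"
proof -
  let ?\<tau> = "Transposition.transpose i (Suc i)"
  let ?A = "mat N N (\<lambda>(i, j). jt_entry h N (f i) j)"
  have perm: "?\<tau> permutes {0..<N}" by (rule permutes_swap_id) (use assms in auto)
  have "mat N N (\<lambda>(i, j). jt_entry h N ((f \<circ> ?\<tau>) i) j) = mat N N (\<lambda>(i, j). ?A $$ (?\<tau> i, j))"
    using permutes_in_image[OF perm] by (intro eq_matI) auto
  then have "jt_det h N (f \<circ> ?\<tau>) = signof ?\<tau> * jt_det h N f"
    using det_permute_rows[of ?A N ?\<tau>] perm by (simp add: jt_det_def)
  then show ?thesis by (simp add: sign_swap_id)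
qed

definition strict_decr :: "nat \<Rightarrow> (nat \<Rightarrow> nat) \<Rightarrow> bool" where
  "strict_decr N f \<longleftrightarrow> (\<forall>i j. i < j \<longrightarrow> j < N \<longrightarrow> f j < f i)"

lemma strict_decr_Suc: "strict_decr N f \<longleftrightarrow> (\<forall>i. Suc i < N \<longrightarrow> f (Suc i) < f i)"
proof
  assume *: "\<forall>i. Suc i < N \<longrightarrow> f (Suc i) < f i"
  have "f j < f i" if "i < j" "j < N" for i j
    using that
  proof (induction j)
    case (Suc j)
    then have "f (Suc j) < f j" using * by simp
    moreover have "i = j \<or> f j < f i" using Suc by (cases "i = j") auto
    ultimately show ?case by auto
  qed simp
  then show "strict_decr N f" by (simp add: strict_decr_def)
qed (simp add: strict_decr_def)

text \<open>Bubble sort: exchanging neighbours flips the sign of both factors and so preserves the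
  product, while undoing an ascent decreases the sum of i * f i.\<close>

lemma sort_tuple:
  assumes "inj_on f {..<N}"
  shows "\<exists>g. strict_decr N g \<and> g ` {..<N} = f ` {..<N} \<and>
    vandermonde N g * jt_det h N g = vandermonde N f * jt_det h N f"
  using assms
proof (induction "\<Sum>i<N. i * f i" arbitrary: f rule: less_induct)
  case less
  show ?case
  proof (cases "strict_decr N f")
    case True
    then show ?thesis by blast
  next
    case False
    then obtain i where i: "Suc i < N" "f i \<le> f (Suc i)"
      by (auto simp: strict_decr_Suc not_less)
    moreover have "f i \<noteq> f (Suc i)"
      using less.prems i inj_on_eq_iff[of f "{..<N}" i "Suc i"] by auto
    ultimately have lt: "f i < f (Suc i)" by simp
    let ?\<tau> = "Transposition.transpose i (Suc i)"
    let ?g = "f \<circ> ?\<tau>"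
    have perm: "?\<tau> permutes {..<N}" by (rule permutes_swap_id) (use i in auto)
    have split: "(\<Sum>j<N. F j) = F i + F (Suc i) + (\<Sum>j\<in>{..<N} - {i, Suc i}. F j)" for F :: "nat \<Rightarrow> nat"
    proof -
      have "(\<Sum>j<N. F j) = F i + (\<Sum>j\<in>{..<N} - {i}. F j)"
        by (rule sum.remove) (use i in auto)
      also have "(\<Sum>j\<in>{..<N} - {i}. F j) = F (Suc i) + (\<Sum>j\<in>({..<N} - {i}) - {Suc i}. F j)"
        by (rule sum.remove) (use i in auto)
      also have "({..<N} - {i}) - {Suc i} = {..<N} - {i, Suc i}" by auto
      finally show ?thesis by simp
    qed
    have "(\<Sum>j\<in>{..<N} - {i, Suc i}. j * ?g j) = (\<Sum>j\<in>{..<N} - {i, Suc i}. j * f j)"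
      by (intro sum.cong) auto
    then have "(\<Sum>j<N. j * ?g j) < (\<Sum>j<N. j * f j)"
      unfolding split using lt by simp
    moreover have inj: "inj_on ?g {..<N}"
      using less.prems perm by (metis comp_inj_on permutes_image permutes_inj_on)
    ultimately obtain g where g: "strict_decr N g" "g ` {..<N} = ?g ` {..<N}"
      "vandermonde N g * jt_det h N g = vandermonde N ?g * jt_det h N ?g"
      using less.hyps by blast
    moreover have "?g ` {..<N} = f ` {..<N}"
      using permutes_image[OF perm] by (metis image_comp)
    ultimately show ?thesis
      by (auto simp: vandermonde_swap[OF i(1)] jt_det_swap[OF i(1)])
  qed
qed

definition decr_enum :: "nat set \<Rightarrow> nat \<Rightarrow> nat" where
  "decr_enum X i = rev (sorted_list_of_set X) ! i"

lemma strict_decr_decr_enum: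
  assumes "finite X"
  shows "strict_decr (card X) (decr_enum X)" "decr_enum X ` {..<card X} = X"
proof -
  have len: "length (sorted_list_of_set X) = card X" by simp
  have "sorted_wrt (<) (sorted_list_of_set X)" by simp
  then have *: "sorted_wrt (>) (rev (sorted_list_of_set X))" by (simp add: sorted_wrt_rev)
  show "strict_decr (card X) (decr_enum X)"
    unfolding strict_decr_def decr_enum_def
    using sorted_wrt_nth_less[OF *] by simp
  have "set (rev (sorted_list_of_set X)) = X" using assms by simp
  then show "decr_enum X ` {..<card X} = X"
    unfolding decr_enum_def set_conv_nth by (auto simp: image_def)
qed

lemma strict_decr_unique:
  assumes "strict_decr N f" "i < N"
  shows "decr_enum (f ` {..<N}) i = f i"
proof -
  let ?l = "map f [0..<N]"
  have "sorted_wrt (>) ?l"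
    using assms(1) by (auto simp: sorted_wrt_iff_nth_less strict_decr_def)
  then have "sorted_wrt (<) (rev ?l)" by (simp add: sorted_wrt_rev)
  then have "sorted_list_of_set (set (rev ?l)) = rev ?l"
    by (metis sorted_list_of_set.idem_if_sorted_distinct strict_sorted_iff)
  moreover have "set (rev ?l) = f ` {..<N}" by (simp add: atLeast0LessThan)
  ultimately show ?thesis using assms(2) by (simp add: decr_enum_def)
qed

lemma strict_decr_inj: "strict_decr N f \<Longrightarrow> inj_on f {..<N}"
  unfolding strict_decr_def inj_on_def by (metis lessThan_iff linorder_neqE_nat nat_less_le)

lemma jt_det_cong: "(\<And>i. i < N \<Longrightarrow> f i = g i) \<Longrightarrow> jt_det h N f = jt_det h N g"
  unfolding jt_det_def by (intro arg_cong[of _ _ det] eq_matI) auto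

lemma vandermonde_cong: "(\<And>i. i < N \<Longrightarrow> f i = g i) \<Longrightarrow> vandermonde N f = vandermonde N g"
  unfolding vandermonde_def by (intro prod.cong) auto

text \<open>The product of two alternating functions is a function of the set of beads. The sign of
  the sorting permutation after a ribbon has been added, which is the sign of the
  Murnaghan--Nakayama rule, is thereby absorbed.\<close>

definition jt_weight :: "(nat \<Rightarrow> real) \<Rightarrow> nat set \<Rightarrow> real" where
  "jt_weight h X = vandermonde (card X) (decr_enum X) * jt_det h (card X) (decr_enum X)"

lemma jt_weight_image:
  assumes "inj_on f {..<N}"
  shows "vandermonde N f * jt_det h N f = jt_weight h (f ` {..<N})"
proof -
  obtain g where g: "strict_decr N g" "g ` {..<N} = f ` {..<N}"
    "vandermonde N g * jt_det h N g = vandermonde N f * jt_det h N f"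
    using sort_tuple[OF assms] by blast
  have c: "card (f ` {..<N}) = N" using assms by (simp add: card_image)
  have "decr_enum (f ` {..<N}) i = g i" if "i < N" for i
    using strict_decr_unique[OF g(1) that] g(2) by simp
  then show ?thesis
    using g(3) jt_det_cong[of N "decr_enum (f ` {..<N})" g h]
      vandermonde_cong[of N "decr_enum (f ` {..<N})" g]
    by (simp add: jt_weight_def c)
qed

lemma jt_det_not_inj:
  assumes "i < N" "j < N" "i \<noteq> j" "f i = f j"
  shows "jt_det h N f = 0"
  unfolding jt_det_def
  by (rule det_identical_rows[of _ N i j]) (use assms in \<open>auto intro!: eq_vecI\<close>)

section \<open>Schur functions and beta-sets\<close>

lemma card_below_strict_decr:
  assumes "strict_decr N f" "i < N"
  shows "card {y \<in> f ` {..<N}. y < f i} = N - 1 - i"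
proof -
  have "{y \<in> f ` {..<N}. y < f i} = f ` {i<..<N}"
  proof (intro equalityI subsetI)
    fix y assume "y \<in> {y \<in> f ` {..<N}. y < f i}"
    then obtain j where j: "j < N" "y = f j" "f j < f i" by auto
    moreover have "f i < f j" if "j < i" using assms that by (simp add: strict_decr_def)
    ultimately have "i < j" using linorder_neqE_nat[of i j] by (metis less_asym)
    with j show "y \<in> f ` {i<..<N}" by auto
  qed (use assms in \<open>auto simp: strict_decr_def\<close>)
  moreover have "inj_on f {i<..<N}"
    using strict_decr_inj[OF assms(1)] by (rule inj_on_subset) auto
  ultimately show ?thesis by (simp add: card_image)
qed

text \<open>The beads 0, ..., k - 1 are k empty rows at the bottom, the room that
  \<open>jt_det_mult_power_sum\<close> requires.\<close>

lemma decr_enum_initial: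
  assumes "finite X" "{..<k} \<subseteq> X" "t < k"
  shows "decr_enum X (card X - 1 - t) = t"
proof -
  note E = strict_decr_decr_enum[OF assms(1)]
  have "t \<in> decr_enum X ` {..<card X}" using E(2) assms by auto
  then obtain i where i: "i < card X" "t = decr_enum X i" by auto
  have "{y \<in> X. y < t} = {..<t}" using assms by auto
  then have "t = card X - 1 - i"
    using card_below_strict_decr[OF E(1) i(1)] by (simp add: E(2) i(2)[symmetric])
  then have "card X - 1 - t = i" using i(1) by simp
  with i(2) show ?thesis by simp
qed

text \<open>Only the pairs containing i change, and writing them with i in front costs the same sign
  for both tuples. The identity is multiplied out because the products may vanish.\<close>

lemma vandermonde_update:
  assumes "i < N"
  shows "vandermonde N (f(i := v)) * (\<Prod>j\<in>{..<N} - {i}. real (f i) - real (f j)) =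
    vandermonde N f * (\<Prod>j\<in>{..<N} - {i}. real v - real (f j))"
proof -
  let ?S = "{(a, b). a < b \<and> b < N}"
  let ?A = "{(a, b) \<in> ?S. a \<noteq> i \<and> b \<noteq> i}"
  let ?s = "\<lambda>j. if j < i then - 1 else 1 :: real"
  have *: "vandermonde N g = (\<Prod>j\<in>{..<N} - {i}. ?s j) * (\<Prod>j\<in>{..<N} - {i}. real (g i) - real (g j)) *
      (\<Prod>(a, b)\<in>?A. real (g a) - real (g b))" for g
  proof -
    have "vandermonde N g = (\<Prod>(a, b)\<in>?S - ?A. real (g a) - real (g b)) *
        (\<Prod>(a, b)\<in>?A. real (g a) - real (g b))"
      unfolding vandermonde_def by (rule prod.subset_diff) (auto simp: finite_pairs)
    also have "(\<Prod>(a, b)\<in>?S - ?A. real (g a) - real (g b)) =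
        (\<Prod>j\<in>{..<N} - {i}. ?s j * (real (g i) - real (g j)))"
      by (rule prod.reindex_bij_witness[of _ "\<lambda>j. if j < i then (j, i) else (i, j)"
            "\<lambda>(a, b). if b = i then a else b"]) (use assms in \<open>auto split: if_splits\<close>)
    finally show ?thesis by (simp add: prod.distrib)
  qed
  have "(\<Prod>(a, b)\<in>?A. real ((f(i := v)) a) - real ((f(i := v)) b)) = (\<Prod>(a, b)\<in>?A. real (f a) - real (f b))"
    by (rule prod.cong) auto
  moreover have "(\<Prod>j\<in>{..<N} - {i}. real ((f(i := v)) i) - real ((f(i := v)) j)) =
      (\<Prod>j\<in>{..<N} - {i}. real v - real (f j))"
    by (rule prod.cong) auto
  ultimately show ?thesis using *[of f] *[of "f(i := v)"] by simp
qed

lemma fact_add: "(fact (x + k) :: real) = fact x * (\<Prod>t<k. real (x + k) - real t)"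
proof (induction k)
  case (Suc k)
  have "(\<Prod>t<Suc k. real (x + Suc k) - real t) = real (x + Suc k) * (\<Prod>t<k. real (x + k) - real t)"
    by (subst prod.lessThan_Suc_shift) simp
  then show ?case using Suc by (simp add: mult_ac)
qed simp

text \<open>The purpose of \<open>rho\<close>: it is the ratio of the normalized Vandermonde
  products below and above a ribbon. It is evaluated at the larger set because it describes the way
  down.\<close>

lemma rho_raise:
  assumes f: "inj_on f {..<N}" and i: "i < N" "f i + k \<notin> f ` {..<N}"
  defines "X' \<equiv> (f(i := f i + k)) ` {..<N}"
  shows "vandermonde N f / (\<Prod>x\<in>f ` {..<N}. fact x) =
    rho k X' (f i + k) * (vandermonde N (f(i := f i + k)) / (\<Prod>x\<in>X'. fact x))"
    and "inj_on (f(i := f i + k)) {..<N}"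
    and "X' = insert (f i + k) (f ` {..<N} - {f i})"
proof -
  let ?f' = "f(i := f i + k)"
  have alg: "V / (F * D) = A * (B / C) * (V' / (F * A * D))"
    if "A \<noteq> 0" "C \<noteq> 0" "V * C = V' * B" for A B C D F V V' :: real
  proof -
    have "V = V' * B / C" using that by (simp add: eq_divide_eq)
    then show ?thesis using that by simp
  qed
  show inj: "inj_on ?f' {..<N}"
    using f i(2) by (rule inj_on_fun_updI)
  have rest: "f ` {..<N} - {f i} = f ` ({..<N} - {i})"
    using f i(1) by (auto simp: inj_on_def)
  show X': "X' = insert (f i + k) (f ` {..<N} - {f i})"
    unfolding rest X'_def using i(1) by auto
  have inj': "inj_on f ({..<N} - {i})" using f by (rule inj_on_subset) auto
  have notin: "f i + k \<notin> f ` {..<N} - {f i}" using i(2) by auto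
  have nz: "(\<Prod>j\<in>{..<N} - {i}. real (f i + k) - real (f j)) \<noteq> 0"
    using i(2) by (auto simp flip: of_nat_add)
  have a: "rho k X' (f i + k) = (\<Prod>t<k. real (f i + k) - real t) *
      ((\<Prod>j\<in>{..<N} - {i}. real (f i) - real (f j)) / (\<Prod>j\<in>{..<N} - {i}. real (f i + k) - real (f j)))"
  proof -
    have "X' - {f i + k} = f ` ({..<N} - {i})" using X' notin rest by auto
    then show ?thesis unfolding rho_def by (simp add: prod.reindex[OF inj'] prod_dividef)
  qed
  have b: "(\<Prod>x\<in>X'. fact x :: real) = fact (f i + k) * (\<Prod>j\<in>{..<N} - {i}. fact (f j))"
    unfolding X' using notin rest by (simp add: prod.reindex[OF inj'])
  have c: "(\<Prod>x\<in>f ` {..<N}. fact x :: real) = fact (f i) * (\<Prod>j\<in>{..<N} - {i}. fact (f j))"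
    unfolding prod.reindex[OF f] by (subst prod.remove[of _ i]) (use i in auto)
  have d: "vandermonde N f * (\<Prod>j\<in>{..<N} - {i}. real (f i + k) - real (f j)) =
      vandermonde N ?f' * (\<Prod>j\<in>{..<N} - {i}. real (f i) - real (f j))"
    using vandermonde_update[OF i(1), of f "f i + k"] by simp
  have e: "(\<Prod>t<k. real (f i + k) - real t) \<noteq> 0"
    by auto
  show "vandermonde N f / (\<Prod>x\<in>f ` {..<N}. fact x) =
      rho k X' (f i + k) * (vandermonde N ?f' / (\<Prod>x\<in>X'. fact x))"
    unfolding a b c fact_add by (rule alg[OF e nz d])
qed

text \<open>For the beta-set of a partition of n this is dim/n! times its Schur function
  (\<open>schur_weight_beta_set\<close>).\<close>

definition schur_weight :: "(nat \<Rightarrow> real) \<Rightarrow> nat set \<Rightarrow> real" where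
  "schur_weight h X = jt_weight h X / (\<Prod>x\<in>X. fact x)"

lemma schur_weight_image:
  assumes "inj_on f {..<N}"
  shows "schur_weight h (f ` {..<N}) = vandermonde N f / (\<Prod>x\<in>f ` {..<N}. fact x) * jt_det h N f"
  using jt_weight_image[OF assms, of h] by (simp add: schur_weight_def)

text \<open>Murnaghan--Nakayama without signs: a raised bead that hits another one gives two equal
  rows and contributes 0, the other raised determinants are converted into weights by
  \<open>rho_raise\<close>.\<close>

lemma schur_weight_mult_power_sum:
  assumes np: "newton_pair h p" and X: "finite X" "{..<k} \<subseteq> X" and k: "k \<ge> 1"
  shows "p k * schur_weight h X =
    (\<Sum>x | x \<in> X \<and> x + k \<notin> X. rho k (insert (x + k) (X - {x})) (x + k) *
       schur_weight h (insert (x + k) (X - {x})))"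
proof -
  define N f where "N = card X" and "f = decr_enum X"
  have fX: "f ` {..<N} = X" and inj: "inj_on f {..<N}"
    using strict_decr_decr_enum[OF X(1)] strict_decr_inj by (auto simp: N_def f_def)
  have kN: "k \<le> N" using card_mono[OF X] by (simp add: N_def)
  have "p k * jt_det h N f = (\<Sum>i<N. jt_det h N (f(i := f i + k)))"
    by (rule jt_det_mult_power_sum[OF np k kN])
      (use decr_enum_initial[OF X] in \<open>simp add: N_def f_def\<close>)
  moreover have "p k * schur_weight h X =
      vandermonde N f / (\<Prod>x\<in>X. fact x) * (p k * jt_det h N f)"
    using schur_weight_image[OF inj, of h] by (simp add: fX)
  ultimately have "p k * schur_weight h X =
      (\<Sum>i<N. vandermonde N f / (\<Prod>x\<in>X. fact x) * jt_det h N (f(i := f i + k)))"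
    by (simp only: sum_distrib_left)
  also have "\<dots> = (\<Sum>i<N. if f i + k \<notin> X then rho k (insert (f i + k) (X - {f i})) (f i + k) *
       schur_weight h (insert (f i + k) (X - {f i})) else 0)"
  proof (intro sum.cong refl)
    fix i assume "i \<in> {..<N}"
    then have i: "i < N" by simp
    show "vandermonde N f / (\<Prod>x\<in>X. fact x) * jt_det h N (f(i := f i + k)) =
        (if f i + k \<notin> X then rho k (insert (f i + k) (X - {f i})) (f i + k) *
       schur_weight h (insert (f i + k) (X - {f i})) else 0)"
    proof (cases "f i + k \<in> X")
      case True
      then obtain j where j: "j < N" "f j = f i + k" using fX by auto
      have "jt_det h N (f(i := f i + k)) = 0"
        by (rule jt_det_not_inj[OF i j(1)]) (use j k in auto)
      with True show ?thesis by simp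
    next
      case False
      note R = rho_raise[OF inj i, of k, unfolded fX, OF False]
      show ?thesis
        unfolding R(1)[unfolded R(3)] using schur_weight_image[OF R(2), of h, unfolded R(3)] False
        by simp
    qed
  qed
  also have "\<dots> = (\<Sum>x\<in>X. if x + k \<notin> X then rho k (insert (x + k) (X - {x})) (x + k) *
       schur_weight h (insert (x + k) (X - {x})) else 0)"
    by (subst (2) fX[symmetric], subst sum.reindex[OF inj]) simp
  also have "\<dots> = (\<Sum>x | x \<in> X \<and> x + k \<notin> X. rho k (insert (x + k) (X - {x})) (x + k) *
       schur_weight h (insert (x + k) (X - {x})))"
    by (rule sum.inter_filter[symmetric]) fact
  finally show ?thesis .
qed

section \<open>Levels: beta-sets with N beads of the partitions of n\<close>

definition levels :: "nat \<Rightarrow> nat \<Rightarrow> nat set set" where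
  "levels n N = {X. finite X \<and> card X = N \<and> \<Sum>X = n + \<Sum>{..<N}}"

lemma finite_levels: "finite (levels n N)"
proof (rule finite_subset)
  show "levels n N \<subseteq> Pow {..n + \<Sum>{..<N}}"
  proof (clarsimp simp: levels_def)
    fix X :: "nat set" and x assume "finite X" "\<Sum>X = n + \<Sum>{..<card X}" "x \<in> X"
    then show "x \<le> n + \<Sum>{..<card X}" by (metis member_le_sum zero_le)
  qed
qed simp

lemma sum_lessThan_card_le:
  fixes Y :: "nat set"
  assumes "finite Y"
  shows "\<Sum>{..<card Y} \<le> \<Sum>Y"
  using assms
proof (induction rule: finite_linorder_max_induct)
  case (insert b A)
  have "card A \<le> card {..<b}" by (rule card_mono) (use insert in auto)
  moreover have "b \<notin> A" using insert by auto
  ultimately show ?case using insert by (simp add: lessThan_Suc)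
qed simp

text \<open>A partition of n has at most n rows, so at least k of N rows are empty. In terms of
  beads: if t < k were missing, moving all beads above t down by one would leave N distinct
  naturals, with sum at least that of the staircase; hence at most n beads lie above t, whereas at
  least N - t > n must.\<close>

lemma levels_initial:
  assumes X: "X \<in> levels n N" and k: "n + k \<le> N"
  shows "{..<k} \<subseteq> X"
proof (rule ccontr)
  assume "\<not> {..<k} \<subseteq> X"
  then obtain t where t: "t < k" "t \<notin> X" by auto
  have fin: "finite X" and N: "card X = N" and S: "\<Sum>X = n + \<Sum>{..<N}"
    using X by (auto simp: levels_def)
  let ?\<phi> = "\<lambda>y. if y < t then y else y - 1"
  have inj: "inj_on ?\<phi> X"
  proof (rule inj_onI)
    fix x y assume xy: "x \<in> X" "y \<in> X" "?\<phi> x = ?\<phi> y"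
    then have "x \<noteq> t" "y \<noteq> t" using t by auto
    with xy(3) show "x = y" by (auto split: if_splits)
  qed
  have im: "\<Sum>(?\<phi> ` X) = (\<Sum>y\<in>X. ?\<phi> y)"
    by (simp only: sum.reindex[OF inj] o_def)
  have one: "(\<Sum>y\<in>X. if y < t then 0 else 1) = card {y \<in> X. \<not> y < t}"
    by (subst card_eq_sum, subst sum.inter_filter[OF fin], intro sum.cong) auto
  have "y = ?\<phi> y + (if y < t then 0 else 1)" if "y \<in> X" for y
    using t that by (cases "y = t") auto
  then have "\<Sum>X = (\<Sum>y\<in>X. ?\<phi> y + (if y < t then 0 else 1))"
    by (intro sum.cong) auto
  also have "\<dots> = \<Sum>(?\<phi> ` X) + card {y \<in> X. \<not> y < t}"
    unfolding sum.distrib im one ..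
  finally have eq: "\<Sum>X = \<Sum>(?\<phi> ` X) + card {y \<in> X. \<not> y < t}" .
  have "\<Sum>(?\<phi> ` X) \<ge> \<Sum>{..<N}"
    using sum_lessThan_card_le[of "?\<phi> ` X"] fin by (simp only: card_image[OF inj] N finite_imageI)
  with eq S have "card {y \<in> X. \<not> y < t} \<le> n" by linarith
  moreover have "card {y \<in> X. y < t} \<le> t"
    using card_mono[of "{..<t}" "{y \<in> X. y < t}"] by auto
  moreover have "card {y \<in> X. y < t} + card {y \<in> X. \<not> y < t} = N"
    unfolding N[symmetric] using fin by (subst card_Un_disjoint[symmetric]) (auto intro: arg_cong[of _ _ card])
  ultimately show False using t k by simp
qed

lemma sum_nat_remove_insert:
  fixes X :: "nat set"
  assumes "finite X" "x \<in> X" "y \<notin> X - {x}"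
  shows "\<Sum>(insert y (X - {x})) + x = \<Sum>X + y" "card (insert y (X - {x})) = card X"
proof -
  show "\<Sum>(insert y (X - {x})) + x = \<Sum>X + y"
    using assms sum.remove[OF assms(1,2), of "\<lambda>x. x"] by simp
  show "card (insert y (X - {x})) = card X"
    using assms by (metis card_Suc_Diff1 card_insert_disjoint finite_Diff)
qed

text \<open>Double counting of the pairs of beta-sets that differ by one ribbon: additions to level
  n are regrouped as removals from level n + k. The bound n + k <= N makes the product rule valid on
  the whole level.\<close>

lemma power_sum_level_sum:
  assumes np: "newton_pair h p" and k: "k \<ge> 1" "n + k \<le> N"
  shows "p k * (\<Sum>X\<in>levels n N. schur_weight h X * g X) =
    (\<Sum>X\<in>levels (n + k) N. schur_weight h X * lower_op k 0 g X)"
proof -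
  let ?r = "\<lambda>X x. insert (x + k) (X - {x})"
  let ?F = "\<lambda>X x. rho k X x * schur_weight h X * g (lower k X x)"
  have low: "lower k (?r X x) (x + k) = X" if "x \<in> X" "x + k \<notin> X" for X x
    using that by (auto simp: lower_def)
  have raise: "?r (lower k X x) (x - k) = X" if "x \<in> X" "k \<le> x" "x - k \<notin> X - {x}" for X x
    using that by (auto simp: lower_def)
  have "p k * (\<Sum>X\<in>levels n N. schur_weight h X * g X) =
      (\<Sum>X\<in>levels n N. \<Sum>x | x \<in> X \<and> x + k \<notin> X. ?F (?r X x) (x + k))"
    unfolding sum_distrib_left
  proof (intro sum.cong refl)
    fix X assume X: "X \<in> levels n N"
    then have "finite X" "{..<k} \<subseteq> X" using levels_initial[OF X k(2)] by (auto simp: levels_def)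
    from schur_weight_mult_power_sum[OF np this k(1)]
    have "p k * (schur_weight h X * g X) =
        (\<Sum>x | x \<in> X \<and> x + k \<notin> X. rho k (?r X x) (x + k) * schur_weight h (?r X x)) * g X"
      by (simp add: mult.assoc[symmetric])
    also have "\<dots> = (\<Sum>x | x \<in> X \<and> x + k \<notin> X. ?F (?r X x) (x + k))"
      unfolding sum_distrib_right by (intro sum.cong) (auto simp: low)
    finally show "p k * (schur_weight h X * g X) = (\<Sum>x | x \<in> X \<and> x + k \<notin> X. ?F (?r X x) (x + k))" .
  qed
  also have "\<dots> = (\<Sum>(X, x)\<in>(SIGMA X:levels n N. {x. x \<in> X \<and> x + k \<notin> X}). ?F (?r X x) (x + k))"
    by (rule sum.Sigma[OF finite_levels]) (auto simp: levels_def)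
  also have "\<dots> = (\<Sum>(X, x)\<in>(SIGMA X:levels (n + k) N. {x. x \<in> X \<and> k \<le> x \<and> x - k \<notin> X - {x}}). ?F X x)"
  proof (rule sum.reindex_bij_witness[of _ "\<lambda>(X, x). (lower k X x, x - k)" "\<lambda>(X, x). (?r X x, x + k)"])
    fix q assume "q \<in> (SIGMA X:levels n N. {x. x \<in> X \<and> x + k \<notin> X})"
    then obtain X x where q: "q = (X, x)" "X \<in> levels n N" "x \<in> X" "x + k \<notin> X" by auto
    show "(case case q of (X, x) \<Rightarrow> (?r X x, x + k) of (X, x) \<Rightarrow> (lower k X x, x - k)) = q"
      using q low by simp
    have "?r X x \<in> levels (n + k) N"
      using q sum_nat_remove_insert[of X x "x + k"] by (auto simp: levels_def)
    moreover have "x \<notin> ?r X x - {x + k}" using k by auto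
    ultimately show "(case q of (X, x) \<Rightarrow> (?r X x, x + k)) \<in>
        (SIGMA X:levels (n + k) N. {x. x \<in> X \<and> k \<le> x \<and> x - k \<notin> X - {x}})"
      using q by simp
    show "(case case q of (X, x) \<Rightarrow> (?r X x, x + k) of (X, x) \<Rightarrow> ?F X x) =
        (case q of (X, x) \<Rightarrow> ?F (?r X x) (x + k))"
      using q by simp
  next
    fix q assume "q \<in> (SIGMA X:levels (n + k) N. {x. x \<in> X \<and> k \<le> x \<and> x - k \<notin> X - {x}})"
    then obtain X x where q: "q = (X, x)" "X \<in> levels (n + k) N" "x \<in> X" "k \<le> x" "x - k \<notin> X - {x}"
      by auto
    show "(case case q of (X, x) \<Rightarrow> (lower k X x, x - k) of (X, x) \<Rightarrow> (?r X x, x + k)) = q"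
      using q raise[of x X] by simp
    have "lower k X x \<in> levels n N"
      using q sum_nat_remove_insert[of X x "x - k"] by (auto simp: levels_def lower_def)
    moreover have "x \<notin> lower k X x" using q k by (auto simp: lower_def)
    moreover have "x - k \<in> lower k X x" by (simp add: lower_def)
    ultimately show "(case q of (X, x) \<Rightarrow> (lower k X x, x - k)) \<in>
        (SIGMA X:levels n N. {x. x \<in> X \<and> x + k \<notin> X})"
      using q by simp
  qed
  also have "\<dots> = (\<Sum>X\<in>levels (n + k) N. \<Sum>x | x \<in> X \<and> k \<le> x \<and> x - k \<notin> X - {x}. ?F X x)"
    by (rule sum.Sigma[OF finite_levels, symmetric]) (auto simp: levels_def)
  also have "\<dots> = (\<Sum>X\<in>levels (n + k) N. schur_weight h X * lower_op k 0 g X)"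
  proof (intro sum.cong refl)
    fix X assume "X \<in> levels (n + k) N"
    then have fin: "finite X" by (simp add: levels_def)
    \<comment> \<open>Illegal removals have weight 0, so the sum extends to all beads.\<close>
    have "(\<Sum>x | x \<in> X \<and> k \<le> x \<and> x - k \<notin> X - {x}. ?F X x) = (\<Sum>x\<in>X. ?F X x)"
    proof (rule sum.mono_neutral_left[OF fin])
      show "\<forall>x\<in>X - {x. x \<in> X \<and> k \<le> x \<and> x - k \<notin> X - {x}}. ?F X x = 0"
      proof
        fix x assume "x \<in> X - {x. x \<in> X \<and> k \<le> x \<and> x - k \<notin> X - {x}}"
        then have "x < k \<or> x - k \<in> X - {x}" by auto
        then show "?F X x = 0" using rho_eq_0[OF fin _ k(1)] by simp
      qed
    qed auto
    then show "(\<Sum>x | x \<in> X \<and> k \<le> x \<and> x - k \<notin> X - {x}. ?F X x) =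
        schur_weight h X * lower_op k 0 g X"
      by (simp add: lower_op_def sum_distrib_left mult_ac)
  qed
  finally show ?thesis .
qed

lemma levels_0: "levels 0 N = {{..<N}}"
proof -
  have "X = {..<N}" if "X \<in> levels 0 N" for X
    using levels_initial[OF that, of N] that card_subset_eq[of X "{..<N}"] by (auto simp: levels_def)
  moreover have "{..<N} \<in> levels 0 N" by (simp add: levels_def)
  ultimately show ?thesis by blast
qed

lemma vandermonde_staircase:
  "vandermonde N (\<lambda>i. N - 1 - i) = (\<Prod>x<N. fact x)"
proof -
  have "vandermonde N (\<lambda>i. N - 1 - i) = (\<Prod>(i, j) | i < j \<and> j < N. real j - real i)"
    unfolding vandermonde_def by (intro prod.cong) (auto simp: of_nat_diff)
  also have "\<dots> = (\<Prod>(j, i)\<in>(SIGMA j:{..<N}. {..<j}). real j - real i)"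
    by (rule prod.reindex_bij_witness[of _ prod.swap prod.swap]) auto
  also have "\<dots> = (\<Prod>j<N. \<Prod>i<j. real j - real i)"
    by (rule prod.Sigma[symmetric]) auto
  also have "\<dots> = (\<Prod>j<N. fact j)"
    using fact_add[of 0] by simp
  finally show ?thesis .
qed

lemma staircase_image: "(\<lambda>i. N - 1 - i) ` {..<N} = {..<N :: nat}" "inj_on (\<lambda>i. N - 1 - i) {..<N}"
proof -
  show "inj_on (\<lambda>i. N - 1 - i) {..<N}" by (auto simp: inj_on_def)
  have "y \<in> (\<lambda>i. N - 1 - i) ` {..<N}" if "y < N" for y
    by (rule image_eqI[of _ _ "N - 1 - y"]) (use that in auto)
  then show "(\<lambda>i. N - 1 - i) ` {..<N} = {..<N}" by auto
qed

text \<open>The empty partition has weight 1: its matrix is unitriangular, and its Vandermonde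
  product equals the product of the factorials.\<close>

lemma schur_weight_staircase:
  assumes "h 0 = 1"
  shows "schur_weight h {..<N} = 1"
proof -
  let ?A = "mat N N (\<lambda>(i, j). jt_entry h N (N - 1 - i) j)"
  have "upper_triangular ?A"
    by (rule upper_triangularI) (auto simp: jt_entry_def)
  then have "det ?A = prod_list (diag_mat ?A)"
    by (rule det_upper_triangular) auto
  also have "diag_mat ?A = map (\<lambda>i. 1) [0..<N]"
    by (auto simp: diag_mat_def jt_entry_def assms)
  finally have "jt_det h N (\<lambda>i. N - 1 - i) = 1"
    by (simp add: jt_det_def map_replicate_const)
  then show ?thesis
    using schur_weight_image[OF staircase_image(2), of h N]
    by (simp only: staircase_image vandermonde_staircase) simp
qed

lemma psum_1_levels:
  assumes "X \<in> levels n N"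
  shows "psum 1 X = n"
proof -
  have X: "finite X" "card X = N" and S: "\<Sum>X = n + \<Sum>{..<N}" using assms by (auto simp: levels_def)
  have "psum 1 X = (\<Sum>x\<in>X. real x) - (\<Sum>i<N. real i)"
    unfolding psum_def node_def by (simp add: X sum.distrib sum_subtractf)
  also have "(\<Sum>x\<in>X. real x) = real (n + \<Sum>{..<N})"
    unfolding S[symmetric] by simp
  finally show ?thesis by simp
qed

text \<open>The product rule for k = 1, applied n times. Each step contributes the number of boxes,
  since \<open>lower_op 1 0\<close> maps the constant 1 to \<open>psum 1\<close>.\<close>

lemma level_sum_schur_weight:
  assumes "newton_pair h p" "n \<le> N"
  shows "(\<Sum>X\<in>levels n N. schur_weight h X) = p 1 ^ n / fact n"
  using assms(2)
proof (induction n)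
  case 0
  then show ?case using assms(1) by (simp add: levels_0 schur_weight_staircase newton_pair_def)
next
  case (Suc n)
  have "p 1 * (\<Sum>X\<in>levels n N. schur_weight h X * 1) =
      (\<Sum>X\<in>levels (n + 1) N. schur_weight h X * lower_op 1 0 (\<lambda>X. 1) X)"
    by (rule power_sum_level_sum[OF assms(1)]) (use Suc in auto)
  also have "\<dots> = (\<Sum>X\<in>levels (n + 1) N. schur_weight h X * real (n + 1))"
  proof (intro sum.cong refl)
    fix X assume X: "X \<in> levels (n + 1) N"
    have "lower_op 1 0 (\<lambda>X. 1) X = rho_moment 1 0 X"
      by (simp add: lower_op_def rho_moment_def)
    also have "\<dots> = psum 1 X"
      by (rule rho_moment_1) (use X Suc.prems in \<open>auto simp: levels_def\<close>)
    finally show "schur_weight h X * lower_op 1 0 (\<lambda>X. 1) X = schur_weight h X * real (n + 1)"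
      using psum_1_levels[OF X] by simp
  qed
  finally have "p 1 * (p 1 ^ n / fact n) = (\<Sum>X\<in>levels (n + 1) N. schur_weight h X) * real (n + 1)"
    using Suc by (simp add: sum_distrib_right)
  then have "(\<Sum>X\<in>levels (n + 1) N. schur_weight h X) = p 1 * (p 1 ^ n / fact n) / real (n + 1)"
    by (subst eq_divide_eq) simp
  then show ?case by (simp add: mult_ac)
qed

lemma level_sum_lower_ops:
  assumes np: "newton_pair h p" and ks: "\<forall>k\<in>set ks. k \<ge> 1" "n + sum_list ks \<le> N"
  shows "(\<Prod>k\<leftarrow>ks. p k) * (p 1 ^ n / fact n) =
    (\<Sum>X\<in>levels (n + sum_list ks) N. schur_weight h X * lower_ops ks X)"
  using ks
proof (induction ks)
  case Nil
  then show ?case using level_sum_schur_weight[OF np, of n N] by simp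
next
  case (Cons k ks)
  have IH: "(\<Prod>k\<leftarrow>ks. p k) * (p 1 ^ n / fact n) =
      (\<Sum>X\<in>levels (n + sum_list ks) N. schur_weight h X * lower_ops ks X)"
    by (rule Cons.IH) (use Cons.prems in auto)
  have "(\<Prod>k\<leftarrow>k # ks. p k) * (p 1 ^ n / fact n) =
      p k * (\<Sum>X\<in>levels (n + sum_list ks) N. schur_weight h X * lower_ops ks X)"
    by (simp only: list.map prod_list.Cons mult.assoc IH)
  also have "\<dots> = (\<Sum>X\<in>levels (n + sum_list ks + k) N. schur_weight h X * lower_op k 0 (lower_ops ks) X)"
    by (rule power_sum_level_sum[OF np]) (use Cons in auto)
  finally show ?case by (simp add: add_ac)
qed

section \<open>Standard tableaux and beta-sets\<close>

definition corners :: "(nat \<times> nat) set \<Rightarrow> (nat \<times> nat) set" where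
  "corners B = {(i, j) \<in> B. (Suc i, j) \<notin> B \<and> (i, Suc j) \<notin> B}"

text \<open>Standard fillings of arbitrary finite sets of boxes: the branching rule does not need the set to
  be a Young diagram.\<close>

definition fillings :: "(nat \<times> nat) set \<Rightarrow> (nat \<times> nat \<Rightarrow> nat) set" where
  "fillings B = {T \<in> extensional B. bij_betw T B {1..card B} \<and>
     (\<forall>i j. (i, j) \<in> B \<longrightarrow> (i, Suc j) \<in> B \<longrightarrow> T (i, j) < T (i, Suc j)) \<and>
     (\<forall>i j. (i, j) \<in> B \<longrightarrow> (Suc i, j) \<in> B \<longrightarrow> T (i, j) < T (Suc i, j))}"

lemma finite_fillings:
  assumes "finite B"
  shows "finite (fillings B)"
proof (rule finite_subset)
  show "fillings B \<subseteq> PiE B (\<lambda>_. {1..card B})"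
    by (auto simp: fillings_def bij_betw_def PiE_def)
  show "finite (PiE B (\<lambda>_. {1..card B}))"
    using assms by (rule finite_PiE) simp
qed

lemma card_fillings_corner:
  assumes B: "finite B" and c: "c \<in> corners B"
  shows "card {T \<in> fillings B. T c = card B} = card (fillings (B - {c}))"
proof (rule bij_betw_same_card[of "\<lambda>T. restrict T (B - {c})"],
    rule bij_betw_byWitness[where f' = "\<lambda>T. T(c := card B)"])
  have cB: "c \<in> B" using c by (auto simp: corners_def)
  have n: "card (B - {c}) = card B - 1" using cB B by simp
  have n1: "card B \<ge> 1" using cB B by (metis One_nat_def Suc_leI card_gt_0_iff empty_iff)
  have ivl: "{1..card B} - {card B} = {1..card B - 1}" using n1 by auto
  show "\<forall>T\<in>{T \<in> fillings B. T c = card B}. (restrict T (B - {c}))(c := card B) = T"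
    by (auto simp: fillings_def restrict_def extensional_def fun_eq_iff)
  show "\<forall>T\<in>fillings (B - {c}). restrict (T(c := card B)) (B - {c}) = T"
    by (auto simp: fillings_def restrict_def extensional_def fun_eq_iff)
  show "(\<lambda>T. restrict T (B - {c})) ` {T \<in> fillings B. T c = card B} \<subseteq> fillings (B - {c})"
  proof (clarify)
    fix T assume T: "T \<in> fillings B" "T c = card B"
    then have "bij_betw T B {1..card B}" by (simp add: fillings_def)
    then have "bij_betw T (B - {c}) ({1..card B} - {T c})"
      using cB n1 T(2) by (intro bij_betw_DiffI) (auto simp: bij_betw_def)
    then have "bij_betw (restrict T (B - {c})) (B - {c}) {1..card (B - {c})}"
      unfolding T(2) ivl n by (subst bij_betw_cong[of _ _ T]) auto
    then show "restrict T (B - {c}) \<in> fillings (B - {c})"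
      using T(1) by (auto simp: fillings_def)
  qed
  show "(\<lambda>T. T(c := card B)) ` fillings (B - {c}) \<subseteq> {T \<in> fillings B. T c = card B}"
  proof (clarify)
    fix T assume T: "T \<in> fillings (B - {c})"
    let ?T = "T(c := card B)"
    have b: "bij_betw T (B - {c}) {1..card B - 1}" using T n by (simp add: fillings_def)
    then have lt: "T x < card B" if "x \<in> B" "x \<noteq> c" for x
    proof -
      have "T x \<in> {1..card B - 1}" using bij_betwE[OF b] that by auto
      then show ?thesis using n1 by auto
    qed
    have "bij_betw ?T (B - {c}) {1..card B - 1}"
      using b by (subst bij_betw_cong[of _ _ T]) auto
    moreover have "bij_betw ?T {c} {card B}" by (simp add: bij_betw_def)
    ultimately have "bij_betw ?T ((B - {c}) \<union> {c}) ({1..card B - 1} \<union> {card B})"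
      by (rule bij_betw_combine) (use n1 in auto)
    moreover have "(B - {c}) \<union> {c} = B" "{1..card B - 1} \<union> {card B} = {1..card B}"
      using cB n1 by auto
    ultimately have "bij_betw ?T B {1..card B}" by simp
    moreover have "?T \<in> extensional B" using T cB by (auto simp: fillings_def extensional_def)
    moreover have "?T (i, j) < ?T (i, Suc j)" if "(i, j) \<in> B" "(i, Suc j) \<in> B" for i j
      using that T c lt[of "(i, j)"] by (auto simp: fillings_def corners_def)
    moreover have "?T (i, j) < ?T (Suc i, j)" if "(i, j) \<in> B" "(Suc i, j) \<in> B" for i j
      using that T c lt[of "(i, j)"] by (auto simp: fillings_def corners_def)
    ultimately show "?T \<in> fillings B \<and> ?T c = card B"
      by (simp add: fillings_def)
  qed
qed

text \<open>Fillings are sorted by the place of their largest entry, which has no box to its right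
  or below it.\<close>

lemma card_fillings_branching:
  assumes B: "finite B" "B \<noteq> {}"
  shows "card (fillings B) = (\<Sum>c\<in>corners B. card (fillings (B - {c})))"
proof -
  have n1: "card B \<ge> 1" using B by (simp add: Suc_le_eq card_gt_0_iff)
  have fin: "finite (corners B)" using B(1) by (rule rev_finite_subset) (auto simp: corners_def)
  have "fillings B = (\<Union>c\<in>corners B. {T \<in> fillings B. T c = card B})"
  proof (intro equalityI subsetI)
    fix T assume T: "T \<in> fillings B"
    then have bij: "bij_betw T B {1..card B}" by (simp add: fillings_def)
    then obtain c where c: "c \<in> B" "T c = card B"
      using n1 by (auto simp: bij_betw_def image_iff set_eq_iff dest!: spec[of _ "card B"])
    have le: "T x \<le> card B" if "x \<in> B" for x
      using bij that by (fastforce simp: bij_betw_def)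
    obtain i j where ij: "c = (i, j)" by (cases c)
    have "(Suc i, j) \<notin> B" "(i, Suc j) \<notin> B"
      using T c le[of "(Suc i, j)"] le[of "(i, Suc j)"] ij by (fastforce simp: fillings_def)+
    then show "T \<in> (\<Union>c\<in>corners B. {T \<in> fillings B. T c = card B})"
      using c T ij by (auto simp: corners_def)
  qed auto
  then have "card (fillings B) = card (\<Union>c\<in>corners B. {T \<in> fillings B. T c = card B})" by simp
  also have "\<dots> = (\<Sum>c\<in>corners B. card {T \<in> fillings B. T c = card B})"
  proof (rule card_UN_disjoint[OF fin])
    show "\<forall>c\<in>corners B. finite {T \<in> fillings B. T c = card B}"
      using finite_fillings[OF B(1)] by simp
    show "\<forall>c\<in>corners B. \<forall>c'\<in>corners B. c \<noteq> c' \<longrightarrow>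
        {T \<in> fillings B. T c = card B} \<inter> {T \<in> fillings B. T c' = card B} = {}"
    proof (intro ballI impI)
      fix c c' assume "c \<in> corners B" "c' \<in> corners B" "c \<noteq> c'"
      moreover from this have "c \<in> B" "c' \<in> B" by (auto simp: corners_def)
      ultimately have *: "T c \<noteq> T c'" if "T \<in> fillings B" for T
        using that by (auto simp: fillings_def bij_betw_def inj_on_eq_iff)
      show "{T \<in> fillings B. T c = card B} \<inter> {T \<in> fillings B. T c' = card B} = {}"
      proof (rule equals0I)
        fix T assume "T \<in> {T \<in> fillings B. T c = card B} \<inter> {T \<in> fillings B. T c' = card B}"
        then have "T \<in> fillings B" "T c = T c'" by auto
        with * show False by blast
      qed
    qed
  qed
  also have "\<dots> = (\<Sum>c\<in>corners B. card (fillings (B - {c})))"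
    using card_fillings_corner[OF B(1)] by simp
  finally show ?thesis .
qed

section \<open>The dimension formula in terms of beads\<close>

definition diagram :: "nat \<Rightarrow> (nat \<Rightarrow> nat) \<Rightarrow> (nat \<times> nat) set" where
  "diagram N R = {(i, j). i < N \<and> j < R i}"

definition beta :: "nat \<Rightarrow> (nat \<Rightarrow> nat) \<Rightarrow> nat \<Rightarrow> nat" where
  "beta N R i = R i + (N - 1 - i)"

definition weak_decr :: "nat \<Rightarrow> (nat \<Rightarrow> nat) \<Rightarrow> bool" where
  "weak_decr N R \<longleftrightarrow> (\<forall>i. Suc i < N \<longrightarrow> R (Suc i) \<le> R i)"

lemma diagram_Sigma: "diagram N R = (SIGMA i:{..<N}. {..<R i})"
  by (auto simp: diagram_def)

lemma finite_diagram: "finite (diagram N R)"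
  by (simp add: diagram_Sigma)

lemma card_diagram: "card (diagram N R) = (\<Sum>i<N. R i)"
  by (simp add: diagram_Sigma)

lemma strict_decr_beta: "weak_decr N R \<Longrightarrow> strict_decr N (beta N R)"
  by (fastforce simp: strict_decr_Suc weak_decr_def beta_def)

lemma sum_staircase: "(\<Sum>i<N. N - 1 - i) = \<Sum>{..<N :: nat}"
  using sum.reindex[OF staircase_image(2), of "\<lambda>x. x" N] unfolding staircase_image(1)
  by (simp add: o_def)

lemma beta_levels:
  assumes "weak_decr N R"
  shows "beta N R ` {..<N} \<in> levels (\<Sum>i<N. R i) N"
proof -
  have inj: "inj_on (beta N R) {..<N}" by (rule strict_decr_inj[OF strict_decr_beta[OF assms]])
  have "\<Sum>(beta N R ` {..<N}) = (\<Sum>i<N. beta N R i)" by (simp add: sum.reindex[OF inj])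
  also have "\<dots> = (\<Sum>i<N. R i) + \<Sum>{..<N}"
    unfolding beta_def sum.distrib sum_staircase ..
  finally show ?thesis by (simp add: levels_def card_image[OF inj])
qed

text \<open>Frobenius' dimension formula. On the right, removing a box multiplies the normalized
  Vandermonde product by \<open>rho 1\<close>. Over all beads these factors add up to the number of
  boxes by \<open>rho_moment_1\<close>, which turns n! into (n + 1)!, so the right side obeys the
  branching rule.\<close>

lemma card_fillings_diagram:
  assumes "weak_decr N R"
  shows "real (card (fillings (diagram N R))) =
    fact (\<Sum>i<N. R i) * (vandermonde N (beta N R) / (\<Prod>x\<in>beta N R ` {..<N}. fact x))"
  using assms
proof (induction "\<Sum>i<N. R i" arbitrary: R)
  case 0
  then have R: "R i = 0" if "i < N" for i using that by simp
  then have "diagram N R = {}" by (auto simp: diagram_def)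
  then have "fillings (diagram N R) = {\<lambda>_. undefined}"
    by (auto simp: fillings_def bij_betw_def)
  moreover have "vandermonde N (beta N R) = vandermonde N (\<lambda>i. N - 1 - i)"
    by (rule vandermonde_cong) (simp add: beta_def R)
  moreover have "beta N R ` {..<N} = (\<lambda>i. N - 1 - i) ` {..<N}"
    by (rule image_cong) (simp_all add: beta_def R)
  ultimately show ?case using 0 by (simp only: staircase_image vandermonde_staircase) simp
next
  case (Suc n)
  let ?f = "beta N R"
  let ?X = "?f ` {..<N}"
  \<comment> \<open>The rows that end in a removable box. In any other row the lowered bead is
    negative or hits the bead of the next row, so \<open>rho 1\<close> is 0 there.\<close>
  define V where "V = {i. i < N \<and> 0 < R i \<and> (Suc i < N \<longrightarrow> R (Suc i) < R i)}"
  define dw where "dw = (\<lambda>R. vandermonde N (beta N R) / (\<Prod>x\<in>beta N R ` {..<N}. fact x))"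
  have anti: "R j \<le> R i" if "i \<le> j" "j < N" for i j
    using that Suc.prems by (induction j) (fastforce simp: weak_decr_def le_Suc_eq)+
  have inj: "inj_on ?f {..<N}" by (rule strict_decr_inj[OF strict_decr_beta[OF Suc.prems]])
  have finV: "finite V" by (rule finite_subset[of _ "{..<N}"]) (auto simp: V_def)
  have cor: "corners (diagram N R) = (\<lambda>i. (i, R i - 1)) ` V"
  proof (intro equalityI subsetI)
    fix c assume "c \<in> corners (diagram N R)"
    then obtain i j where c: "c = (i, j)" "i < N" "j < R i" "\<not> (Suc i < N \<and> j < R (Suc i))" "\<not> Suc j < R i"
      by (auto simp: corners_def diagram_def)
    then have "j = R i - 1" "i \<in> V" by (auto simp: V_def)
    then show "c \<in> (\<lambda>i. (i, R i - 1)) ` V" using c by auto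
  qed (auto simp: corners_def diagram_def V_def)
  have ne: "diagram N R \<noteq> {}"
    using Suc.hyps(2) card_diagram[of N R] by (metis Zero_neq_Suc card.empty)
  have step: "real (card (fillings (diagram N R - {(i, R i - 1)}))) = fact n * (rho 1 ?X (?f i) * dw R)"
    if i: "i \<in> V" for i
  proof -
    let ?R = "R(i := R i - 1)"
    have iN: "i < N" "0 < R i" using i by (auto simp: V_def)
    have "diagram N R - {(i, R i - 1)} = diagram N ?R"
      using iN by (auto simp: diagram_def split: if_splits)
    moreover have wd: "weak_decr N ?R"
      using i Suc.prems anti[of _ i] by (fastforce simp: weak_decr_def V_def)
    moreover have "(\<Sum>j<N. ?R j) = n"
    proof -
      have "(\<Sum>j<N. ?R j) + 1 = (\<Sum>j<N. R j)"
        using iN by (simp add: sum.remove[of "{..<N}" i])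
      then show ?thesis using Suc.hyps(2) by simp
    qed
    ultimately have "real (card (fillings (diagram N R - {(i, R i - 1)}))) = fact n * dw ?R"
      using Suc.hyps(1)[of ?R] by (simp add: dw_def)
    moreover have "dw ?R = rho 1 ?X (?f i) * dw R"
    proof -
      have f: "(beta N ?R)(i := ?f i) = ?f"
        using iN by (auto simp: beta_def fun_eq_iff)
      have fi: "beta N ?R i + 1 = ?f i" using iN by (simp add: beta_def)
      have "?f i \<notin> beta N ?R ` {..<N}"
      proof
        assume "?f i \<in> beta N ?R ` {..<N}"
        then obtain j where j: "j < N" "?f i = beta N ?R j" by auto
        show False
        proof (cases "j = i")
          case True
          then show ?thesis using j fi by simp
        next
          case False
          then have "?f i = ?f j" using j by (simp add: beta_def)
          then show ?thesis using inj j iN False by (auto simp: inj_on_def)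
        qed
      qed
      then show ?thesis
        unfolding dw_def
        by (rule rho_raise(1)[OF strict_decr_inj[OF strict_decr_beta[OF wd]] iN(1), of 1, unfolded f fi])
    qed
    ultimately show ?thesis by simp
  qed
  have zero: "rho 1 ?X (?f i) = 0" if i: "i < N" "i \<notin> V" for i
  proof (rule rho_eq_0)
    show "?f i < 1 \<or> ?f i - 1 \<in> ?X - {?f i}"
    proof (cases "?f i = 0")
      case False
      have "Suc i < N \<and> R (Suc i) = R i"
      proof (cases "R i = 0")
        case True
        then have "Suc i < N" using False i by (auto simp: beta_def)
        then show ?thesis using anti[of i "Suc i"] True by simp
      next
        case False
        then show ?thesis using i anti[of i "Suc i"] by (auto simp: V_def)
      qed
      then have "?f i - 1 = ?f (Suc i)" "Suc i < N" by (auto simp: beta_def)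
      then show ?thesis using False by auto
    qed simp
  qed auto
  have "real (card (fillings (diagram N R))) =
      (\<Sum>c\<in>corners (diagram N R). real (card (fillings (diagram N R - {c}))))"
    using card_fillings_branching[OF finite_diagram ne] by simp
  also have "\<dots> = (\<Sum>i\<in>V. real (card (fillings (diagram N R - {(i, R i - 1)}))))"
    unfolding cor by (subst sum.reindex) (auto simp: inj_on_def)
  also have "\<dots> = (\<Sum>i\<in>V. fact n * (rho 1 ?X (?f i) * dw R))"
    by (intro sum.cong refl step)
  also have "\<dots> = (\<Sum>i<N. fact n * (rho 1 ?X (?f i) * dw R))"
  proof (rule sum.mono_neutral_left)
    show "V \<subseteq> {..<N}" by (auto simp: V_def)
    show "\<forall>i\<in>{..<N} - V. fact n * (rho 1 ?X (?f i) * dw R) = 0"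
      using zero by auto
  qed simp
  also have "\<dots> = fact n * (\<Sum>i<N. rho 1 ?X (?f i)) * dw R"
    by (simp add: sum_distrib_left sum_distrib_right mult.assoc)
  also have "(\<Sum>i<N. rho 1 ?X (?f i)) = rho_moment 1 0 ?X"
    by (simp add: rho_moment_def sum.reindex[OF inj])
  also have "\<dots> = psum 1 ?X"
    by (rule rho_moment_1) (use Suc.hyps(2) in \<open>auto intro: ccontr\<close>)
  also have "\<dots> = real (Suc n)"
    using psum_1_levels[OF beta_levels[OF Suc.prems]] Suc.hyps(2) by simp
  finally show ?case
    unfolding Suc.hyps(2)[symmetric] dw_def by (simp add: mult_ac)
qed

section \<open>Partitions as beta-sets\<close>

definition row_len :: "nat list \<Rightarrow> nat \<Rightarrow> nat" where
  "row_len \<nu> i = (if i < length \<nu> then \<nu> ! i else 0)"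

definition partitions_of :: "nat \<Rightarrow> nat list set" where
  "partitions_of n = {\<nu> \<in> partitions. sum_list \<nu> = n}"

lemma row_len_antimono:
  assumes "\<nu> \<in> partitions" "i \<le> j"
  shows "row_len \<nu> j \<le> row_len \<nu> i"
  using assms sorted_wrt_nth_less[of "(\<ge>)" \<nu> i j]
  by (cases "i = j") (auto simp: partitions_def row_len_def)

lemma weak_decr_row_len: "\<nu> \<in> partitions \<Longrightarrow> weak_decr N (row_len \<nu>)"
  using row_len_antimono[of \<nu> _ "Suc _"] by (simp add: weak_decr_def)

lemma row_len_pos_iff: "\<nu> \<in> partitions \<Longrightarrow> 0 < row_len \<nu> i \<longleftrightarrow> i < length \<nu>"
  by (auto simp: partitions_def row_len_def) (metis gr0I nth_mem)

lemma sum_row_len: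
  assumes "length \<nu> \<le> N"
  shows "(\<Sum>i<N. row_len \<nu> i) = sum_list \<nu>"
proof -
  have "(\<Sum>i<N. row_len \<nu> i) = (\<Sum>i<length \<nu>. \<nu> ! i)"
    by (rule sum.mono_neutral_cong_right) (use assms in \<open>auto simp: row_len_def\<close>)
  then show ?thesis by (simp add: sum_list_sum_nth atLeast0LessThan)
qed

lemma length_le_sum_list:
  assumes "\<nu> \<in> partitions"
  shows "length \<nu> \<le> sum_list \<nu>"
proof -
  have "0 \<notin> set \<nu>" using assms by (simp add: partitions_def)
  then show ?thesis by (induction \<nu>) (auto simp: Suc_le_eq intro: add_strict_mono)
qed

lemma boxes_diagram: "length \<nu> \<le> N \<Longrightarrow> boxes \<nu> = diagram N (row_len \<nu>)"
  by (auto simp: boxes_def diagram_def row_len_def split: if_splits)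

lemma card_boxes: "card (boxes \<nu>) = sum_list \<nu>"
  using boxes_diagram[of \<nu> "length \<nu>"] card_diagram[of "length \<nu>" "row_len \<nu>"] sum_row_len[of \<nu> "length \<nu>"]
  by simp

lemma num_tableaux_eq:
  assumes "\<nu> \<in> partitions" "length \<nu> \<le> N"
  shows "real (num_tableaux \<nu>) = fact (sum_list \<nu>) *
    (vandermonde N (beta N (row_len \<nu>)) / (\<Prod>x\<in>beta N (row_len \<nu>) ` {..<N}. fact x))"
proof -
  \<comment> \<open>\<open>standard_tableaux\<close> asks only for the right or lower box of a pair
    to exist, \<open>fillings\<close> asks for both. Closure of the diagram under smaller indices
    supplies the other one.\<close>
  have down: "(i, j) \<in> boxes \<nu>" if "(i', j') \<in> boxes \<nu>" "i \<le> i'" "j \<le> j'" for i j i' j'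
  proof -
    have "j' < row_len \<nu> i'" using that(1) by (simp add: boxes_def row_len_def)
    then have "j < row_len \<nu> i" using row_len_antimono[OF assms(1) that(2)] that(3) by simp
    then show ?thesis by (auto simp: boxes_def row_len_def split: if_splits)
  qed
  have down1: "(i, j) \<in> boxes \<nu>" if "(i, Suc j) \<in> boxes \<nu>" for i j
    by (rule down[OF that]) auto
  have down2: "(i, j) \<in> boxes \<nu>" if "(Suc i, j) \<in> boxes \<nu>" for i j
    by (rule down[OF that]) auto
  have "standard_tableaux \<nu> = fillings (boxes \<nu>)"
    unfolding standard_tableaux_def fillings_def card_boxes
    by (intro Collect_cong) (use down1 down2 in blast)
  then show ?thesis
    using card_fillings_diagram[OF weak_decr_row_len[OF assms(1)], of N] sum_row_len[OF assms(2)]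
      boxes_diagram[OF assms(2)] by (simp add: num_tableaux_def)
qed

definition beta_set :: "nat \<Rightarrow> nat list \<Rightarrow> nat set" where
  "beta_set N \<nu> = beta N (row_len \<nu>) ` {..<N}"

text \<open>N >= n beads suffice, since a partition of n has at most n rows; missing rows count as
  empty.\<close>

lemma bij_betw_beta_set:
  assumes "n \<le> N"
  shows "bij_betw (beta_set N) (partitions_of n) (levels n N)"
proof (rule bij_betw_imageI)
  have len: "length \<nu> \<le> N" if "\<nu> \<in> partitions_of n" for \<nu>
    using length_le_sum_list[of \<nu>] that assms by (simp add: partitions_of_def)
  show "inj_on (beta_set N) (partitions_of n)"
  proof (rule inj_onI)
    fix \<nu> \<mu> assume \<nu>: "\<nu> \<in> partitions_of n" and \<mu>: "\<mu> \<in> partitions_of n"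
      and eq: "beta_set N \<nu> = beta_set N \<mu>"
    have p: "\<nu> \<in> partitions" "\<mu> \<in> partitions" using \<nu> \<mu> by (auto simp: partitions_of_def)
    have "beta N (row_len \<nu>) i = beta N (row_len \<mu>) i" if "i < N" for i
      using strict_decr_unique[OF strict_decr_beta[OF weak_decr_row_len[OF p(1)]] that]
        strict_decr_unique[OF strict_decr_beta[OF weak_decr_row_len[OF p(2)]] that] eq
      by (simp add: beta_set_def)
    then have eqR: "row_len \<nu> i = row_len \<mu> i" for i
    proof (cases "i < N")
      case True
      then show ?thesis using \<open>\<And>i. i < N \<Longrightarrow> beta N (row_len \<nu>) i = beta N (row_len \<mu>) i\<close>[of i]
        by (simp add: beta_def)
    next
      case False
      then show ?thesis using len[OF \<nu>] len[OF \<mu>] by (simp add: row_len_def)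
    qed
    then have "i < length \<nu> \<longleftrightarrow> i < length \<mu>" "i < length \<nu> \<Longrightarrow> \<nu> ! i = \<mu> ! i" for i
      using row_len_pos_iff[OF p(1), of i] row_len_pos_iff[OF p(2), of i] eqR[of i]
      by (auto simp: row_len_def split: if_splits)
    then show "\<nu> = \<mu>" by (metis linorder_neqE_nat nat_less_le nth_equalityI)
  qed
  show "beta_set N ` partitions_of n = levels n N"
  proof (intro equalityI subsetI)
    fix X assume "X \<in> beta_set N ` partitions_of n"
    then obtain \<nu> where \<nu>: "\<nu> \<in> partitions_of n" "X = beta_set N \<nu>" by auto
    then show "X \<in> levels n N"
      using beta_levels[OF weak_decr_row_len, of \<nu> N] sum_row_len[OF len[OF \<nu>(1)]]
      by (simp add: partitions_of_def beta_set_def)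
  next
    fix X assume X: "X \<in> levels n N"
    then have fin: "finite X" and cX: "card X = N" and S: "\<Sum>X = n + \<Sum>{..<N}"
      by (auto simp: levels_def)
    let ?f = "decr_enum X"
    have sd: "strict_decr N ?f" and im: "?f ` {..<N} = X"
      using strict_decr_decr_enum[OF fin] by (simp_all add: cX)
    \<comment> \<open>N - 1 - i beads lie below bead i, so the natural subtraction in
      \<open>R\<close> loses nothing.\<close>
    have ge: "N - 1 - i \<le> ?f i" if "i < N" for i
    proof -
      have "card {y \<in> X. y < ?f i} \<le> card {..<?f i}" by (rule card_mono) auto
      then show ?thesis using card_below_strict_decr[OF sd that] by (simp add: im)
    qed
    define R where "R = (\<lambda>i. ?f i - (N - 1 - i))"
    have bR: "beta N R i = ?f i" if "i < N" for i using ge[OF that] by (simp add: beta_def R_def)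
    have "R (Suc i) \<le> R i" if "Suc i < N" for i
      using sd that by (auto simp: strict_decr_Suc R_def)
    then have anti: "R j \<le> R i" if "i \<le> j" "j < N" for i j
      using that by (induction j) (fastforce simp: le_Suc_eq)+
    \<comment> \<open>The number of nonzero rows, N if all are nonzero. The empty rows have to be
      cut off because a partition lists only nonzero parts.\<close>
    define L where "L = (LEAST i. N \<le> i \<or> R i = 0)"
    have L: "N \<le> L \<or> R L = 0" unfolding L_def by (rule LeastI[of _ N]) simp
    have LN: "L \<le> N" unfolding L_def by (rule Least_le) simp
    have pos: "0 < R i" if "i < L" for i
      using not_less_Least[of i "\<lambda>i. N \<le> i \<or> R i = 0"] that by (simp add: L_def)
    let ?\<nu> = "map R [0..<L]"
    have "sorted_wrt (\<ge>) ?\<nu>"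
      using anti LN by (auto simp: sorted_wrt_iff_nth_less)
    moreover have "0 \<notin> set ?\<nu>" using pos by fastforce
    ultimately have part: "?\<nu> \<in> partitions" by (simp add: partitions_def)
    have row_len: "row_len ?\<nu> i = R i" if "i < N" for i
      using that L anti[of L i] by (auto simp: row_len_def)
    have "beta_set N ?\<nu> = ?f ` {..<N}"
      unfolding beta_set_def
      by (rule image_cong) (use bR row_len in \<open>auto simp: beta_def\<close>)
    then have bs: "beta_set N ?\<nu> = X" by (simp only: im)
    have "\<Sum>X = sum_list ?\<nu> + \<Sum>{..<N}"
      using beta_levels[OF weak_decr_row_len[OF part], of N] sum_row_len[of ?\<nu> N] LN bs
      by (simp add: levels_def beta_set_def)
    then have "?\<nu> \<in> partitions_of n" using S part by (simp add: partitions_of_def)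
    with bs show "X \<in> beta_set N ` partitions_of n" by blast
  qed
qed

lemma finite_partitions_of: "finite (partitions_of n)"
  using bij_betw_finite[OF bij_betw_beta_set[of n n]] finite_levels by simp

text \<open>An empty row appended at the bottom of the matrix is the last unit vector, so expanding
  along it removes it. This lets a Schur function be computed with any sufficient number of
  beads.\<close>

lemma det_jt_pad:
  fixes h :: "nat \<Rightarrow> real"
  assumes "h 0 = 1" "\<And>i. L \<le> i \<Longrightarrow> R i = 0" "L \<le> N"
  defines "e \<equiv> \<lambda>(i, j). if i \<le> R i + j then h (R i + j - i) else 0"
  shows "det (mat N N e) = det (mat L L e)"
  using assms(3)
proof (induction N rule: dec_induct)
  case (step N)
  let ?A = "mat (Suc N) (Suc N) e"
  have "det ?A = (\<Sum>j<Suc N. ?A $$ (N, j) * cofactor ?A N j)"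
    by (rule laplace_expansion_row) auto
  also have "\<dots> = cofactor ?A N N"
    using assms(2)[OF step.hyps(1)] by (simp add: e_def assms(1))
  also have "mat_delete ?A N N = mat N N e"
    by (intro eq_matI) (auto simp: mat_delete_def)
  then have "cofactor ?A N N = det (mat N N e)" by (simp add: cofactor_def)
  finally show ?case using step.IH by simp
qed simp

lemma newton_pair_complete_sym:
  "newton_pair (\<lambda>n. sym_eval x (complete_sym n)) x"
  unfolding newton_pair_def
proof (intro conjI allI impI)
  show "sym_eval x (complete_sym 0) = 1" by (simp add: complete_sym.simps sym_eval_one)
  fix n :: nat assume n: "n \<ge> 1"
  have "sym_eval x (complete_sym n) =
      1 / real n * (\<Sum>k\<in>{1..n}. x k * sym_eval x (complete_sym (n - k)))"
    using n by (subst complete_sym.simps)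
      (simp add: sym_eval_mult sym_eval_const sym_eval_sum sym_eval_power_sum)
  then show "real n * sym_eval x (complete_sym n) =
      (\<Sum>k\<in>{1..n}. x k * sym_eval x (complete_sym (n - k)))"
    using n by simp
qed

lemma sym_eval_schur:
  assumes "length \<nu> \<le> N"
  shows "sym_eval x (schur \<nu>) = jt_det (\<lambda>n. sym_eval x (complete_sym n)) N (beta N (row_len \<nu>))"
proof -
  interpret comm_ring_hom "sym_eval x"
    by unfold_locales (simp_all add: sym_eval_zero sym_eval_one sym_eval_add sym_eval_mult)
  let ?h = "\<lambda>n. sym_eval x (complete_sym n)" and ?L = "length \<nu>"
  let ?e = "\<lambda>(i, j). if i \<le> row_len \<nu> i + j then ?h (row_len \<nu> i + j - i) else 0"
  have "sym_eval x (schur \<nu>) = det (mat ?L ?L ?e)"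
    unfolding schur_def hom_det[symmetric]
    by (intro arg_cong[of _ _ det] eq_matI) (auto simp: row_len_def)
  also have "\<dots> = det (mat N N ?e)"
    by (rule det_jt_pad[symmetric])
      (use newton_pair_complete_sym[of x] assms in \<open>auto simp: newton_pair_def row_len_def\<close>)
  also have "\<dots> = jt_det ?h N (beta N (row_len \<nu>))"
    unfolding jt_det_def
  proof (intro arg_cong[of _ _ det] eq_matI)
    fix i j assume "i < dim_row (mat N N (\<lambda>(i, j). jt_entry ?h N (beta N (row_len \<nu>) i) j))"
      "j < dim_col (mat N N (\<lambda>(i, j). jt_entry ?h N (beta N (row_len \<nu>) i) j))"
    then have ij: "i < N" "j < N" by auto
    define y where "y = beta N (row_len \<nu>) i + j + 1"
    have "y + i = row_len \<nu> i + j + N" using ij by (simp add: y_def beta_def)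
    then have "N \<le> y \<longleftrightarrow> i \<le> row_len \<nu> i + j" "y - N = row_len \<nu> i + j - i" by auto
    then have "jt_entry ?h N (beta N (row_len \<nu>) i) j =
        (if i \<le> row_len \<nu> i + j then ?h (row_len \<nu> i + j - i) else 0)"
      unfolding jt_entry_def y_def[symmetric] by simp
    then show "mat N N ?e $$ (i, j) = mat N N (\<lambda>(i, j). jt_entry ?h N (beta N (row_len \<nu>) i) j) $$ (i, j)"
      using ij by simp
  qed auto
  finally show ?thesis .
qed

lemma schur_weight_beta_set:
  assumes "\<nu> \<in> partitions" "length \<nu> \<le> N"
  shows "schur_weight (\<lambda>n. sym_eval x (complete_sym n)) (beta_set N \<nu>) =
    real (num_tableaux \<nu>) / fact (sum_list \<nu>) * sym_eval x (schur \<nu>)"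
  using schur_weight_image[OF strict_decr_inj[OF strict_decr_beta[OF weak_decr_row_len[OF assms(1), of N]]]]
  by (simp add: beta_set_def num_tableaux_eq[OF assms] sym_eval_schur[OF assms(2)])

text \<open>\<open>x\<close> is an arbitrary specialization of the power sums and enters the right
  side through Schur functions only. The identity can therefore be integrated against a measure of
  which just the Schur averages are known.\<close>

theorem sum_schur_lower_ops:
  assumes "\<forall>k\<in>set ks. k \<ge> 1" "n + sum_list ks \<le> N"
  shows "(\<Prod>k\<leftarrow>ks. x k) * (x 1 ^ n / fact n) = (\<Sum>\<nu>\<in>partitions_of (n + sum_list ks).
    real (num_tableaux \<nu>) / fact (n + sum_list ks) * sym_eval x (schur \<nu>) * lower_ops ks (beta_set N \<nu>))"
proof -
  let ?h = "\<lambda>n. sym_eval x (complete_sym n)" and ?m = "n + sum_list ks"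
  have "(\<Prod>k\<leftarrow>ks. x k) * (x 1 ^ n / fact n) =
      (\<Sum>X\<in>levels ?m N. schur_weight ?h X * lower_ops ks X)"
    by (rule level_sum_lower_ops[OF newton_pair_complete_sym assms])
  also have "\<dots> = (\<Sum>\<nu>\<in>partitions_of ?m. schur_weight ?h (beta_set N \<nu>) * lower_ops ks (beta_set N \<nu>))"
    by (rule sum.reindex_bij_betw[OF bij_betw_beta_set[OF assms(2)], symmetric])
  also have "\<dots> = (\<Sum>\<nu>\<in>partitions_of ?m. real (num_tableaux \<nu>) / fact ?m * sym_eval x (schur \<nu>) *
      lower_ops ks (beta_set N \<nu>))"
  proof (intro sum.cong refl)
    fix \<nu> assume "\<nu> \<in> partitions_of ?m"
    then have "\<nu> \<in> partitions" "sum_list \<nu> = ?m" "length \<nu> \<le> N"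
      using length_le_sum_list[of \<nu>] assms(2) by (auto simp: partitions_of_def)
    then show "schur_weight ?h (beta_set N \<nu>) * lower_ops ks (beta_set N \<nu>) =
        real (num_tableaux \<nu>) / fact ?m * sym_eval x (schur \<nu>) * lower_ops ks (beta_set N \<nu>)"
      using schur_weight_beta_set[of \<nu> N x] by simp
  qed
  finally show ?thesis .
qed

section \<open>Modified Frobenius coordinates\<close>

text \<open>A nonnegative term is at most the whole sum, so k - 1 of its k factors can be replaced
  by s.\<close>

lemma sum_power_le:
  fixes a :: "nat \<Rightarrow> real"
  assumes "\<And>i. 0 \<le> a i" "summable a" "suminf a \<le> s" "k \<ge> 1"
  shows "summable (\<lambda>i. a i ^ k)" "(suminf (\<lambda>i. a i ^ k)) \<le> suminf a * s ^ (k - 1)"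
proof -
  have le: "a i ^ k \<le> a i * s ^ (k - 1)" for i
  proof -
    have "a i \<le> suminf a"
      using sum_le_suminf[OF assms(2), of "{i}"] assms(1) by simp
    then have "a i ^ (k - 1) \<le> s ^ (k - 1)" using assms by (intro power_mono) auto
    moreover have "a i ^ k = a i * a i ^ (k - 1)" using assms(4) by (cases k) auto
    ultimately show ?thesis using assms(1) by (simp add: mult_left_mono)
  qed
  have s: "summable (\<lambda>i. a i * s ^ (k - 1))" by (rule summable_mult2[OF assms(2)])
  show "summable (\<lambda>i. a i ^ k)"
    by (rule summable_comparison_test_ev[OF _ s]) (use le assms(1) in auto)
  then show "(suminf (\<lambda>i. a i ^ k)) \<le> suminf a * s ^ (k - 1)"
    using suminf_le[OF le _ s] suminf_mult2[OF assms(2), of "s ^ (k - 1)"] by simp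
qed

lemma thoma_power_sum_bound:
  assumes "(\<alpha>, \<beta>, r) \<in> thoma_cone" "k \<ge> 1"
  shows "\<bar>thoma_power_sum (\<alpha>, \<beta>, r) k\<bar> \<le> r ^ k"
proof (cases "k = 1")
  case True
  then show ?thesis using assms by (simp add: thoma_cone_def)
next
  case False
  have c: "\<And>i. 0 \<le> \<alpha> i" "\<And>i. 0 \<le> \<beta> i" "summable \<alpha>" "summable \<beta>" "suminf \<alpha> + suminf \<beta> \<le> r"
    using assms(1) by (auto simp: thoma_cone_def)
  have nn: "0 \<le> suminf \<alpha>" "0 \<le> suminf \<beta>" using c by (auto intro: suminf_nonneg)
  have le: "suminf \<alpha> \<le> r" "suminf \<beta> \<le> r" using c(5) nn by linarith+
  have "(suminf (\<lambda>i. \<alpha> i ^ k)) \<le> suminf \<alpha> * r ^ (k - 1)" "(suminf (\<lambda>i. \<beta> i ^ k)) \<le> suminf \<beta> * r ^ (k - 1)"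
    "summable (\<lambda>i. \<alpha> i ^ k)" "summable (\<lambda>i. \<beta> i ^ k)"
    using sum_power_le[OF c(1,3) le(1) assms(2)] sum_power_le[OF c(2,4) le(2) assms(2)] by auto
  moreover from this have "0 \<le> (suminf (\<lambda>i. \<alpha> i ^ k))" "0 \<le> (suminf (\<lambda>i. \<beta> i ^ k))"
    using c by (auto intro!: suminf_nonneg)
  moreover have "suminf \<alpha> * r ^ (k - 1) + suminf \<beta> * r ^ (k - 1) \<le> r * r ^ (k - 1)"
    using c(5) nn unfolding distrib_right[symmetric] by (intro mult_right_mono) auto
  moreover have "r * r ^ (k - 1) = r ^ k" using assms(2) by (cases k) auto
  moreover have "\<bar>(- 1) ^ (k - 1) * (suminf (\<lambda>i. \<beta> i ^ k))\<bar> = \<bar>suminf (\<lambda>i. \<beta> i ^ k)\<bar>"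
    by (simp add: abs_mult power_abs)
  moreover have "thoma_power_sum (\<alpha>, \<beta>, r) k = (suminf (\<lambda>i. \<alpha> i ^ k)) + (- 1) ^ (k - 1) * (suminf (\<lambda>i. \<beta> i ^ k))"
    using False by simp
  ultimately show ?thesis by linarith
qed

lemma boxes_iff: "(i, j) \<in> boxes \<nu> \<longleftrightarrow> j < row_len \<nu> i"
  by (auto simp: boxes_def row_len_def)

lemma boxes_iff_col:
  assumes "\<nu> \<in> partitions"
  shows "(i, j) \<in> boxes \<nu> \<longleftrightarrow> i < col_length \<nu> j"
proof -
  let ?C = "{i. (i, j) \<in> boxes \<nu>}"
  have down: "i' \<in> ?C" if "i \<in> ?C" "i' \<le> i" for i i'
    using that row_len_antimono[OF assms that(2)] by (simp add: boxes_iff)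
  have fin: "finite ?C" by (rule finite_subset[of _ "{..<length \<nu>}"]) (auto simp: boxes_def)
  have "?C = {..<card ?C}"
  proof (rule card_subset_eq[symmetric])
    have "x < card ?C" if "x \<in> ?C" for x
    proof -
      have "{..x} \<subseteq> ?C" using down[OF that] by auto
      then have "card {..x} \<le> card ?C" using fin by (intro card_mono)
      then show ?thesis by simp
    qed
    then have "?C \<subseteq> {..<card ?C}" by auto
    moreover from this have "{..<card ?C} = ?C"
      by (intro card_subset_eq[symmetric]) auto
    ultimately show "{..<card ?C} \<subseteq> ?C" by simp
  qed (use fin in auto)
  then have "?C = {..<col_length \<nu> j}" unfolding col_length_def .
  then show ?thesis by blast
qed

definition arm :: "nat list \<Rightarrow> nat \<Rightarrow> real" where
  "arm \<nu> i = (if (i, i) \<in> boxes \<nu> then real (row_len \<nu> i) - real i - 1 / 2 else 0)"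

definition leg :: "nat list \<Rightarrow> nat \<Rightarrow> real" where
  "leg \<nu> i = (if (i, i) \<in> boxes \<nu> then real (col_length \<nu> i) - real i - 1 / 2 else 0)"

lemma thoma_embed_alt:
  "thoma_embed \<epsilon> \<nu> = (\<lambda>i. \<epsilon> * arm \<nu> i, \<lambda>i. \<epsilon> * leg \<nu> i, \<epsilon> * real (sum_list \<nu>))"
  by (auto simp: thoma_embed_def arm_def leg_def row_len_def boxes_def fun_eq_iff)

lemma arm_leg_nonneg:
  assumes "\<nu> \<in> partitions"
  shows "0 \<le> arm \<nu> i" "0 \<le> leg \<nu> i"
  using boxes_iff[of i i \<nu>] boxes_iff_col[OF assms, of i i] by (auto simp: arm_def leg_def)

lemma decseq_arm_leg:
  assumes "\<nu> \<in> partitions"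
  shows "decseq (arm \<nu>)" "decseq (leg \<nu>)"
proof -
  have down: "(i, i) \<in> boxes \<nu>" if "(Suc i, Suc i) \<in> boxes \<nu>" for i
    using that row_len_antimono[OF assms, of i "Suc i"] by (auto simp: boxes_iff)
  have col: "col_length \<nu> (Suc i) \<le> col_length \<nu> i" for i
  proof (rule ccontr)
    assume "\<not> ?thesis"
    then have "(col_length \<nu> i, Suc i) \<in> boxes \<nu>" by (simp add: boxes_iff_col[OF assms])
    then have "(col_length \<nu> i, i) \<in> boxes \<nu>" by (simp add: boxes_iff)
    then show False by (simp add: boxes_iff_col[OF assms])
  qed
  have "arm \<nu> (Suc i) \<le> arm \<nu> i" "leg \<nu> (Suc i) \<le> leg \<nu> i" for i
    using down[of i] arm_leg_nonneg[OF assms, of i] row_len_antimono[OF assms, of i "Suc i"] col[of i]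
    by (auto simp: arm_def leg_def)
  then show "decseq (arm \<nu>)" "decseq (leg \<nu>)" by (auto simp: decseq_Suc_iff)
qed

text \<open>Both sides are the sum of \<open>(c + 1/2)^k - (c - 1/2)^k\<close> over the contents \<open>c\<close> of all boxes,
  telescoped along rows on the left and along diagonal hooks on the right.\<close>

lemma row_sum_eq_hook_sum:
  assumes \<nu>: "\<nu> \<in> partitions" and N: "length \<nu> \<le> N" and k: "k \<ge> 1"
  shows "(\<Sum>i<N. (real (row_len \<nu> i) - real i - 1 / 2) ^ k - (- real i - 1 / 2) ^ k) =
    (\<Sum>i<N. arm \<nu> i ^ k - (- leg \<nu> i) ^ k)"
proof -
  let ?g = "\<lambda>(i, j). (real j - real i + 1 / 2) ^ k - (real j - real i - 1 / 2) ^ k"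
  let ?r = "row_len \<nu>" and ?c = "col_length \<nu>"
  have tel: "(\<Sum>j\<in>{a..<b}. (real j - x + 1 / 2) ^ k - (real j - x - 1 / 2) ^ k) =
      (real b - x - 1 / 2) ^ k - (real a - x - 1 / 2) ^ k" if "a \<le> b" for a b and x :: real
    using that
  proof (induction b rule: dec_induct)
    case (step b)
    have "real (Suc b) - x - 1 / 2 = real b - x + 1 / 2" by simp
    then show ?case using step by (simp only: sum.atLeastLessThan_Suc)
  qed simp
  have tel': "(\<Sum>i\<in>{a..<b}. (x - real i + 1 / 2) ^ k - (x - real i - 1 / 2) ^ k) =
      (x - real a + 1 / 2) ^ k - (x - real b + 1 / 2) ^ k" if "a \<le> b" for a b and x :: real
    using that
  proof (induction b rule: dec_induct)
    case (step b)
    have "x - real (Suc b) + 1 / 2 = x - real b - 1 / 2" by simp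
    then show ?case using step by (simp only: sum.atLeastLessThan_Suc)
  qed simp
  have "(\<Sum>i<N. (real (?r i) - real i - 1 / 2) ^ k - (- real i - 1 / 2) ^ k) =
      (\<Sum>i<N. \<Sum>j<?r i. ?g (i, j))"
    using tel[of 0] by (simp add: atLeast0LessThan)
  also have "\<dots> = (\<Sum>q\<in>boxes \<nu>. ?g q)"
    unfolding boxes_diagram[OF N] diagram_Sigma by (subst sum.Sigma) auto
  \<comment> \<open>Boxes on or right of the diagonal are grouped by rows, those strictly below it
    by columns; index i collects the i-th diagonal hook.\<close>
  also have "boxes \<nu> = (SIGMA i:{..<N}. {i..<?r i}) \<union> prod.swap ` (SIGMA j:{..<N}. {Suc j..<?c j})"
    (is "_ = ?A \<union> prod.swap ` ?B")
  proof (rule Set.set_eqI)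
    fix q :: "nat \<times> nat"
    obtain i j where q: "q = (i, j)" by (cases q)
    have "(i, j) \<in> boxes \<nu> \<Longrightarrow> i < N" using N by (auto simp: boxes_def)
    then show "q \<in> boxes \<nu> \<longleftrightarrow> q \<in> ?A \<union> prod.swap ` ?B"
      using boxes_iff[of i j \<nu>] boxes_iff_col[OF \<nu>, of i j] q
      by (cases "i \<le> j") (auto simp: image_iff)
  qed
  also have "(\<Sum>q\<in>?A \<union> prod.swap ` ?B. ?g q) = (\<Sum>q\<in>?A. ?g q) + (\<Sum>q\<in>prod.swap ` ?B. ?g q)"
    by (rule sum.union_disjoint) auto
  also have "(\<Sum>q\<in>?A. ?g q) = (\<Sum>i<N. \<Sum>j\<in>{i..<?r i}. ?g (i, j))"
    by (subst sum.Sigma) auto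
  also have "(\<Sum>q\<in>prod.swap ` ?B. ?g q) = (\<Sum>q\<in>?B. ?g (prod.swap q))"
    by (subst sum.reindex) auto
  also have "\<dots> = (\<Sum>j<N. \<Sum>i\<in>{Suc j..<?c j}. ?g (i, j))"
    by (subst sum.Sigma) auto
  also have "(\<Sum>i<N. \<Sum>j\<in>{i..<?r i}. ?g (i, j)) + (\<Sum>j<N. \<Sum>i\<in>{Suc j..<?c j}. ?g (i, j)) =
      (\<Sum>i<N. arm \<nu> i ^ k - (- leg \<nu> i) ^ k)"
    unfolding sum.distrib[symmetric]
  proof (intro sum.cong refl)
    fix i assume "i \<in> {..<N}"
    show "(\<Sum>j\<in>{i..<?r i}. ?g (i, j)) + (\<Sum>i'\<in>{Suc i..<?c i}. ?g (i', i)) =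
        arm \<nu> i ^ k - (- leg \<nu> i) ^ k"
    \<comment> \<open>The row telescopes to arm^k - (-1/2)^k and the column to (-1/2)^k - (-leg)^k;
      the inner ends cancel.\<close>
    proof (cases "(i, i) \<in> boxes \<nu>")
      case True
      then have "i < ?r i" "i < ?c i" using boxes_iff[of i i \<nu>] boxes_iff_col[OF \<nu>, of i i] by auto
      then show ?thesis
        using tel[of i "?r i" "real i"] tel'[of "Suc i" "?c i" "real i"] True
        by (simp add: arm_def leg_def algebra_simps)
    next
      case False
      then have "?r i \<le> i" "?c i \<le> i" using boxes_iff[of i i \<nu>] boxes_iff_col[OF \<nu>, of i i] by auto
      then show ?thesis using False k by (simp add: arm_def leg_def)
    qed
  qed
  finally show ?thesis .
qed

lemma psum_beta_set:
  assumes \<nu>: "\<nu> \<in> partitions" and N: "length \<nu> \<le> N" and k: "k \<ge> 1"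
  shows "psum k (beta_set N \<nu>) = (\<Sum>i<N. arm \<nu> i ^ k - (- leg \<nu> i) ^ k)"
proof -
  have inj: "inj_on (beta N (row_len \<nu>)) {..<N}"
    by (rule strict_decr_inj[OF strict_decr_beta[OF weak_decr_row_len[OF \<nu>]]])
  have c: "card (beta_set N \<nu>) = N" unfolding beta_set_def by (simp add: card_image[OF inj])
  have "(\<Sum>x\<in>beta_set N \<nu>. node (beta_set N \<nu>) x ^ k) =
      (\<Sum>i<N. (real (row_len \<nu> i) - real i - 1 / 2) ^ k)"
    unfolding node_def c unfolding beta_set_def sum.reindex[OF inj]
    by (intro sum.cong) (auto simp: beta_def of_nat_diff)
  moreover have "(\<Sum>i<N. (real i - real N + 1 / 2) ^ k) = (\<Sum>i<N. (- real i - 1 / 2) ^ k)"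
    by (rule sum.reindex_bij_witness[of _ "\<lambda>i. N - 1 - i" "\<lambda>i. N - 1 - i"])
      (auto simp: of_nat_diff algebra_simps)
  ultimately show ?thesis
    using row_sum_eq_hook_sum[OF assms] by (simp add: psum_def c sum_subtractf)
qed

lemma arm_leg_zero:
  assumes "length \<nu> \<le> i"
  shows "arm \<nu> i = 0" "leg \<nu> i = 0"
  using assms by (auto simp: arm_def leg_def boxes_def)

lemma arm_leg_sums:
  assumes "length \<nu> \<le> N" "k \<ge> 1"
  shows "(\<lambda>i. arm \<nu> i ^ k) sums (\<Sum>i<N. arm \<nu> i ^ k)" "(\<lambda>i. leg \<nu> i ^ k) sums (\<Sum>i<N. leg \<nu> i ^ k)"
  by (rule sums_finite; use assms arm_leg_zero[of \<nu>] in auto)+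

text \<open>The case k = 1 of \<open>psum_beta_set\<close>. It places embedded partitions on the
  face of the cone where the two sequences together exhaust r.\<close>

lemma sum_arm_leg:
  assumes \<nu>: "\<nu> \<in> partitions" and N: "sum_list \<nu> \<le> N"
  shows "(\<Sum>i<N. arm \<nu> i) + (\<Sum>i<N. leg \<nu> i) = real (sum_list \<nu>)"
proof -
  have len: "length \<nu> \<le> N" using length_le_sum_list[OF \<nu>] N by simp
  have "beta_set N \<nu> \<in> levels (sum_list \<nu>) N"
    using bij_betw_beta_set[OF N] \<nu> by (auto simp: bij_betw_def partitions_of_def)
  then show ?thesis
    using psum_1_levels psum_beta_set[OF \<nu> len, of 1] by (simp add: sum.distrib)
qed

lemma thoma_embed_in_cone:
  assumes \<nu>: "\<nu> \<in> partitions" and "\<epsilon> \<ge> 0"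
  shows "thoma_embed \<epsilon> \<nu> \<in> thoma_cone"
proof -
  let ?N = "sum_list \<nu>"
  have len: "length \<nu> \<le> ?N" by (rule length_le_sum_list[OF \<nu>])
  have s: "arm \<nu> sums (\<Sum>i<?N. arm \<nu> i)" "leg \<nu> sums (\<Sum>i<?N. leg \<nu> i)"
    using arm_leg_sums[OF len, of 1] by auto
  have "(\<lambda>i. \<epsilon> * arm \<nu> i) sums (\<epsilon> * (\<Sum>i<?N. arm \<nu> i))" "(\<lambda>i. \<epsilon> * leg \<nu> i) sums (\<epsilon> * (\<Sum>i<?N. leg \<nu> i))"
    by (intro sums_mult s)+
  moreover have "\<epsilon> * (\<Sum>i<?N. arm \<nu> i) + \<epsilon> * (\<Sum>i<?N. leg \<nu> i) = \<epsilon> * real ?N"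
    using sum_arm_leg[OF \<nu> order_refl] by (simp flip: distrib_left)
  moreover have "decseq (\<lambda>i. \<epsilon> * arm \<nu> i)" "decseq (\<lambda>i. \<epsilon> * leg \<nu> i)"
    using decseq_arm_leg[OF \<nu>] assms(2) by (auto simp: decseq_def intro: mult_left_mono)
  ultimately show ?thesis
    using arm_leg_nonneg[OF \<nu>] assms(2)
    by (auto simp: thoma_embed_alt thoma_cone_def sums_iff)
qed

text \<open>On the cone p_1 is the coordinate r and not a sum over the two sequences. For embedded
  partitions both agree by \<open>sum_arm_leg\<close>, so one formula covers every k >= 1.\<close>

lemma thoma_power_sum_embed:
  assumes \<nu>: "\<nu> \<in> partitions" and N: "sum_list \<nu> \<le> N" and k: "k \<ge> 1"
  shows "thoma_power_sum (thoma_embed \<epsilon> \<nu>) k = \<epsilon> ^ k * psum k (beta_set N \<nu>)"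
proof -
  have len: "length \<nu> \<le> N" using length_le_sum_list[OF \<nu>] N by simp
  note P = psum_beta_set[OF \<nu> len k]
  show ?thesis
  proof (cases "k = 1")
    case True
    then show ?thesis using P sum_arm_leg[OF \<nu> N] by (simp add: thoma_embed_alt sum.distrib)
  next
    case False
    have "(suminf (\<lambda>i. (\<epsilon> * arm \<nu> i) ^ k)) = \<epsilon> ^ k * (\<Sum>i<N. arm \<nu> i ^ k)"
      "(suminf (\<lambda>i. (\<epsilon> * leg \<nu> i) ^ k)) = \<epsilon> ^ k * (\<Sum>i<N. leg \<nu> i ^ k)"
      using sums_mult[OF arm_leg_sums(1)[OF len k], of "\<epsilon> ^ k"]
        sums_mult[OF arm_leg_sums(2)[OF len k], of "\<epsilon> ^ k"]
      by (simp_all add: power_mult_distrib sums_iff)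
    moreover have "(- leg \<nu> i) ^ k = - ((- 1) ^ (k - 1) * leg \<nu> i ^ k)" for i
      using k by (subst power_minus) (cases k; simp)
    ultimately show ?thesis
      using False by (simp add: thoma_embed_alt P sum.distrib sum_distrib_left algebra_simps)
  qed
qed

text \<open>The embedding with parameter 1 turns the estimate of power sums on the cone into the
  premise of \<open>psum_poly_bound\<close>.\<close>

lemma psum_beta_set_bound:
  assumes \<nu>: "\<nu> \<in> partitions" and N: "sum_list \<nu> \<le> N" and k: "k \<ge> 1"
  shows "\<bar>psum k (beta_set N \<nu>)\<bar> \<le> real (sum_list \<nu>) ^ k"
proof -
  have "thoma_power_sum (thoma_embed 1 \<nu>) k = psum k (beta_set N \<nu>)"
    using thoma_power_sum_embed[OF assms, of 1] by simp
  moreover have "thoma_embed 1 \<nu> \<in> thoma_cone" by (rule thoma_embed_in_cone[OF \<nu>]) simp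
  ultimately show ?thesis
    using thoma_power_sum_bound[of "arm \<nu>" "leg \<nu>" "real (sum_list \<nu>)", OF _ k]
    by (simp add: thoma_embed_alt del: thoma_power_sum.simps)
qed

section \<open>The topology of the Thoma simplex\<close>

lemma finite_pos_level_set:
  fixes a :: "nat \<Rightarrow> real"
  assumes "summable a" "M > 0"
  shows "finite {i. a i = M}"
proof -
  have "eventually (\<lambda>i. a i < M) sequentially"
    using summable_LIMSEQ_zero[OF assms(1)] assms(2) by (rule order_tendstoD)
  then obtain n where n: "\<And>i. i \<ge> n \<Longrightarrow> a i < M" by (auto simp: eventually_sequentially)
  have "{i. a i = M} \<subseteq> {..<n}"
  proof
    fix i assume "i \<in> {i. a i = M}"
    then show "i \<in> {..<n}" using n[of i] by (cases "i < n") auto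
  qed
  then show ?thesis by (rule finite_subset) simp
qed

text \<open>Terms below M die out and terms equal to M stay 1. The summable majorant a i / M allows
  the limit to be taken term by term.\<close>

lemma tannery_count:
  fixes a :: "nat \<Rightarrow> real"
  assumes "\<And>i. 0 \<le> a i" "\<And>i. a i \<le> M" "summable a" "M > 0"
  shows "(\<lambda>k. suminf (\<lambda>i. (a i / M) ^ Suc k)) \<longlonglongrightarrow> real (card {i. a i = M})"
proof -
  have le: "norm ((a i / M) ^ Suc k) \<le> a i / M" for i k
  proof -
    have "(a i / M) ^ k \<le> 1" using assms by (intro power_le_one) auto
    then show ?thesis using assms by (simp add: abs_mult mult_left_le divide_right_mono)
  qed
  have fin: "finite {i. a i = M}" by (rule finite_pos_level_set) fact+
  have "(\<lambda>k. (a i / M) ^ Suc k) \<longlonglongrightarrow> (if a i = M then 1 else 0)" for i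
  proof (cases "a i = M")
    case True
    then show ?thesis using assms(4) by simp
  next
    case False
    then have "a i < M" using assms(2)[of i] by simp
    then have "(\<lambda>k. (a i / M) ^ k) \<longlonglongrightarrow> 0"
      using assms by (intro LIMSEQ_realpow_zero) auto
    then have "(\<lambda>k. (a i / M) ^ Suc k) \<longlonglongrightarrow> 0" by (rule LIMSEQ_Suc)
    then show ?thesis using False by (simp only: if_False)
  qed
  then have "(\<lambda>k. suminf (\<lambda>i. (a i / M) ^ Suc k)) \<longlonglongrightarrow> suminf (\<lambda>i. if a i = M then 1 else 0 :: real)"
    by (rule tannerys_theorem[where M = "\<lambda>i. a i / M", THEN conjunct2, THEN conjunct2])
      (use le summable_divide[OF assms(3), of M] in \<open>auto intro: always_eventually\<close>)
  also have "suminf (\<lambda>i. if a i = M then 1 else 0 :: real) = (\<Sum>i\<in>{i. a i = M}. 1)"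
    by (subst suminf_finite[OF fin]) auto
  finally show ?thesis by simp
qed

lemma summable_power_bounded:
  fixes a :: "nat \<Rightarrow> real"
  assumes "\<And>i. 0 \<le> a i" "summable a" "k \<ge> 1"
  shows "summable (\<lambda>i. a i ^ k)"
proof -
  have "eventually (\<lambda>i. a i < 1) sequentially"
    using summable_LIMSEQ_zero[OF assms(2)] by (rule order_tendstoD) simp
  then have "eventually (\<lambda>i. norm (a i ^ k) \<le> a i) sequentially"
  proof eventually_elim
    case (elim i)
    have "a i ^ k \<le> a i ^ 1" using elim assms by (intro power_decreasing) auto
    then show ?case using assms(1)[of i] by simp
  qed
  then show ?thesis using assms(2) by (rule summable_comparison_test_ev)
qed

text \<open>Cancels the common initial segment of the two sequences. What is left starts with
  different terms unless the sequences were equal.\<close>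

lemma sequence_difference_tail:
  fixes \<alpha> \<alpha>' :: "nat \<Rightarrow> real"
  assumes "decseq \<alpha>" "\<And>i. 0 \<le> \<alpha> i" "summable \<alpha>" "decseq \<alpha>'" "\<And>i. 0 \<le> \<alpha>' i" "summable \<alpha>'"
  obtains a a' where "decseq a" "\<forall>i. 0 \<le> a i" "summable a" "decseq a'" "\<forall>i. 0 \<le> a' i" "summable a'"
    "\<forall>k\<ge>1. suminf (\<lambda>i. \<alpha> i ^ k) - suminf (\<lambda>i. \<alpha>' i ^ k) = suminf (\<lambda>i. a i ^ k) - suminf (\<lambda>i. a' i ^ k)"
    "a 0 = a' 0 \<longrightarrow> \<alpha> = \<alpha>' \<and> a 0 = 0"
proof (cases "\<alpha> = \<alpha>'")
  case True
  show ?thesis by (rule that[of "\<lambda>_. 0" "\<lambda>_. 0"]) (use True in auto)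
next
  case False
  then obtain j where j: "\<alpha> j \<noteq> \<alpha>' j" by (auto simp: fun_eq_iff)
  define n where "n = (LEAST j. \<alpha> j \<noteq> \<alpha>' j)"
  have n: "\<alpha> n \<noteq> \<alpha>' n" unfolding n_def using j by (rule LeastI)
  have eq: "\<alpha> i = \<alpha>' i" if "i < n" for i using not_less_Least[of i "\<lambda>j. \<alpha> j \<noteq> \<alpha>' j"] that
    by (simp add: n_def)
  show ?thesis
  proof (rule that[of "\<lambda>i. \<alpha> (i + n)" "\<lambda>i. \<alpha>' (i + n)"])
    show "decseq (\<lambda>i. \<alpha> (i + n))" "decseq (\<lambda>i. \<alpha>' (i + n))"
      using assms(1,4) by (auto simp: decseq_def)
    show "summable (\<lambda>i. \<alpha> (i + n))" "summable (\<lambda>i. \<alpha>' (i + n))"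
      using assms(3,6) by (auto intro: summable_ignore_initial_segment)
    have "suminf (\<lambda>i. \<alpha> i ^ k) - suminf (\<lambda>i. \<alpha>' i ^ k) =
        suminf (\<lambda>i. \<alpha> (i + n) ^ k) - suminf (\<lambda>i. \<alpha>' (i + n) ^ k)"
      if "k \<ge> 1" for k
      using suminf_split_initial_segment[OF summable_power_bounded[OF assms(2,3) that], of n]
        suminf_split_initial_segment[OF summable_power_bounded[OF assms(5,6) that], of n] eq
      by simp
    then show "\<forall>k\<ge>1. suminf (\<lambda>i. \<alpha> i ^ k) - suminf (\<lambda>i. \<alpha>' i ^ k) =
        suminf (\<lambda>i. \<alpha> (i + n) ^ k) - suminf (\<lambda>i. \<alpha>' (i + n) ^ k)"
      by blast
  qed (use assms n in auto)
qed

text \<open>After cancellation let M be the largest remaining coordinate. Power sums divided by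
  powers of M count its occurrences in the limit, and even and odd exponents separate the
  \<alpha>-type from the \<beta>-type. So M occurs equally often on both sides of each type,
  although the leading terms differ. Being asymptotic, the argument works with exponents from 2
  on.\<close>

lemma power_sums_determine:
  fixes \<alpha> \<beta> \<alpha>' \<beta>' :: "nat \<Rightarrow> real"
  assumes \<alpha>: "decseq \<alpha>" "\<And>i. 0 \<le> \<alpha> i" "summable \<alpha>"
    and \<alpha>': "decseq \<alpha>'" "\<And>i. 0 \<le> \<alpha>' i" "summable \<alpha>'"
    and \<beta>: "decseq \<beta>" "\<And>i. 0 \<le> \<beta> i" "summable \<beta>"
    and \<beta>': "decseq \<beta>'" "\<And>i. 0 \<le> \<beta>' i" "summable \<beta>'"
    and eq: "\<And>k. k \<ge> 2 \<Longrightarrow> suminf (\<lambda>i. \<alpha> i ^ k) + (- 1) ^ (k - 1) * suminf (\<lambda>i. \<beta> i ^ k) =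
      suminf (\<lambda>i. \<alpha>' i ^ k) + (- 1) ^ (k - 1) * suminf (\<lambda>i. \<beta>' i ^ k)"
  shows "\<alpha> = \<alpha>' \<and> \<beta> = \<beta>'"
proof -
  obtain a a' where a0: "decseq a" "\<forall>i. 0 \<le> a i" "summable a"
    "decseq a'" "\<forall>i. 0 \<le> a' i" "summable a'"
    "\<forall>k\<ge>1. suminf (\<lambda>i. \<alpha> i ^ k) - suminf (\<lambda>i. \<alpha>' i ^ k) =
      suminf (\<lambda>i. a i ^ k) - suminf (\<lambda>i. a' i ^ k)"
    "a 0 = a' 0 \<longrightarrow> \<alpha> = \<alpha>' \<and> a 0 = 0"
    by (rule sequence_difference_tail[OF \<alpha> \<alpha>'])
  note a = a0(1) a0(2)[rule_format] a0(3,4) a0(5)[rule_format] a0(6) a0(7)[rule_format] a0(8)[rule_format]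
  obtain b b' where b0: "decseq b" "\<forall>i. 0 \<le> b i" "summable b"
    "decseq b'" "\<forall>i. 0 \<le> b' i" "summable b'"
    "\<forall>k\<ge>1. suminf (\<lambda>i. \<beta> i ^ k) - suminf (\<lambda>i. \<beta>' i ^ k) =
      suminf (\<lambda>i. b i ^ k) - suminf (\<lambda>i. b' i ^ k)"
    "b 0 = b' 0 \<longrightarrow> \<beta> = \<beta>' \<and> b 0 = 0"
    by (rule sequence_difference_tail[OF \<beta> \<beta>'])
  note b = b0(1) b0(2)[rule_format] b0(3,4) b0(5)[rule_format] b0(6) b0(7)[rule_format] b0(8)[rule_format]
  define M where "M = max (max (a 0) (a' 0)) (max (b 0) (b' 0))"
  have "a 0 = a' 0 \<and> b 0 = b' 0"
  proof (rule ccontr)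
    assume ne: "\<not> ?thesis"
    have M0: "M > 0" using ne a(2)[of 0] a(5)[of 0] b(2)[of 0] b(5)[of 0] by (auto simp: M_def max_def)
    have le: "a i \<le> M" "a' i \<le> M" "b i \<le> M" "b' i \<le> M" for i
      using decseqD[OF a(1), of 0 i] decseqD[OF a(4), of 0 i] decseqD[OF b(1), of 0 i]
        decseqD[OF b(4), of 0 i] by (auto simp: M_def)
    define c where "c = (\<lambda>x :: nat \<Rightarrow> real. real (card {i. x i = M}))"
    define s where "s = (\<lambda>(x :: nat \<Rightarrow> real) k. suminf (\<lambda>i. (x i / M) ^ Suc k))"
    have lim: "s a \<longlonglongrightarrow> c a" "s a' \<longlonglongrightarrow> c a'" "s b \<longlonglongrightarrow> c b" "s b' \<longlonglongrightarrow> c b'"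
      unfolding s_def c_def
      using tannery_count[OF a(2) le(1) a(3) M0] tannery_count[OF a(5) le(2) a(6) M0]
        tannery_count[OF b(2) le(3) b(3) M0] tannery_count[OF b(5) le(4) b(6) M0] by auto
    have s_eq: "s x k = suminf (\<lambda>i. x i ^ Suc k) / M ^ Suc k" if "\<And>i. 0 \<le> x i" "summable x" for x k
      unfolding s_def power_divide
      by (rule suminf_divide) (rule summable_power_bounded[OF that], simp)
    have rel: "(s a k - s a' k) + (- 1) ^ k * (s b k - s b' k) = 0" if "k \<ge> 1" for k
    proof -
      have "(suminf (\<lambda>i. \<alpha> i ^ Suc k) - suminf (\<lambda>i. \<alpha>' i ^ Suc k)) +
          (- 1) ^ k * (suminf (\<lambda>i. \<beta> i ^ Suc k) - suminf (\<lambda>i. \<beta>' i ^ Suc k)) = 0"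
        using eq[of "Suc k"] that by (simp add: right_diff_distrib del: power_Suc)
      moreover have "suminf (\<lambda>i. \<alpha> i ^ Suc k) - suminf (\<lambda>i. \<alpha>' i ^ Suc k) =
          suminf (\<lambda>i. a i ^ Suc k) - suminf (\<lambda>i. a' i ^ Suc k)"
        by (rule a(7)) simp
      moreover have "suminf (\<lambda>i. \<beta> i ^ Suc k) - suminf (\<lambda>i. \<beta>' i ^ Suc k) =
          suminf (\<lambda>i. b i ^ Suc k) - suminf (\<lambda>i. b' i ^ Suc k)"
        by (rule b(7)) simp
      ultimately have "(suminf (\<lambda>i. a i ^ Suc k) - suminf (\<lambda>i. a' i ^ Suc k)) +
          (- 1) ^ k * (suminf (\<lambda>i. b i ^ Suc k) - suminf (\<lambda>i. b' i ^ Suc k)) = 0"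
        by (simp only:)
      then have "((suminf (\<lambda>i. a i ^ Suc k) - suminf (\<lambda>i. a' i ^ Suc k)) +
          (- 1) ^ k * (suminf (\<lambda>i. b i ^ Suc k) - suminf (\<lambda>i. b' i ^ Suc k))) / M ^ Suc k = 0"
        by simp
      then show ?thesis
        unfolding s_eq[OF a(2,3)] s_eq[OF a(5,6)] s_eq[OF b(2,3)] s_eq[OF b(5,6)]
        by (simp only: add_divide_distrib diff_divide_distrib times_divide_eq_right[symmetric])
    qed
    \<comment> \<open>\<open>s\<close> has exponent k + 1: even indices are odd exponents, where the
      \<beta>-type counts with a plus sign.\<close>
    have even: "strict_mono (\<lambda>k :: nat. 2 * k + 2)" and odd: "strict_mono (\<lambda>k :: nat. 2 * k + 1)"
      by (auto simp: strict_mono_def)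
    have "(\<lambda>k. (s a (2 * k + 2) - s a' (2 * k + 2)) + (s b (2 * k + 2) - s b' (2 * k + 2)))
        \<longlonglongrightarrow> (c a - c a') + (c b - c b')"
      using lim[THEN LIMSEQ_subseq_LIMSEQ, OF even] by (intro tendsto_intros) (auto simp: o_def)
    moreover have "(s a (2 * k + 2) - s a' (2 * k + 2)) + (s b (2 * k + 2) - s b' (2 * k + 2)) = 0" for k
      using rel[of "2 * k + 2"] by simp
    ultimately have 1: "(c a - c a') + (c b - c b') = 0" by (simp add: LIMSEQ_const_iff)
    have "(\<lambda>k. (s a (2 * k + 1) - s a' (2 * k + 1)) - (s b (2 * k + 1) - s b' (2 * k + 1)))
        \<longlonglongrightarrow> (c a - c a') - (c b - c b')"
      using lim[THEN LIMSEQ_subseq_LIMSEQ, OF odd] by (intro tendsto_intros) (auto simp: o_def)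
    moreover have "(s a (2 * k + 1) - s a' (2 * k + 1)) - (s b (2 * k + 1) - s b' (2 * k + 1)) = 0" for k
      using rel[of "2 * k + 1"] by simp
    ultimately have 2: "(c a - c a') - (c b - c b') = 0" by (simp add: LIMSEQ_const_iff)
    have c_eq: "c a = c a'" "c b = c b'" using 1 2 by auto
    have cpos: "c x > 0" if "x 0 = M" "summable x" for x
    proof -
      have "finite {i. x i = M}" by (rule finite_pos_level_set[OF that(2) M0])
      moreover have "0 \<in> {i. x i = M}" using that by simp
      ultimately show ?thesis by (auto simp: c_def card_gt_0_iff)
    qed
    have czero: "c x = 0" if "x 0 < M" "decseq x" for x
    proof -
      have "x i < M" for i using decseqD[OF that(2), of 0 i] that(1) by simp
      then have "{i. x i = M} = {}" by (auto simp: less_le)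
      then show ?thesis by (simp add: c_def)
    qed
    have split: "x 0 = M \<longleftrightarrow> x' 0 = M"
      if "c x = c x'" "decseq x" "decseq x'" "summable x" "summable x'" "x 0 \<le> M" "x' 0 \<le> M" for x x'
      using cpos[of x] cpos[of x'] czero[of x] czero[of x'] that by (cases "x 0 = M"; cases "x' 0 = M") auto
    have "a 0 = M \<longleftrightarrow> a' 0 = M" "b 0 = M \<longleftrightarrow> b' 0 = M"
      using split[OF c_eq(1)] split[OF c_eq(2)] a b le by blast+
    moreover have "a 0 = M \<or> a' 0 = M \<or> b 0 = M \<or> b' 0 = M" by (auto simp: M_def max_def)
    ultimately show False using a(8) b(8) M0 by auto
  qed
  then show ?thesis using a(8) b(8) by blast
qed

text \<open>Replaces summability and the bound on infinite sums by conditions on finitely many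
  coordinates each, from which closedness in the product topology can be read off.\<close>

lemma thoma_simplex_alt:
  "thoma_simplex = {\<omega>. (\<forall>i. fst \<omega> (Suc i) \<le> fst \<omega> i) \<and> (\<forall>i. 0 \<le> fst \<omega> i) \<and>
     (\<forall>i. fst (snd \<omega>) (Suc i) \<le> fst (snd \<omega>) i) \<and> (\<forall>i. 0 \<le> fst (snd \<omega>) i) \<and>
     (\<forall>n. (\<Sum>i<n. fst \<omega> i) + (\<Sum>i<n. fst (snd \<omega>) i) \<le> 1) \<and> snd (snd \<omega>) = 1}"
proof -
  have "(summable \<alpha> \<and> summable \<beta> \<and> suminf \<alpha> + suminf \<beta> \<le> 1) \<longleftrightarrow>
      (\<forall>n. (\<Sum>i<n. \<alpha> i) + (\<Sum>i<n. \<beta> i) \<le> 1)"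
    if nn: "\<And>i. 0 \<le> \<alpha> i" "\<And>i. 0 \<le> \<beta> i" for \<alpha> \<beta> :: "nat \<Rightarrow> real"
  proof
    assume s: "summable \<alpha> \<and> summable \<beta> \<and> suminf \<alpha> + suminf \<beta> \<le> 1"
    show "\<forall>n. (\<Sum>i<n. \<alpha> i) + (\<Sum>i<n. \<beta> i) \<le> 1"
    proof
      fix n
      have "(\<Sum>i<n. \<alpha> i) \<le> suminf \<alpha>" "(\<Sum>i<n. \<beta> i) \<le> suminf \<beta>"
        using s nn by (auto intro: sum_le_suminf)
      then show "(\<Sum>i<n. \<alpha> i) + (\<Sum>i<n. \<beta> i) \<le> 1" using s by linarith
    qed
  next
    assume b: "\<forall>n. (\<Sum>i<n. \<alpha> i) + (\<Sum>i<n. \<beta> i) \<le> 1"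
    have nn': "0 \<le> (\<Sum>i<n. \<alpha> i)" "0 \<le> (\<Sum>i<n. \<beta> i)" for n using nn by (auto intro: sum_nonneg)
    have le: "(\<Sum>i<n. \<alpha> i) \<le> 1" "(\<Sum>i<n. \<beta> i) \<le> 1" for n
      using b[rule_format, of n] nn'[of n] by linarith+
    have s: "summable \<alpha>" "summable \<beta>"
      by (rule summableI_nonneg_bounded[of _ 1]; use nn le in auto)+
    have "suminf \<alpha> + suminf \<beta> = suminf (\<lambda>i. \<alpha> i + \<beta> i)" by (rule suminf_add) fact+
    also have "\<dots> \<le> 1"
      by (rule suminf_le_const) (use s b in \<open>auto simp: sum.distrib intro: summable_add\<close>)
    finally show "summable \<alpha> \<and> summable \<beta> \<and> suminf \<alpha> + suminf \<beta> \<le> 1" using s by simp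
  qed
  note * = this
  have "(\<alpha>, \<beta>, r) \<in> thoma_simplex \<longleftrightarrow>
      (\<forall>i. \<alpha> (Suc i) \<le> \<alpha> i) \<and> (\<forall>i. 0 \<le> \<alpha> i) \<and> (\<forall>i. \<beta> (Suc i) \<le> \<beta> i) \<and> (\<forall>i. 0 \<le> \<beta> i) \<and>
      (\<forall>n. (\<Sum>i<n. \<alpha> i) + (\<Sum>i<n. \<beta> i) \<le> 1) \<and> r = 1" for \<alpha> \<beta> r
    using *[of \<alpha> \<beta>]
    by (cases "(\<forall>i. 0 \<le> \<alpha> i) \<and> (\<forall>i. 0 \<le> \<beta> i)")
      (auto simp: thoma_simplex_def thoma_cone_def decseq_Suc_iff)
  then show ?thesis by auto
qed

lemma simplex_le:
  assumes "\<omega> \<in> thoma_simplex"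
  shows "fst \<omega> i \<le> 1 / real (Suc i)" "fst (snd \<omega>) i \<le> 1 / real (Suc i)"
    "0 \<le> fst \<omega> i" "0 \<le> fst (snd \<omega>) i"
proof -
  have w: "\<And>i. fst \<omega> (Suc i) \<le> fst \<omega> i" "\<And>i. 0 \<le> fst \<omega> i"
     "\<And>i. fst (snd \<omega>) (Suc i) \<le> fst (snd \<omega>) i" "\<And>i. 0 \<le> fst (snd \<omega>) i"
     "\<And>n. (\<Sum>i<n. fst \<omega> i) + (\<Sum>i<n. fst (snd \<omega>) i) \<le> 1"
    using assms unfolding thoma_simplex_alt by auto
  have dec: "decseq (fst \<omega>)" "decseq (fst (snd \<omega>))" using w by (auto simp: decseq_Suc_iff)
  have "real (Suc i) * fst \<omega> i \<le> (\<Sum>j<Suc i. fst \<omega> j)"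
    using sum_bounded_below[of "{..<Suc i}" "fst \<omega> i" "fst \<omega>"] decseqD[OF dec(1), of _ i] by auto
  moreover have "real (Suc i) * fst (snd \<omega>) i \<le> (\<Sum>j<Suc i. fst (snd \<omega>) j)"
    using sum_bounded_below[of "{..<Suc i}" "fst (snd \<omega>) i" "fst (snd \<omega>)"] decseqD[OF dec(2), of _ i]
    by auto
  moreover have "0 \<le> (\<Sum>j<Suc i. fst \<omega> j)" "0 \<le> (\<Sum>j<Suc i. fst (snd \<omega>) j)"
    using w by (auto intro!: sum_nonneg simp del: sum.lessThan_Suc)
  ultimately have "real (Suc i) * fst \<omega> i \<le> 1" "real (Suc i) * fst (snd \<omega>) i \<le> 1"
    using w(5)[of "Suc i"] by linarith+
  then show "fst \<omega> i \<le> 1 / real (Suc i)" "fst (snd \<omega>) i \<le> 1 / real (Suc i)"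
    by (simp_all add: pos_le_divide_eq mult.commute)
  show "0 \<le> fst \<omega> i" "0 \<le> fst (snd \<omega>) i" by fact+
qed

lemma continuous_on_coordinates:
  "continuous_on S (\<lambda>\<omega> :: thoma_point. fst \<omega> i)" "continuous_on S (\<lambda>\<omega> :: thoma_point. fst (snd \<omega>) i)"
  by (rule continuous_on_compose2[OF continuous_on_product_coordinates
        continuous_on_fst[OF continuous_on_id] subset_UNIV],
      rule continuous_on_compose2[OF continuous_on_product_coordinates
        continuous_on_fst[OF continuous_on_snd[OF continuous_on_id]] subset_UNIV])

lemma compact_thoma_simplex: "compact thoma_simplex"
proof -
  let ?K = "{a :: nat \<Rightarrow> real. \<forall>i. a i \<in> {0..1}}"
  have "compactin (product_topology (\<lambda>i :: nat. euclidean :: real topology) UNIV) (PiE UNIV (\<lambda>_. {0..1}))"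
    by (subst compactin_PiE) auto
  moreover have "PiE UNIV (\<lambda>_. {0..1}) = ?K" by (auto simp: PiE_def Pi_def)
  ultimately have K: "compact ?K" by (simp add: euclidean_product_topology)
  have "closed thoma_simplex"
    unfolding thoma_simplex_alt
    by (intro closed_Collect_conj closed_Collect_all closed_Collect_le closed_Collect_eq
        continuous_on_coordinates continuous_on_add continuous_on_sum continuous_on_const
        continuous_on_snd continuous_on_id)
  moreover have "thoma_simplex \<subseteq> ?K \<times> ?K \<times> {1}"
  proof
    fix \<omega> assume \<omega>: "\<omega> \<in> thoma_simplex"
    have le1: "1 / real (Suc i) \<le> 1" for i by simp
    have "fst \<omega> i \<in> {0..1}" "fst (snd \<omega>) i \<in> {0..1}" for i
      using simplex_le[OF \<omega>, of i] le1[of i] unfolding atLeastAtMost_iff by linarith+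
    then have "fst \<omega> \<in> ?K" "fst (snd \<omega>) \<in> ?K" by blast+
    moreover have "snd (snd \<omega>) = 1" using \<omega> by (auto simp: thoma_simplex_def)
    ultimately show "\<omega> \<in> ?K \<times> ?K \<times> {1}" by (cases \<omega>) auto
  qed
  moreover have "compact (?K \<times> ?K \<times> {1 :: real})"
    by (intro compact_Times K) simp
  ultimately show ?thesis by (metis closed_Int_compact inf.absorb1)
qed

text \<open>The plain sum of the coordinates is not continuous, as mass can escape into many small
  coordinates; this is why p_1 is r. For k >= 2 the monotone coordinates are at most 1/(i + 1),
  whose k-th powers are summable, and the Weierstrass test applies.\<close>

lemma continuous_on_power_sum:
  assumes "k \<ge> 1"
  shows "continuous_on thoma_simplex (\<lambda>\<omega>. thoma_power_sum \<omega> k)"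
proof (cases "k = 1")
  case True
  have "continuous_on thoma_simplex (\<lambda>\<omega>. snd (snd \<omega>))" by (intro continuous_intros)
  then show ?thesis
    by (rule continuous_on_eq) (auto simp: True)
next
  case False
  have sm: "summable (\<lambda>i. (1 / real (Suc i)) ^ k)"
  proof -
    have "summable (\<lambda>i. 1 / real i ^ k)"
      using inverse_power_summable[of k, where 'a = real] False assms by (simp add: inverse_eq_divide)
    then show ?thesis using summable_Suc_iff[of "\<lambda>i. 1 / real i ^ k"] by (simp add: power_one_over)
  qed
  have ul: "continuous_on thoma_simplex (\<lambda>\<omega>. suminf (\<lambda>i. g \<omega> i ^ k))"
    if g: "\<And>i. continuous_on thoma_simplex (\<lambda>\<omega>. g \<omega> i)"
      "\<And>\<omega> i. \<omega> \<in> thoma_simplex \<Longrightarrow> g \<omega> i \<le> 1 / real (Suc i)" "\<And>\<omega> i. \<omega> \<in> thoma_simplex \<Longrightarrow> 0 \<le> g \<omega> i"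
    for g :: "thoma_point \<Rightarrow> nat \<Rightarrow> real"
  proof (rule uniform_limit_theorem)
    show "uniform_limit thoma_simplex (\<lambda>n \<omega>. \<Sum>i<n. g \<omega> i ^ k) (\<lambda>\<omega>. suminf (\<lambda>i. g \<omega> i ^ k)) sequentially"
    proof (rule Weierstrass_m_test[OF _ sm])
      fix n \<omega> assume "\<omega> \<in> thoma_simplex"
      then show "norm (g \<omega> n ^ k) \<le> (1 / real (Suc n)) ^ k"
        using g(2,3)[of \<omega> n] by (auto intro!: power_mono)
    qed
    show "\<forall>\<^sub>F n in sequentially. continuous_on thoma_simplex (\<lambda>\<omega>. \<Sum>i<n. g \<omega> i ^ k)"
      by (intro always_eventually allI continuous_intros g(1))
  qed simp
  have "continuous_on thoma_simplex (\<lambda>\<omega>. suminf (\<lambda>i. fst \<omega> i ^ k) +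
      (- 1) ^ (k - 1) * suminf (\<lambda>i. fst (snd \<omega>) i ^ k))"
    by (intro continuous_intros ul continuous_on_coordinates simplex_le)
  then show ?thesis
    by (rule continuous_on_eq) (use False in auto)
qed

lemma power_sums_separate:
  assumes "\<omega> \<in> thoma_simplex" "\<omega>' \<in> thoma_simplex" "\<omega> \<noteq> \<omega>'"
  shows "\<exists>k\<ge>2. thoma_power_sum \<omega> k \<noteq> thoma_power_sum \<omega>' k"
proof (rule ccontr)
  assume *: "\<not> ?thesis"
  obtain \<alpha> \<beta> where w: "\<omega> = (\<alpha>, \<beta>, 1)" using assms(1) by (auto simp: thoma_simplex_def)
  obtain \<alpha>' \<beta>' where w': "\<omega>' = (\<alpha>', \<beta>', 1)" using assms(2) by (auto simp: thoma_simplex_def)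
  have "\<alpha> = \<alpha>' \<and> \<beta> = \<beta>'"
  proof (rule power_sums_determine)
    fix k :: nat assume "k \<ge> 2"
    then have "thoma_power_sum \<omega> k = thoma_power_sum \<omega>' k" using * by blast
    then show "suminf (\<lambda>i. \<alpha> i ^ k) + (- 1) ^ (k - 1) * suminf (\<lambda>i. \<beta> i ^ k) =
      suminf (\<lambda>i. \<alpha>' i ^ k) + (- 1) ^ (k - 1) * suminf (\<lambda>i. \<beta>' i ^ k)"
      using \<open>k \<ge> 2\<close> by (simp add: w w')
  qed (use assms(1,2) in \<open>auto simp: thoma_simplex_def thoma_cone_def w w'\<close>)
  then show False using assms(3) w w' by simp
qed

section \<open>Convergence on the levels of the Young graph\<close>

lemma continuous_on_sym_at: "continuous_on thoma_simplex (sym_at f)"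
  unfolding sym_at_def sym_eval_def
  by (intro continuous_on_sum continuous_on_mult continuous_on_const continuous_on_prod
      continuous_on_power continuous_on_power_sum) simp_all

lemma thoma_power_sum_1: "\<omega> \<in> thoma_simplex \<Longrightarrow> thoma_power_sum \<omega> 1 = 1"
  by (auto simp: thoma_simplex_def)

lemma thoma_embed_in_simplex:
  assumes "\<nu> \<in> partitions_of n" "n \<ge> 1"
  shows "thoma_embed (1 / real n) \<nu> \<in> thoma_simplex"
  using thoma_embed_in_cone[of \<nu> "1 / real n"] assms
  by (auto simp: partitions_of_def thoma_simplex_def thoma_embed_def)

definition level_measure :: "thoma_point measure \<Rightarrow> nat list \<Rightarrow> real" where
  "level_measure P \<nu> = real (num_tableaux \<nu>) * (\<integral>\<omega>. sym_at (schur \<nu>) \<omega> \<partial>P)"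

lemma admissible_mult_pos:
  assumes "admissible z z'"
  obtains c where "c > 0" "z * z' = complex_of_real c"
proof -
  \<comment> \<open>For the one-box partition admissibility is a condition on \<open>z * z'\<close>
    itself.\<close>
  have "[1] \<in> partitions" by (simp add: partitions_def)
  moreover have "boxes [1] = {(0, 0)}" by (auto simp: boxes_def)
  ultimately have "z * z' \<in> \<real>\<^sub>\<ge>\<^sub>0" "z * z' \<noteq> 0"
    using assms by (auto simp: admissible_def content_poch_def)
  then obtain c where c: "z * z' = complex_of_real c" "c \<ge> 0"
    by (auto simp: nonneg_Reals_def)
  moreover have "c \<noteq> 0" using c(1) \<open>z * z' \<noteq> 0\<close> by (metis of_real_0)
  ultimately show ?thesis by (intro that) auto
qed

lemma space_boundary:
  assumes "is_boundary_z_measure z z' P"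
  shows "space P = thoma_simplex"
proof -
  have "sets P = sets (restrict_space borel thoma_simplex)"
    using assms by (simp add: is_boundary_z_measure_def)
  then have "space P = space (restrict_space borel thoma_simplex)" by (rule sets_eq_imp_space_eq)
  then show ?thesis by (simp add: space_restrict_space)
qed

lemma integrable_boundary:
  fixes g :: "thoma_point \<Rightarrow> real"
  assumes P: "is_boundary_z_measure z z' P" and g: "continuous_on thoma_simplex g"
  shows "integrable P g"
proof -
  interpret prob_space P using P by (simp add: is_boundary_z_measure_def)
  have "g \<in> borel_measurable (restrict_space borel thoma_simplex)"
    by (rule borel_measurable_continuous_on_restrict[OF g])
  moreover have "sets P = sets (restrict_space borel thoma_simplex)"
    using P by (simp add: is_boundary_z_measure_def)
  ultimately have meas: "g \<in> borel_measurable P" by (simp cong: measurable_cong_sets)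
  have "bounded (g ` thoma_simplex)"
    by (intro compact_imp_bounded compact_continuous_image g compact_thoma_simplex)
  then obtain B where B: "\<And>\<omega>. \<omega> \<in> thoma_simplex \<Longrightarrow> norm (g \<omega>) \<le> B"
    by (auto simp: bounded_iff)
  show ?thesis
    by (rule integrable_const_bound[of _ B]) (use B meas space_boundary[OF P] in \<open>auto intro!: AE_I2\<close>)
qed

lemma integral_sym_at_schur:
  assumes adm: "admissible z z'" and P: "is_boundary_z_measure z z' P"
    and c: "z * z' = complex_of_real c" "c > 0" and \<nu>: "\<nu> \<in> partitions"
  shows "(\<integral>\<omega>. sym_at (schur \<nu>) \<omega> \<partial>P) = Re (content_poch z \<nu> * content_poch z' \<nu>) /
      pochhammer c (sum_list \<nu>) * (real (num_tableaux \<nu>) / fact (sum_list \<nu>))"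
    and "Re (content_poch z \<nu> * content_poch z' \<nu>) \<ge> 0"
proof -
  have "content_poch z \<nu> * content_poch z' \<nu> \<in> \<real>\<^sub>\<ge>\<^sub>0"
    using adm \<nu> by (simp add: admissible_def)
  then obtain r where r: "content_poch z \<nu> * content_poch z' \<nu> = complex_of_real r" "r \<ge> 0"
    by (auto simp: nonneg_Reals_def)
  then show "Re (content_poch z \<nu> * content_poch z' \<nu>) \<ge> 0" by simp
  have "complex_of_real (\<integral>\<omega>. sym_at (schur \<nu>) \<omega> \<partial>P) =
      complex_of_real (r / pochhammer c (sum_list \<nu>) * (real (num_tableaux \<nu>) / fact (sum_list \<nu>)))"
    using P \<nu> r(1) by (simp add: is_boundary_z_measure_def c(1) pochhammer_of_real)
  then show "(\<integral>\<omega>. sym_at (schur \<nu>) \<omega> \<partial>P) = Re (content_poch z \<nu> * content_poch z' \<nu>) /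
      pochhammer c (sum_list \<nu>) * (real (num_tableaux \<nu>) / fact (sum_list \<nu>))"
    unfolding of_real_eq_iff using r(1) by simp
qed

lemma level_measure_nonneg:
  assumes "admissible z z'" "is_boundary_z_measure z z' P" "\<nu> \<in> partitions"
  shows "level_measure P \<nu> \<ge> 0"
proof -
  obtain c where c: "c > 0" "z * z' = complex_of_real c" by (rule admissible_mult_pos[OF assms(1)])
  show ?thesis
    using integral_sym_at_schur[OF assms(1,2) c(2,1) assms(3)] c(1)
    by (simp add: level_measure_def pochhammer_pos zero_le_mult_iff order_less_imp_le)
qed

text \<open>Multiplying and dividing by \<open>pochhammer c n\<close> splits the weight into the
  negative binomial probability of level n and the weight within the level.\<close>

lemma mixed_z_measure_eq:
  assumes "admissible z z'" "is_boundary_z_measure z z' P" "z * z' = complex_of_real c" "c > 0"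
    "\<nu> \<in> partitions_of n"
  shows "mixed_z_measure z z' \<xi> \<nu> =
    (1 - \<xi>) powr c * \<xi> ^ n * (pochhammer c n / fact n) * level_measure P \<nu>"
proof -
  have \<nu>: "\<nu> \<in> partitions" "sum_list \<nu> = n" using assms(5) by (auto simp: partitions_of_def)
  have "pochhammer c n > 0" using assms(4) by (rule pochhammer_pos)
  then show ?thesis
    using integral_sym_at_schur(1)[OF assms(1-4) \<nu>(1)] \<nu>(2)
    by (simp add: mixed_z_measure_def level_measure_def assms(3) power2_eq_square)
qed

text \<open>Exact for every admissible n; the falling factorial in front becomes a power of n only
  in the limit. The beta-sets have n beads, the smallest number that
  \<open>sum_schur_lower_ops\<close> permits here.\<close>

lemma sum_level_measure_lower_ops:
  assumes P: "is_boundary_z_measure z z' P" and ks: "\<forall>k\<in>set ks. k \<ge> 1" "sum_list ks \<le> n"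
  shows "(\<Sum>\<nu>\<in>partitions_of n. level_measure P \<nu> * lower_ops ks (beta_set n \<nu>)) =
    fact n / fact (n - sum_list ks) * (\<integral>\<omega>. (\<Prod>k\<leftarrow>ks. thoma_power_sum \<omega> k) \<partial>P)"
proof -
  let ?m = "n - sum_list ks"
  have nm: "?m + sum_list ks = n" using ks by simp
  let ?w = "\<lambda>\<nu>. real (num_tableaux \<nu>) / fact n * lower_ops ks (beta_set n \<nu>)"
  have int: "integrable P (sym_at f)" for f
    by (rule integrable_boundary[OF P continuous_on_sym_at])
  have "(\<integral>\<omega>. (\<Prod>k\<leftarrow>ks. thoma_power_sum \<omega> k) * (1 / fact ?m) \<partial>P) =
      (\<integral>\<omega>. (\<Sum>\<nu>\<in>partitions_of n. ?w \<nu> * sym_at (schur \<nu>) \<omega>) \<partial>P)"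
  proof (rule Bochner_Integration.integral_cong[OF refl])
    fix \<omega> assume "\<omega> \<in> space P"
    then have "thoma_power_sum \<omega> 1 = 1" using thoma_power_sum_1 space_boundary[OF P] by simp
    then have "(\<Prod>k\<leftarrow>ks. thoma_power_sum \<omega> k) * (1 / fact ?m) =
        (\<Prod>k\<leftarrow>ks. thoma_power_sum \<omega> k) * (thoma_power_sum \<omega> 1 ^ ?m / fact ?m)"
      by simp
    also have "\<dots> = (\<Sum>\<nu>\<in>partitions_of n. ?w \<nu> * sym_at (schur \<nu>) \<omega>)"
      using sum_schur_lower_ops[OF ks(1), of ?m n "thoma_power_sum \<omega>"] unfolding nm sym_at_def
      by (simp add: mult_ac del: One_nat_def)
    finally show "(\<Prod>k\<leftarrow>ks. thoma_power_sum \<omega> k) * (1 / fact ?m) =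
        (\<Sum>\<nu>\<in>partitions_of n. ?w \<nu> * sym_at (schur \<nu>) \<omega>)" .
  qed
  also have "\<dots> = (\<Sum>\<nu>\<in>partitions_of n. ?w \<nu> * (\<integral>\<omega>. sym_at (schur \<nu>) \<omega> \<partial>P))"
    using int by (subst Bochner_Integration.integral_sum) auto
  also have "\<dots> = (\<Sum>\<nu>\<in>partitions_of n. level_measure P \<nu> * lower_ops ks (beta_set n \<nu>)) / fact n"
    by (simp add: level_measure_def sum_divide_distrib mult_ac)
  finally show ?thesis by (simp add: field_simps)
qed

lemma sum_level_measure:
  assumes "is_boundary_z_measure z z' P"
  shows "(\<Sum>\<nu>\<in>partitions_of n. level_measure P \<nu>) = 1"
proof -
  interpret prob_space P using assms by (simp add: is_boundary_z_measure_def)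
  show ?thesis
    using sum_level_measure_lower_ops[OF assms, of "[]" n] by (simp add: prob_space)
qed

lemma falling_ratio_tendsto:
  "(\<lambda>n. fact n / fact (n - m) / real n ^ m) \<longlonglongrightarrow> 1"
proof -
  have "(\<lambda>n. (real n - real t) / real n) \<longlonglongrightarrow> 1" for t :: nat
  proof -
    have "(\<lambda>n. 1 - real t / real n) \<longlonglongrightarrow> 1 - 0"
      by (intro tendsto_diff tendsto_const lim_const_over_n)
    moreover have "eventually (\<lambda>n. 1 - real t / real n = (real n - real t) / real n) sequentially"
      using eventually_gt_at_top[of 0] by eventually_elim (simp add: field_simps)
    ultimately show ?thesis by (simp add: Lim_transform_eventually)
  qed
  then have "(\<lambda>n. \<Prod>t<m. (real n - real t) / real n) \<longlonglongrightarrow> (\<Prod>t<m. 1)"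
    by (intro tendsto_prod)
  moreover have "eventually (\<lambda>n. (\<Prod>t<m. (real n - real t) / real n) =
      fact n / fact (n - m) / real n ^ m) sequentially"
    using eventually_ge_at_top[of m]
  proof eventually_elim
    case (elim n)
    then have "(fact n :: real) = fact (n - m) * (\<Prod>t<m. real n - real t)"
      using fact_add[of "n - m" m] by simp
    then show ?case by (simp add: prod_dividef)
  qed
  ultimately show ?thesis by (simp add: Lim_transform_eventually)
qed

lemma level_moment_tendsto:
  assumes adm: "admissible z z'" and P: "is_boundary_z_measure z z' P"
    and ks: "\<forall>k\<in>set ks. k \<ge> 1"
  shows "(\<lambda>n. \<Sum>\<nu>\<in>partitions_of n. level_measure P \<nu> *
      (\<Prod>k\<leftarrow>ks. thoma_power_sum (thoma_embed (1 / real n) \<nu>) k))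
    \<longlonglongrightarrow> (\<integral>\<omega>. (\<Prod>k\<leftarrow>ks. thoma_power_sum \<omega> k) \<partial>P)"
proof -
  let ?m = "sum_list ks"
  let ?I = "\<integral>\<omega>. (\<Prod>k\<leftarrow>ks. thoma_power_sum \<omega> k) \<partial>P"
  let ?Q = "\<lambda>X. \<Prod>k\<leftarrow>ks. psum k X"
  let ?E = "\<lambda>n. \<Sum>\<nu>\<in>partitions_of n. level_measure P \<nu> *
      (\<Prod>k\<leftarrow>ks. thoma_power_sum (thoma_embed (1 / real n) \<nu>) k)"
  obtain C where C: "\<And>X n. finite X \<Longrightarrow> X \<noteq> {} \<Longrightarrow> n \<ge> 1 \<Longrightarrow> (\<forall>s\<ge>1. \<bar>psum s X\<bar> \<le> real n ^ s) \<Longrightarrow>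
      \<bar>lower_ops ks X - ?Q X\<bar> \<le> C * real n ^ (?m - 1)"
    using psum_poly_bound[OF psum_poly_lower_ops[OF ks]] by blast
  have bound: "\<bar>?E n - fact n / fact (n - ?m) / real n ^ ?m * ?I\<bar> \<le> \<bar>C\<bar> / real n"
    if n: "n \<ge> 1" "n \<ge> ?m" for n
  proof -
    have part: "\<nu> \<in> partitions" "sum_list \<nu> = n" if "\<nu> \<in> partitions_of n" for \<nu>
      using that by (auto simp: partitions_of_def)
    have pe: "(\<Prod>k\<leftarrow>ks'. thoma_power_sum (thoma_embed (1 / real n) \<nu>) k) =
        (\<Prod>k\<leftarrow>ks'. psum k (beta_set n \<nu>)) / real n ^ sum_list ks'"
      if "\<nu> \<in> partitions_of n" "\<forall>k\<in>set ks'. k \<ge> 1" for \<nu> ks'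
    proof -
      have "thoma_power_sum (thoma_embed (1 / real n) \<nu>) k = psum k (beta_set n \<nu>) / real n ^ k"
        if "k \<ge> 1" for k
        using thoma_power_sum_embed[OF part(1) _ that, of \<nu> n "1 / real n"] part(2) \<open>\<nu> \<in> partitions_of n\<close>
        by (simp add: power_divide del: thoma_power_sum.simps)
      then show ?thesis using that(2)
        by (induction ks') (auto simp: power_add simp del: thoma_power_sum.simps)
    qed
    \<comment> \<open>The difference has weight one less than \<open>?m\<close>, so division by n^m
      leaves 1/n. For the empty list the truncated weight does not drop, but the difference is
      0.\<close>
    have diff: "\<bar>?Q (beta_set n \<nu>) - lower_ops ks (beta_set n \<nu>)\<bar> / real n ^ ?m \<le> \<bar>C\<bar> / real n"
      if \<nu>: "\<nu> \<in> partitions_of n" for \<nu>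
    proof (cases "ks = []")
      case True
      then show ?thesis by simp
    next
      case False
      then have m: "?m \<ge> 1" using ks by (cases ks) auto
      have X: "beta_set n \<nu> \<in> levels n n"
        using bij_betw_beta_set[of n n] \<nu> by (auto simp: bij_betw_def)
      then have "finite (beta_set n \<nu>)" "beta_set n \<nu> \<noteq> {}" using n by (auto simp: levels_def)
      then have "\<bar>lower_ops ks (beta_set n \<nu>) - ?Q (beta_set n \<nu>)\<bar> \<le> C * real n ^ (?m - 1)"
        using psum_beta_set_bound[OF part(1)[OF \<nu>], of n] part(2)[OF \<nu>] n by (intro C) auto
      also have "\<dots> \<le> \<bar>C\<bar> * real n ^ (?m - 1)" by (intro mult_right_mono) auto
      finally have "\<bar>?Q (beta_set n \<nu>) - lower_ops ks (beta_set n \<nu>)\<bar> / real n ^ ?m \<le>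
          \<bar>C\<bar> * real n ^ (?m - 1) / real n ^ ?m"
        by (intro divide_right_mono) (auto simp: abs_minus_commute)
      also have "\<bar>C\<bar> * real n ^ (?m - 1) / real n ^ ?m = \<bar>C\<bar> / real n"
      proof -
        have pw: "real n ^ ?m = real n * real n ^ (?m - 1)" using m by (cases ?m) auto
        show ?thesis unfolding pw using n by simp
      qed
      finally show ?thesis .
    qed
    have "fact n / fact (n - ?m) / real n ^ ?m * ?I =
        (\<Sum>\<nu>\<in>partitions_of n. level_measure P \<nu> * lower_ops ks (beta_set n \<nu>)) / real n ^ ?m"
      using sum_level_measure_lower_ops[OF P ks n(2)] by simp
    also have "\<dots> = (\<Sum>\<nu>\<in>partitions_of n. level_measure P \<nu> *
        (lower_ops ks (beta_set n \<nu>) / real n ^ ?m))"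
      by (simp add: sum_divide_distrib)
    finally have "?E n - fact n / fact (n - ?m) / real n ^ ?m * ?I = (\<Sum>\<nu>\<in>partitions_of n.
        level_measure P \<nu> * ((?Q (beta_set n \<nu>) - lower_ops ks (beta_set n \<nu>)) / real n ^ ?m))"
      using pe[OF _ ks] by (simp add: sum_subtractf[symmetric] right_diff_distrib diff_divide_distrib)
    also have "\<bar>\<dots>\<bar> \<le> (\<Sum>\<nu>\<in>partitions_of n. level_measure P \<nu> * (\<bar>C\<bar> / real n))"
    proof (rule order_trans[OF sum_abs sum_mono])
      fix \<nu> assume \<nu>: "\<nu> \<in> partitions_of n"
      then have nn: "level_measure P \<nu> \<ge> 0" using level_measure_nonneg[OF adm P] part by blast
      have "\<bar>real n ^ ?m\<bar> = real n ^ ?m" by simp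
      then show "\<bar>level_measure P \<nu> * ((?Q (beta_set n \<nu>) - lower_ops ks (beta_set n \<nu>)) / real n ^ ?m)\<bar>
          \<le> level_measure P \<nu> * (\<bar>C\<bar> / real n)"
        using mult_left_mono[OF diff[OF \<nu>] nn] nn by (simp only: abs_mult abs_divide abs_of_nonneg)
    qed
    also have "\<dots> = \<bar>C\<bar> / real n"
      by (simp only: sum_distrib_right[symmetric] sum_level_measure[OF P] mult_1_left)
    finally show ?thesis .
  qed
  have "(\<lambda>n. ?E n - fact n / fact (n - ?m) / real n ^ ?m * ?I) \<longlonglongrightarrow> 0"
  proof (rule Lim_null_comparison)
    show "eventually (\<lambda>n. norm (?E n - fact n / fact (n - ?m) / real n ^ ?m * ?I) \<le> \<bar>C\<bar> / real n) sequentially"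
      using eventually_ge_at_top[of 1] eventually_ge_at_top[of ?m]
      by eventually_elim (use bound in auto)
    show "(\<lambda>n. \<bar>C\<bar> / real n) \<longlonglongrightarrow> 0" by (rule lim_const_over_n)
  qed
  moreover have "(\<lambda>n. fact n / fact (n - ?m) / real n ^ ?m * ?I) \<longlonglongrightarrow> 1 * ?I"
    by (intro tendsto_mult falling_ratio_tendsto tendsto_const)
  ultimately show ?thesis
    using tendsto_add by fastforce
qed

section \<open>From moments to continuous functions on the simplex\<close>

lemma level_sym_tendsto:
  assumes adm: "admissible z z'" and P: "is_boundary_z_measure z z' P"
  shows "(\<lambda>n. \<Sum>\<nu>\<in>partitions_of n. level_measure P \<nu> * sym_at f (thoma_embed (1 / real n) \<nu>))
    \<longlonglongrightarrow> (\<integral>\<omega>. sym_at f \<omega> \<partial>P)"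
proof -
  let ?mon = "\<lambda>m \<omega>. \<Prod>i\<in>Poly_Mapping.keys m. thoma_power_sum \<omega> (Suc i) ^ Poly_Mapping.lookup m i"
  \<comment> \<open>A monomial becomes a list of degrees with repetition, the form in which the
    moments are known.\<close>
  have list: "\<exists>ks. (\<forall>k\<in>set ks. k \<ge> 1) \<and> (\<forall>x :: nat \<Rightarrow> real. (\<Prod>i\<in>K. x (Suc i) ^ e i) = (\<Prod>k\<leftarrow>ks. x k))"
    if "finite K" for K and e :: "nat \<Rightarrow> nat"
    using that
  proof (induction K)
    case empty
    show ?case by (rule exI[of _ "[]"]) simp
  next
    case (insert i K)
    then obtain ks where ks: "\<forall>k\<in>set ks. k \<ge> 1" "\<forall>x :: nat \<Rightarrow> real. (\<Prod>i\<in>K. x (Suc i) ^ e i) = (\<Prod>k\<leftarrow>ks. x k)"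
      by blast
    show ?case
      by (rule exI[of _ "replicate (e i) (Suc i) @ ks"])
        (use insert.hyps ks in \<open>auto simp: prod_list_replicate\<close>)
  qed
  have mono: "(\<lambda>n. \<Sum>\<nu>\<in>partitions_of n. level_measure P \<nu> * ?mon m (thoma_embed (1 / real n) \<nu>))
      \<longlonglongrightarrow> (\<integral>\<omega>. ?mon m \<omega> \<partial>P)" for m
  proof -
    obtain ks where ks: "\<forall>k\<in>set ks. k \<ge> 1" "\<And>x :: nat \<Rightarrow> real.
        (\<Prod>i\<in>Poly_Mapping.keys m. x (Suc i) ^ Poly_Mapping.lookup m i) = (\<Prod>k\<leftarrow>ks. x k)"
      using list[of "Poly_Mapping.keys m" "Poly_Mapping.lookup m"] by auto
    show ?thesis unfolding ks(2) by (rule level_moment_tendsto[OF adm P ks(1)])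
  qed
  have int: "integrable P (?mon m)" for m
    by (rule integrable_boundary[OF P], intro continuous_on_prod continuous_on_power
        continuous_on_power_sum) simp_all
  have "(\<lambda>n. \<Sum>m\<in>Poly_Mapping.keys f. Poly_Mapping.lookup f m *
      (\<Sum>\<nu>\<in>partitions_of n. level_measure P \<nu> * ?mon m (thoma_embed (1 / real n) \<nu>)))
    \<longlonglongrightarrow> (\<Sum>m\<in>Poly_Mapping.keys f. Poly_Mapping.lookup f m * (\<integral>\<omega>. ?mon m \<omega> \<partial>P))"
    by (intro tendsto_sum tendsto_mult tendsto_const mono)
  moreover have "(\<Sum>m\<in>Poly_Mapping.keys f. Poly_Mapping.lookup f m * (\<integral>\<omega>. ?mon m \<omega> \<partial>P)) =
      (\<integral>\<omega>. sym_at f \<omega> \<partial>P)"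
    unfolding sym_at_def sym_eval_def
    by (subst Bochner_Integration.integral_sum) (use int in auto)
  moreover have "(\<Sum>m\<in>Poly_Mapping.keys f. Poly_Mapping.lookup f m *
      (\<Sum>\<nu>\<in>partitions_of n. level_measure P \<nu> * ?mon m (thoma_embed (1 / real n) \<nu>))) =
      (\<Sum>\<nu>\<in>partitions_of n. level_measure P \<nu> * sym_at f (thoma_embed (1 / real n) \<nu>))" for n
    unfolding sym_at_def sym_eval_def sum_distrib_left
    by (subst sum.swap) (intro sum.cong refl, simp add: mult_ac)
  ultimately show ?thesis by simp
qed

lemma sym_dense:
  assumes "continuous_on thoma_simplex g" "e > 0"
  shows "\<exists>f. \<forall>\<omega>\<in>thoma_simplex. \<bar>g \<omega> - sym_at f \<omega>\<bar> < e"
proof -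
  interpret function_ring_on "range sym_at" thoma_simplex
  proof
    show "compact thoma_simplex" by (rule compact_thoma_simplex)
    show "continuous_on thoma_simplex f" if "f \<in> range sym_at" for f
      using that continuous_on_sym_at by auto
    show "(\<lambda>x. f x + g x) \<in> range sym_at" if "f \<in> range sym_at" "g \<in> range sym_at" for f g
    proof -
      obtain a b where "f = sym_at a" "g = sym_at b" using \<open>f \<in> range sym_at\<close> \<open>g \<in> range sym_at\<close> by auto
      then have "(\<lambda>x. f x + g x) = sym_at (a + b)" by (simp add: sym_at_def sym_eval_add fun_eq_iff)
      then show ?thesis by simp
    qed
    show "(\<lambda>x. f x * g x) \<in> range sym_at" if "f \<in> range sym_at" "g \<in> range sym_at" for f g
    proof -
      obtain a b where "f = sym_at a" "g = sym_at b" using \<open>f \<in> range sym_at\<close> \<open>g \<in> range sym_at\<close> by auto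
      then have "(\<lambda>x. f x * g x) = sym_at (a * b)" by (simp add: sym_at_def sym_eval_mult fun_eq_iff)
      then show ?thesis by simp
    qed
    show "(\<lambda>_. c) \<in> range sym_at" for c
    proof -
      have "(\<lambda>_. c) = sym_at (sym_const c)" by (simp add: sym_at_def sym_eval_const fun_eq_iff)
      then show ?thesis by simp
    qed
    fix x y assume "x \<in> thoma_simplex" "y \<in> thoma_simplex" "x \<noteq> y"
    then obtain k where k: "k \<ge> 2" "thoma_power_sum x k \<noteq> thoma_power_sum y k"
      using power_sums_separate by blast
    have "sym_at (power_sum k) x \<noteq> sym_at (power_sum k) y"
      using k by (simp add: sym_at_def sym_eval_power_sum del: thoma_power_sum.simps)
    then show "\<exists>f\<in>range sym_at. f x \<noteq> f y" by blast
  qed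
  show ?thesis using Stone_Weierstrass_basic[OF assms] by auto
qed

lemma level_tendsto:
  assumes adm: "admissible z z'" and P: "is_boundary_z_measure z z' P"
    and g: "continuous_on thoma_simplex g"
  shows "(\<lambda>n. \<Sum>\<nu>\<in>partitions_of n. level_measure P \<nu> * g (thoma_embed (1 / real n) \<nu>))
    \<longlonglongrightarrow> (\<integral>\<omega>. g \<omega> \<partial>P)"
proof (rule LIMSEQ_I)
  fix e :: real assume e: "e > 0"
  interpret prob_space P using P by (simp add: is_boundary_z_measure_def)
  obtain f where f: "\<And>\<omega>. \<omega> \<in> thoma_simplex \<Longrightarrow> \<bar>g \<omega> - sym_at f \<omega>\<bar> < e / 3"
    using sym_dense[OF g, of "e / 3"] e by auto
  let ?E = "\<lambda>g n. \<Sum>\<nu>\<in>partitions_of n. level_measure P \<nu> * g (thoma_embed (1 / real n) \<nu>)"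
  obtain n0 where n0: "\<And>n. n \<ge> n0 \<Longrightarrow> norm (?E (sym_at f) n - (\<integral>\<omega>. sym_at f \<omega> \<partial>P)) < e / 3"
    using LIMSEQ_D[OF level_sym_tendsto[OF adm P, of f], of "e / 3"] e by auto
  have 1: "\<bar>?E g n - ?E (sym_at f) n\<bar> \<le> e / 3" if n: "n \<ge> 1" for n
  proof -
    have "?E g n - ?E (sym_at f) n = (\<Sum>\<nu>\<in>partitions_of n. level_measure P \<nu> *
        (g (thoma_embed (1 / real n) \<nu>) - sym_at f (thoma_embed (1 / real n) \<nu>)))"
      by (simp add: sum_subtractf right_diff_distrib)
    also have "\<bar>\<dots>\<bar> \<le> (\<Sum>\<nu>\<in>partitions_of n. level_measure P \<nu> * (e / 3))"
    proof (rule order_trans[OF sum_abs sum_mono])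
      fix \<nu> assume \<nu>: "\<nu> \<in> partitions_of n"
      then have nn: "level_measure P \<nu> \<ge> 0"
        using level_measure_nonneg[OF adm P] by (simp add: partitions_of_def)
      show "\<bar>level_measure P \<nu> * (g (thoma_embed (1 / real n) \<nu>) - sym_at f (thoma_embed (1 / real n) \<nu>))\<bar>
          \<le> level_measure P \<nu> * (e / 3)"
        using mult_left_mono[OF less_imp_le[OF f[OF thoma_embed_in_simplex[OF \<nu> n]]] nn] nn
        by (simp only: abs_mult abs_of_nonneg)
    qed
    also have "\<dots> = e / 3" by (simp only: sum_distrib_right[symmetric] sum_level_measure[OF P])
    finally show ?thesis .
  qed
  have int: "integrable P g" "integrable P (sym_at f)"
    by (intro integrable_boundary[OF P] g continuous_on_sym_at)+
  have 2: "\<bar>(\<integral>\<omega>. sym_at f \<omega> \<partial>P) - (\<integral>\<omega>. g \<omega> \<partial>P)\<bar> \<le> e / 3"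
  proof -
    have "(\<integral>\<omega>. sym_at f \<omega> \<partial>P) - (\<integral>\<omega>. g \<omega> \<partial>P) = (\<integral>\<omega>. sym_at f \<omega> - g \<omega> \<partial>P)"
      using int by simp
    also have "\<bar>\<dots>\<bar> \<le> (\<integral>\<omega>. \<bar>sym_at f \<omega> - g \<omega>\<bar> \<partial>P)" by (rule integral_abs_bound)
    also have "\<dots> \<le> (\<integral>\<omega>. e / 3 \<partial>P)"
    proof (rule integral_mono)
      fix \<omega> assume "\<omega> \<in> space P"
      then show "\<bar>sym_at f \<omega> - g \<omega>\<bar> \<le> e / 3"
        using f[of \<omega>] space_boundary[OF P] by (simp add: abs_minus_commute)
    qed (use int in auto)
    also have "\<dots> = e / 3" by (simp add: prob_space)
    finally show ?thesis .
  qed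
  show "\<exists>no. \<forall>n\<ge>no. norm (?E g n - (\<integral>\<omega>. g \<omega> \<partial>P)) < e"
  proof (intro exI[of _ "max 1 n0"] allI impI)
    fix n assume "n \<ge> max 1 n0"
    then have "\<bar>?E g n - ?E (sym_at f) n\<bar> \<le> e / 3"
      "\<bar>?E (sym_at f) n - (\<integral>\<omega>. sym_at f \<omega> \<partial>P)\<bar> < e / 3"
      using 1[of n] n0[of n] by auto
    with 2 show "norm (?E g n - (\<integral>\<omega>. g \<omega> \<partial>P)) < e" unfolding real_norm_def by linarith
  qed
qed

section \<open>From the negative binomial to the Gamma distribution\<close>

definition nb_coeff :: "real \<Rightarrow> nat \<Rightarrow> real" where
  "nb_coeff c n = pochhammer c n / fact n"

lemma nb_coeff_nonneg: "c > 0 \<Longrightarrow> nb_coeff c n \<ge> 0"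
  by (simp add: nb_coeff_def pochhammer_nonneg)

text \<open>Gauss' limit for Gamma, inverted: \<open>Gamma_series'\<close> is (n - 1)! n^c divided
  by the Pochhammer symbol.\<close>

lemma nb_coeff_asymp:
  assumes "c > 0"
  shows "(\<lambda>n. nb_coeff c n * real n powr (1 - c)) \<longlonglongrightarrow> 1 / Gamma c"
proof -
  have "(\<lambda>n. 1 / Gamma_series' c n) \<longlonglongrightarrow> 1 / Gamma c"
    by (intro tendsto_divide tendsto_const Gamma_series'_LIMSEQ)
      (use Gamma_real_pos[OF assms] in simp)
  moreover have "eventually (\<lambda>n. 1 / Gamma_series' c n = nb_coeff c n * real n powr (1 - c)) sequentially"
    using eventually_gt_at_top[of 0]
  proof eventually_elim
    case (elim n)
    have f: "(fact n :: real) = real n * fact (n - 1)" using elim by (simp add: fact_reduce)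
    have e: "exp (c * ln (real n)) = real n powr c" using elim by (simp add: powr_def)
    have "real n powr (1 - c) = real n / real n powr c" using elim by (simp add: powr_diff)
    then show ?case using elim unfolding Gamma_series'_def nb_coeff_def f by (simp add: e)
  qed
  ultimately show ?thesis by (simp add: Lim_transform_eventually)
qed

text \<open>The base n + 1 in place of n lets the bound include n = 0, where
  \<open>real n powr a\<close> is 0. The constant K comes from the boundedness of a convergent
  sequence.\<close>

lemma nb_coeff_bound:
  assumes "c > 0"
  obtains K where "K \<ge> 0" "\<And>n. nb_coeff c n \<le> K * (real n + 1) powr (c - 1)"
proof -
  have "(\<lambda>n. (1 + 1 / real n) powr (1 - c)) \<longlonglongrightarrow> (1 + 0) powr (1 - c)"
    by (intro tendsto_powr tendsto_add tendsto_const lim_const_over_n) auto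
  then have "(\<lambda>n. nb_coeff c n * real n powr (1 - c) * (1 + 1 / real n) powr (1 - c))
      \<longlonglongrightarrow> 1 / Gamma c * (1 + 0) powr (1 - c)"
    by (intro tendsto_mult nb_coeff_asymp assms)
  moreover have "eventually (\<lambda>n. nb_coeff c n * real n powr (1 - c) * (1 + 1 / real n) powr (1 - c) =
      nb_coeff c n * (real n + 1) powr (1 - c)) sequentially"
    using eventually_gt_at_top[of 0]
  proof eventually_elim
    case (elim n)
    have "real n powr (1 - c) * (1 + 1 / real n) powr (1 - c) = (real n * (1 + 1 / real n)) powr (1 - c)"
      using elim by (simp add: powr_mult)
    also have "real n * (1 + 1 / real n) = real n + 1" using elim by (simp add: field_simps)
    finally show ?case by (simp add: mult.assoc)
  qed
  ultimately have "(\<lambda>n. nb_coeff c n * (real n + 1) powr (1 - c)) \<longlonglongrightarrow> 1 / Gamma c * (1 + 0) powr (1 - c)"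
    by (rule Lim_transform_eventually)
  then have "Bseq (\<lambda>n. nb_coeff c n * (real n + 1) powr (1 - c))"
    by (intro convergent_imp_Bseq convergentI)
  then obtain K where K: "K > 0" "\<And>n. norm (nb_coeff c n * (real n + 1) powr (1 - c)) \<le> K"
    by (rule BseqE) blast
  show ?thesis
  proof (rule that[of K])
    fix n
    have "nb_coeff c n * (real n + 1) powr (1 - c) * (real n + 1) powr (c - 1) \<le> K * (real n + 1) powr (c - 1)"
      using K(2)[of n] nb_coeff_nonneg[OF assms, of n] by (intro mult_right_mono) (auto simp: abs_mult)
    moreover have "(real n + 1) powr (1 - c) * (real n + 1) powr (c - 1) = 1"
      by (simp flip: powr_add)
    ultimately show "nb_coeff c n \<le> K * (real n + 1) powr (c - 1)" by (simp add: mult.assoc)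
  qed (use K in simp)
qed

section \<open>Integrable majorants\<close>

lemma integrable_Gamma_integrand:
  assumes "s > (0 :: real)"
  shows "integrable lborel (\<lambda>x. indicator {0<..} x * (x powr (s - 1) * exp (- x)))"
proof -
  let ?f = "\<lambda>x :: real. indicator {0<..} x * (x powr (s - 1) * exp (- x))"
  \<comment> \<open>The two indicators differ at 0 only, where both sides are 0 because
    \<open>0 powr a\<close> is 0.\<close>
  have "(\<lambda>x. ennreal (?f x)) = (\<lambda>t. ennreal (indicator {0..} t * t powr (s - 1) / exp t))"
    by (auto simp: fun_eq_iff indicator_def exp_minus field_simps)
  then have nn: "(\<integral>\<^sup>+ x. ennreal (?f x) \<partial>lborel) = ennreal (Gamma s)"
    using Gamma_conv_nn_integral_real[OF assms] by simp
  show ?thesis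
    by (rule integrableI_nonneg) (auto simp: nn)
qed

text \<open>For x in the cell between \<epsilon> n and \<epsilon> (n + 1), the power c - 1 of
  \<epsilon> (n + 1) is at most that of x if the exponent is negative, and at most that of x + 1
  otherwise. The factor with exponent M makes room for polynomial growth of the test
  function.\<close>

definition nb_majorant :: "real \<Rightarrow> nat \<Rightarrow> real \<Rightarrow> real" where
  "nb_majorant c M x = indicator {0<..} x *
     ((if c < 1 then x powr (c - 1) else (x + 1) powr (c - 1)) * (1 + x) ^ M * exp (- x))"

lemma one_plus_power_le:
  assumes "(x :: real) \<ge> 0"
  shows "(1 + x) ^ M \<le> 2 ^ M * (1 + x ^ M)"
proof -
  have "(1 + x) ^ M \<le> (2 * max 1 x) ^ M" using assms by (intro power_mono) auto
  also have "\<dots> = 2 ^ M * max 1 x ^ M" by (simp add: power_mult_distrib)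
  also have "max 1 x ^ M \<le> 1 + x ^ M" using assms by (auto simp: max_def)
  finally show ?thesis by simp
qed

lemma integrable_nb_majorant:
  assumes "c > 0"
  shows "integrable lborel (nb_majorant c M)"
proof -
  let ?g = "\<lambda>s x :: real. indicator {0<..} x * (x powr (s - 1) * exp (- x))"
  have meas: "nb_majorant c M \<in> borel_measurable lborel"
    unfolding nb_majorant_def by measurable
  show ?thesis
  proof (cases "c < 1")
    case True
    have "integrable lborel (\<lambda>x. 2 ^ M * (?g c x + ?g (c + real M) x))"
      using assms by (intro integrable_mult_right Bochner_Integration.integrable_add integrable_Gamma_integrand) auto
    then show ?thesis
    proof (rule Bochner_Integration.integrable_bound[OF _ meas], intro AE_I2)
      fix x :: real
      show "norm (nb_majorant c M x) \<le> norm (2 ^ M * (?g c x + ?g (c + real M) x))"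
      proof (cases "x > 0")
        case x: True
        have "x powr (c - 1) * (1 + x) ^ M * exp (- x) \<le> x powr (c - 1) * (2 ^ M * (1 + x ^ M)) * exp (- x)"
          using x one_plus_power_le[of x M] by (intro mult_right_mono mult_left_mono) auto
        also have "\<dots> = 2 ^ M * (?g c x + ?g (c + real M) x)"
        proof -
          have "x powr (c + real M - 1) = x powr (c - 1) * x ^ M"
            using x by (simp add: powr_add powr_diff powr_realpow field_simps)
          then show ?thesis using x by (simp add: algebra_simps)
        qed
        finally show ?thesis using x True by (simp add: nb_majorant_def)
      qed (simp add: nb_majorant_def)
    qed
  next
    case False
    \<comment> \<open>For c >= 1 the real exponent c - 1 is rounded up, so that a single natural
      power of 1 + x remains.\<close>
    define k where "k = nat \<lceil>c - 1\<rceil> + M"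
    have "integrable lborel (\<lambda>x. 2 ^ k * (?g 1 x + ?g (1 + real k) x))"
      by (intro integrable_mult_right Bochner_Integration.integrable_add integrable_Gamma_integrand) auto
    then show ?thesis
    proof (rule Bochner_Integration.integrable_bound[OF _ meas], intro AE_I2)
      fix x :: real
      show "norm (nb_majorant c M x) \<le> norm (2 ^ k * (?g 1 x + ?g (1 + real k) x))"
      proof (cases "x > 0")
        case x: True
        have "(x + 1) powr (c - 1) \<le> (x + 1) powr real (nat \<lceil>c - 1\<rceil>)"
          using x by (intro powr_mono) linarith+
        also have "\<dots> = (1 + x) ^ nat \<lceil>c - 1\<rceil>"
          using x by (simp add: powr_realpow add.commute)
        finally have "(x + 1) powr (c - 1) * (1 + x) ^ M * exp (- x) \<le>
            (1 + x) ^ nat \<lceil>c - 1\<rceil> * (1 + x) ^ M * exp (- x)"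
          using x by (intro mult_right_mono) auto
        also have "\<dots> = (1 + x) ^ k * exp (- x)" by (simp add: k_def power_add)
        also have "\<dots> \<le> 2 ^ k * (1 + x ^ k) * exp (- x)"
          using x one_plus_power_le[of x k] by (intro mult_right_mono) auto
        also have "\<dots> = 2 ^ k * (?g 1 x + ?g (1 + real k) x)"
          using x by (simp add: powr_realpow algebra_simps)
        finally show ?thesis using x False by (simp add: nb_majorant_def)
      qed (simp add: nb_majorant_def)
    qed
  qed
qed

lemma floor_div_bounds:
  assumes "0 < \<epsilon>" "0 \<le> x"
  shows "\<epsilon> * real (nat \<lfloor>x / \<epsilon>\<rfloor>) \<le> x" "x < \<epsilon> * (real (nat \<lfloor>x / \<epsilon>\<rfloor>) + 1)"
proof -
  let ?n = "nat \<lfloor>x / \<epsilon>\<rfloor>"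
  have n: "real ?n = real_of_int \<lfloor>x / \<epsilon>\<rfloor>" using assms by simp
  have "real ?n \<le> x / \<epsilon>" "x / \<epsilon> < real ?n + 1" unfolding n by linarith+
  then have "real ?n * \<epsilon> \<le> x" "x < (real ?n + 1) * \<epsilon>"
    using pos_le_divide_eq[OF assms(1)] pos_divide_less_eq[OF assms(1)] by blast+
  then show "\<epsilon> * real ?n \<le> x" "x < \<epsilon> * (real ?n + 1)"
    by (simp_all only: mult.commute)
qed

text \<open>Divided by \<epsilon>, the term is the height of a step over the cell of x. The constant
  \<open>exp 1\<close> comes from \<epsilon> n > x - \<epsilon> > x - 1.\<close>

lemma nb_term_bound:
  assumes c: "c > 0" and K: "\<And>n. nb_coeff c n \<le> K * (real n + 1) powr (c - 1)" "K \<ge> 0"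
    and \<epsilon>: "0 < \<epsilon>" "\<epsilon> < 1" and x: "x > 0" and C: "C \<ge> 0"
    and h: "\<bar>h\<bar> \<le> C * (1 + \<epsilon> * real (nat \<lfloor>x / \<epsilon>\<rfloor>)) ^ M"
  shows "\<bar>\<epsilon> powr c * nb_coeff c (nat \<lfloor>x / \<epsilon>\<rfloor>) * (1 - \<epsilon>) ^ nat \<lfloor>x / \<epsilon>\<rfloor> * h / \<epsilon>\<bar> \<le>
    K * C * exp 1 * nb_majorant c M x"
proof -
  define n where "n = nat \<lfloor>x / \<epsilon>\<rfloor>"
  have n: "\<epsilon> * real n \<le> x" "x < \<epsilon> * (real n + 1)"
    using floor_div_bounds[OF \<epsilon>(1), of x] x by (auto simp: n_def)
  let ?q = "if c < 1 then x powr (c - 1) else (x + 1) powr (c - 1)"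
  have pw: "\<epsilon> powr c / \<epsilon> = \<epsilon> powr (c - 1)" using \<epsilon> by (simp add: powr_diff)
  have "\<epsilon> powr c / \<epsilon> * nb_coeff c n \<le> \<epsilon> powr (c - 1) * (K * (real n + 1) powr (c - 1))"
    unfolding pw using \<epsilon> K(1) by (intro mult_left_mono) auto
  also have "\<epsilon> powr (c - 1) * (K * (real n + 1) powr (c - 1)) = K * (\<epsilon> * (real n + 1)) powr (c - 1)"
    using \<epsilon> by (simp add: powr_mult)
  also have "\<dots> \<le> K * ?q"
  proof (intro mult_left_mono K(2))
    show "(\<epsilon> * (real n + 1)) powr (c - 1) \<le> ?q"
    proof (cases "c < 1")
      case True
      then show ?thesis using n x \<epsilon> powr_mono2'[of "1 - c" x "\<epsilon> * (real n + 1)"] 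
        by (auto intro!: powr_mono2')
    next
      case False
      have "\<epsilon> * (real n + 1) \<le> x + 1" using n \<epsilon> by (simp add: algebra_simps)
      then show ?thesis using False \<epsilon> by (auto intro!: powr_mono2)
    qed
  qed
  finally have 1: "\<epsilon> powr c / \<epsilon> * nb_coeff c n \<le> K * ?q" .
  have "(1 - \<epsilon>) ^ n \<le> exp (- \<epsilon>) ^ n"
    using exp_ge_add_one_self[of "- \<epsilon>"] \<epsilon> by (intro power_mono) auto
  also have "\<dots> = exp (- (\<epsilon> * real n))" by (simp flip: exp_of_nat_mult add: mult.commute)
  also have "\<dots> \<le> exp (1 - x)" using n \<epsilon> by (simp add: algebra_simps)
  also have "exp (1 - x) = exp 1 * exp (- x)" by (simp flip: exp_add)
  finally have 2: "(1 - \<epsilon>) ^ n \<le> exp 1 * exp (- x)" .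
  have "(1 + \<epsilon> * real n) ^ M \<le> (1 + x) ^ M" using n \<epsilon> by (intro power_mono) auto
  then have 3: "\<bar>h\<bar> \<le> C * (1 + x) ^ M"
    using h C by (fold n_def) (meson mult_left_mono order_trans)
  have nn: "0 \<le> \<epsilon> powr c / \<epsilon> * nb_coeff c n" "0 \<le> (1 - \<epsilon>) ^ n" "0 \<le> ?q"
    using \<epsilon> nb_coeff_nonneg[OF c] by auto
  have "\<bar>\<epsilon> powr c * nb_coeff c n * (1 - \<epsilon>) ^ n * h / \<epsilon>\<bar> =
      (\<epsilon> powr c / \<epsilon> * nb_coeff c n) * (1 - \<epsilon>) ^ n * \<bar>h\<bar>"
    using \<epsilon> nb_coeff_nonneg[OF c] by (simp add: abs_mult)
  also have "\<dots> \<le> (K * ?q) * (exp 1 * exp (- x)) * (C * (1 + x) ^ M)"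
    by (rule mult_mono[OF mult_mono[OF 1 2] 3]) (use nn K(2) in auto)
  also have "\<dots> = K * C * exp 1 * nb_majorant c M x"
    using x by (simp add: nb_majorant_def)
  finally show ?thesis by (simp add: n_def)
qed

text \<open>With n about x / \<epsilon>, the asymptotics of \<open>nb_coeff\<close> gives the power
  c - 1 of \<epsilon> n divided by \<open>Gamma c\<close>, while (1 - \<epsilon>)^n lies between exp
  (- \<epsilon> n / (1 - \<epsilon>)) and exp (- \<epsilon> n).\<close>

lemma nb_term_limit:
  assumes c: "c > 0" and X: "\<And>j. 0 < X j" "\<And>j. X j < 1" "X \<longlonglongrightarrow> 0" and x: "x > 0"
  defines "n \<equiv> \<lambda>j. nat \<lfloor>x / X j\<rfloor>"
  shows "filterlim n at_top sequentially" "(\<lambda>j. X j * real (n j)) \<longlonglongrightarrow> x"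
    "(\<lambda>j. X j powr c * nb_coeff c (n j) * (1 - X j) ^ n j / X j) \<longlonglongrightarrow> x powr (c - 1) * exp (- x) / Gamma c"
proof -
  have b: "X j * real (n j) \<le> x" "x < X j * (real (n j) + 1)" for j
    using floor_div_bounds[OF X(1), of x j] x by (auto simp: n_def)
  show Xn: "(\<lambda>j. X j * real (n j)) \<longlonglongrightarrow> x"
  proof (rule tendsto_sandwich[of "\<lambda>j. x - X j" _ _ "\<lambda>_. x"])
    show "(\<lambda>j. x - X j) \<longlonglongrightarrow> x" using tendsto_diff[OF tendsto_const X(3), of x] by simp
  qed (use b in \<open>auto intro!: always_eventually simp: algebra_simps less_imp_le\<close>)
  have "X j \<noteq> 0" for j using X(1)[of j] by simp
  then have "filterlim X (at_right 0) sequentially"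
    using X by (simp add: filterlim_at)
  then have "filterlim (\<lambda>j. x * inverse (X j)) at_top sequentially"
    by (intro filterlim_tendsto_pos_mult_at_top[OF tendsto_const x]
        filterlim_compose[OF filterlim_inverse_at_top_right])
  then have inv: "filterlim (\<lambda>j. x / X j) at_top sequentially" by (simp add: divide_inverse)
  have "filterlim (\<lambda>j. real (n j)) at_top sequentially"
  proof (rule filterlim_at_top_mono)
    show "filterlim (\<lambda>j. - 1 + x / X j) at_top sequentially"
      by (rule filterlim_tendsto_add_at_top[OF tendsto_const inv])
    show "eventually (\<lambda>j. - 1 + x / X j \<le> real (n j)) sequentially"
    proof (intro always_eventually allI)
      fix j
      have "x / X j \<le> real (n j) + 1" using b(2)[of j] X(1)[of j] by (simp add: field_simps)
      then show "- 1 + x / X j \<le> real (n j)" by simp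
    qed
  qed
  then show n: "filterlim n at_top sequentially"
    by (simp add: filterlim_sequentially_iff_filterlim_real)
  have 1: "(\<lambda>j. nb_coeff c (n j) * real (n j) powr (1 - c)) \<longlonglongrightarrow> 1 / Gamma c"
    using filterlim_compose[OF nb_coeff_asymp[OF c] n] .
  have 2: "(\<lambda>j. (X j * real (n j)) powr (c - 1)) \<longlonglongrightarrow> x powr (c - 1)"
    by (intro tendsto_powr Xn tendsto_const) (use x in simp)
  have 3: "(\<lambda>j. (1 - X j) ^ n j) \<longlonglongrightarrow> exp (- x)"
  proof (rule tendsto_sandwich)
    have "(\<lambda>j. exp (- (X j * real (n j) / (1 - X j)))) \<longlonglongrightarrow> exp (- (x / (1 - 0)))"
      by (intro tendsto_exp tendsto_minus tendsto_divide Xn tendsto_diff tendsto_const X(3)) simp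
    then show "(\<lambda>j. exp (- (X j * real (n j) / (1 - X j)))) \<longlonglongrightarrow> exp (- x)" by simp
    show "(\<lambda>j. exp (- (X j * real (n j)))) \<longlonglongrightarrow> exp (- x)"
      by (intro tendsto_exp tendsto_minus Xn)
    show "eventually (\<lambda>j. (1 - X j) ^ n j \<le> exp (- (X j * real (n j)))) sequentially"
    proof (intro always_eventually allI)
      fix j
      have "(1 - X j) ^ n j \<le> exp (- X j) ^ n j"
        using exp_ge_add_one_self[of "- X j"] X(2)[of j] by (intro power_mono) auto
      then show "(1 - X j) ^ n j \<le> exp (- (X j * real (n j)))"
        by (simp flip: exp_of_nat_mult add: mult.commute)
    qed
    show "eventually (\<lambda>j. exp (- (X j * real (n j) / (1 - X j))) \<le> (1 - X j) ^ n j) sequentially"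
    proof (intro always_eventually allI)
      fix j
      have pos: "1 - X j > 0" using X(2)[of j] by simp
      have "1 / (1 - X j) = 1 + X j / (1 - X j)" using pos by (simp add: field_simps)
      also have "\<dots> \<le> exp (X j / (1 - X j))" by (rule exp_ge_add_one_self)
      finally have "inverse (exp (X j / (1 - X j))) \<le> inverse (1 / (1 - X j))"
        using pos by (intro le_imp_inverse_le) auto
      then have "exp (- (X j / (1 - X j))) \<le> 1 - X j" by (simp add: exp_minus)
      then have "exp (- (X j / (1 - X j))) ^ n j \<le> (1 - X j) ^ n j" by (intro power_mono) auto
      then show "exp (- (X j * real (n j) / (1 - X j))) \<le> (1 - X j) ^ n j"
        by (simp flip: exp_of_nat_mult add: mult.commute)
    qed
  qed
  have "(\<lambda>j. (nb_coeff c (n j) * real (n j) powr (1 - c)) * (X j * real (n j)) powr (c - 1) * (1 - X j) ^ n j)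
      \<longlonglongrightarrow> 1 / Gamma c * x powr (c - 1) * exp (- x)"
    by (intro tendsto_mult 1 2 3)
  moreover have "eventually (\<lambda>j. (nb_coeff c (n j) * real (n j) powr (1 - c)) *
      (X j * real (n j)) powr (c - 1) * (1 - X j) ^ n j =
      X j powr c * nb_coeff c (n j) * (1 - X j) ^ n j / X j) sequentially"
    using filterlim_at_top[THEN iffD1, OF n, rule_format, of 1]
  proof eventually_elim
    case (elim j)
    then have nj: "real (n j) > 0" by simp
    have "(X j * real (n j)) powr (c - 1) = X j powr (c - 1) * real (n j) powr (c - 1)"
      using X(1)[of j] by (simp add: powr_mult)
    moreover have "real (n j) powr (1 - c) * real (n j) powr (c - 1) = 1"
      using nj by (simp flip: powr_add)
    moreover have "X j powr (c - 1) = X j powr c / X j" using X(1)[of j] by (simp add: powr_diff)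
    ultimately show ?case by (simp add: field_simps)
  qed
  ultimately have "(\<lambda>j. X j powr c * nb_coeff c (n j) * (1 - X j) ^ n j / X j)
      \<longlonglongrightarrow> 1 / Gamma c * x powr (c - 1) * exp (- x)"
    by (rule Lim_transform_eventually)
  then show "(\<lambda>j. X j powr c * nb_coeff c (n j) * (1 - X j) ^ n j / X j)
      \<longlonglongrightarrow> x powr (c - 1) * exp (- x) / Gamma c" by simp
qed

text \<open>The series is the integral of a step function with cells of width \<epsilon>, so one
  integrable majorant on the half-line yields summability and, by dominated convergence, the limit.
  The values \<open>h\<close> may depend on \<epsilon>; they only have to converge along n = floor
  (x / \<epsilon>).\<close>

lemma negative_binomial_to_gamma:
  fixes h :: "real \<Rightarrow> nat \<Rightarrow> real" and L :: "real \<Rightarrow> real"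
  assumes c: "c > 0" and C: "C \<ge> 0"
    and h: "\<And>\<epsilon> n. 0 < \<epsilon> \<Longrightarrow> \<epsilon> < 1 \<Longrightarrow> \<bar>h \<epsilon> n\<bar> \<le> C * (1 + \<epsilon> * real n) ^ M"
    and L: "(\<lambda>x. indicator {0<..} x * L x) \<in> borel_measurable borel"
    and lim: "\<And>X x. (\<And>j. 0 < X j) \<Longrightarrow> (\<And>j. X j < 1) \<Longrightarrow> X \<longlonglongrightarrow> 0 \<Longrightarrow> x > 0 \<Longrightarrow>
      (\<lambda>j. h (X j) (nat \<lfloor>x / X j\<rfloor>)) \<longlonglongrightarrow> L x"
  defines "t \<equiv> \<lambda>\<epsilon> n. \<epsilon> powr c * nb_coeff c n * (1 - \<epsilon>) ^ n * h \<epsilon> n"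
  shows "\<And>\<epsilon>. 0 < \<epsilon> \<Longrightarrow> \<epsilon> < 1 \<Longrightarrow> summable (\<lambda>n. \<bar>t \<epsilon> n\<bar>)"
    and "((\<lambda>\<epsilon>. suminf (t \<epsilon>)) \<longlongrightarrow>
      (\<integral>x. indicator {0<..} x * (x powr (c - 1) * exp (- x) / Gamma c * L x) \<partial>lborel)) (at_right 0)"
proof -
  obtain K where K: "K \<ge> 0" "\<And>n. nb_coeff c n \<le> K * (real n + 1) powr (c - 1)"
    using nb_coeff_bound[OF c] by blast
  define D where "D = (\<lambda>x. K * C * exp 1 * nb_majorant c M x)"
  have D: "integrable lborel D"
    unfolding D_def by (intro integrable_mult_right integrable_nb_majorant c)
  have D0: "0 \<le> D x" for x
    using K(1) C by (auto simp: D_def nb_majorant_def indicator_def)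
  define S where "S = (\<lambda>\<epsilon> x. indicator {0<..} x * (t \<epsilon> (nat \<lfloor>x / \<epsilon>\<rfloor>) / \<epsilon>))"
  \<comment> \<open>Open cells are disjoint and miss only the grid points, a null set. Off the grid
    exactly one summand, that of the cell of x, is relevant.\<close>
  define f where "f = (\<lambda>\<epsilon> n x. indicator {real n * \<epsilon><..<(real n + 1) * \<epsilon>} x * (t \<epsilon> n / \<epsilon>))"
  have SD: "\<bar>S \<epsilon> x\<bar> \<le> D x" if "0 < \<epsilon>" "\<epsilon> < 1" for \<epsilon> x
  proof (cases "x > 0")
    case True
    then show ?thesis
      using nb_term_bound[OF c K(2,1) that True C h[OF that]] by (simp add: S_def D_def t_def)
  qed (use D0 in \<open>simp add: S_def\<close>)
  have f_eq: "f \<epsilon> n x = (if n = nat \<lfloor>x / \<epsilon>\<rfloor> then S \<epsilon> x else 0)"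
    if \<epsilon>: "0 < \<epsilon>" and x: "\<forall>k :: nat. x \<noteq> real k * \<epsilon>" for \<epsilon> n x
  proof (cases "x > 0")
    case False
    then have "x \<notin> {real n * \<epsilon><..<(real n + 1) * \<epsilon>}" using \<epsilon> by (auto simp: not_less intro: order_trans)
    then show ?thesis using False by (simp add: f_def S_def)
  next
    case True
    have "x \<in> {real n * \<epsilon><..<(real n + 1) * \<epsilon>} \<longleftrightarrow> n = nat \<lfloor>x / \<epsilon>\<rfloor>"
    proof
      assume "x \<in> {real n * \<epsilon><..<(real n + 1) * \<epsilon>}"
      then have "real n \<le> x / \<epsilon>" "x / \<epsilon> < real n + 1" using \<epsilon> by (auto simp: field_simps)
      then have "\<lfloor>x / \<epsilon>\<rfloor> = int n" by linarith
      then show "n = nat \<lfloor>x / \<epsilon>\<rfloor>" by simp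
    next
      assume "n = nat \<lfloor>x / \<epsilon>\<rfloor>"
      then have "\<epsilon> * real n \<le> x" "x < \<epsilon> * (real n + 1)"
        using floor_div_bounds[OF \<epsilon>, of x] True by auto
      then show "x \<in> {real n * \<epsilon><..<(real n + 1) * \<epsilon>}"
        using x[rule_format, of n] by (auto simp: mult.commute)
    qed
    then show ?thesis using True by (auto simp: f_def S_def indicator_def)
  qed
  have AE_off: "AE x in lborel. \<forall>k :: nat. x \<noteq> real k * \<epsilon>" for \<epsilon> :: real
    unfolding AE_all_countable by (auto intro: AE_lborel_singleton)
  have f_int: "integrable lborel (f \<epsilon> n)" "(\<integral>x. f \<epsilon> n x \<partial>lborel) = t \<epsilon> n"
    "integrable lborel (\<lambda>x. \<bar>f \<epsilon> n x\<bar>)" "(\<integral>x. \<bar>f \<epsilon> n x\<bar> \<partial>lborel) = \<bar>t \<epsilon> n\<bar>"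
    if \<epsilon>: "0 < \<epsilon>" for \<epsilon> n
  proof -
    have m: "measure lborel {real n * \<epsilon><..<(real n + 1) * \<epsilon>} = \<epsilon>"
      "emeasure lborel {real n * \<epsilon><..<(real n + 1) * \<epsilon>} < \<infinity>"
      using \<epsilon> by (simp_all add: algebra_simps)
    have i: "integrable lborel (indicator {real n * \<epsilon><..<(real n + 1) * \<epsilon>} :: real \<Rightarrow> real)"
      using m(2) by (intro integrable_real_indicator) auto
    show "integrable lborel (f \<epsilon> n)" unfolding f_def by (rule integrable_mult_left[OF i])
    then show "integrable lborel (\<lambda>x. \<bar>f \<epsilon> n x\<bar>)" by (rule integrable_abs)
    show "(\<integral>x. f \<epsilon> n x \<partial>lborel) = t \<epsilon> n" unfolding f_def using i m \<epsilon> by simp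
    have "(\<lambda>x. \<bar>f \<epsilon> n x\<bar>) = (\<lambda>x. indicator {real n * \<epsilon><..<(real n + 1) * \<epsilon>} x * (\<bar>t \<epsilon> n\<bar> / \<epsilon>))"
      using \<epsilon> by (auto simp: f_def abs_mult fun_eq_iff)
    then show "(\<integral>x. \<bar>f \<epsilon> n x\<bar> \<partial>lborel) = \<bar>t \<epsilon> n\<bar>" using i m \<epsilon> by simp
  qed
  show summ: "summable (\<lambda>n. \<bar>t \<epsilon> n\<bar>)" if \<epsilon>: "0 < \<epsilon>" "\<epsilon> < 1" for \<epsilon>
  proof (rule summableI_nonneg_bounded)
    fix k
    have "(\<Sum>n<k. \<bar>t \<epsilon> n\<bar>) = (\<integral>x. (\<Sum>n<k. \<bar>f \<epsilon> n x\<bar>) \<partial>lborel)"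
      using f_int[OF \<epsilon>(1)] by (subst Bochner_Integration.integral_sum) auto
    also have "\<dots> \<le> (\<integral>x. D x \<partial>lborel)"
    proof (rule integral_mono_AE)
      show "AE x in lborel. (\<Sum>n<k. \<bar>f \<epsilon> n x\<bar>) \<le> D x"
        using AE_off[of \<epsilon>]
      proof eventually_elim
        case (elim x)
        have "(\<Sum>n<k. \<bar>f \<epsilon> n x\<bar>) = (\<Sum>n<k. if n = nat \<lfloor>x / \<epsilon>\<rfloor> then \<bar>S \<epsilon> x\<bar> else 0)"
          using f_eq[OF \<epsilon>(1) elim] by (intro sum.cong) auto
        also have "\<dots> \<le> \<bar>S \<epsilon> x\<bar>" by simp
        also have "\<dots> \<le> D x" by (rule SD[OF \<epsilon>])
        finally show ?case .
      qed
    qed (use D f_int[OF \<epsilon>(1)] in auto)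
    finally show "(\<Sum>n<k. \<bar>t \<epsilon> n\<bar>) \<le> (\<integral>x. D x \<partial>lborel)" .
  qed simp
  have S_sums: "(\<lambda>n. f \<epsilon> n x) sums S \<epsilon> x" if "0 < \<epsilon>" "\<forall>k :: nat. x \<noteq> real k * \<epsilon>" for \<epsilon> x
    unfolding f_eq[OF that] by (rule sums_single)
  have S_eq: "(\<integral>x. S \<epsilon> x \<partial>lborel) = suminf (t \<epsilon>)" if \<epsilon>: "0 < \<epsilon>" "\<epsilon> < 1" for \<epsilon>
  proof -
    have ae: "AE x in lborel. summable (\<lambda>n. norm (f \<epsilon> n x))"
      using AE_off[of \<epsilon>]
    proof eventually_elim
      case (elim x)
      have eq: "(\<lambda>n. norm (f \<epsilon> n x)) = (\<lambda>n. if n = nat \<lfloor>x / \<epsilon>\<rfloor> then \<bar>S \<epsilon> x\<bar> else 0)"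
        using f_eq[OF \<epsilon>(1) elim] by auto
      show ?case unfolding eq by (rule sums_summable[OF sums_single])
    qed
    have sm: "summable (\<lambda>n. \<integral>x. norm (f \<epsilon> n x) \<partial>lborel)"
      using summ[OF \<epsilon>] f_int(4)[OF \<epsilon>(1)] by simp
    have "(\<integral>x. suminf (\<lambda>n. f \<epsilon> n x) \<partial>lborel) = suminf (\<lambda>n. \<integral>x. f \<epsilon> n x \<partial>lborel)"
      by (rule integral_suminf[OF f_int(1)[OF \<epsilon>(1)] ae sm])
    moreover have "(\<integral>x. suminf (\<lambda>n. f \<epsilon> n x) \<partial>lborel) = (\<integral>x. S \<epsilon> x \<partial>lborel)"
    proof (rule integral_cong_AE)
      show "S \<epsilon> \<in> borel_measurable lborel" unfolding S_def by measurable
      show "AE x in lborel. suminf (\<lambda>n. f \<epsilon> n x) = S \<epsilon> x"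
        using AE_off[of \<epsilon>] by eventually_elim (rule sums_unique[OF S_sums[OF \<epsilon>(1)], symmetric])
      show "(\<lambda>x. suminf (\<lambda>n. f \<epsilon> n x)) \<in> borel_measurable lborel" unfolding f_def by measurable
    qed
    ultimately show ?thesis using f_int(2)[OF \<epsilon>(1)] by simp
  qed
  have seq: "(\<lambda>j. suminf (t (X j))) \<longlonglongrightarrow>
      (\<integral>x. indicator {0<..} x * (x powr (c - 1) * exp (- x) / Gamma c * L x) \<partial>lborel)"
    if X: "\<And>j. 0 < X j" "\<And>j. X j < 1" "X \<longlonglongrightarrow> 0" for X
  proof -
    have "(\<lambda>j. \<integral>x. S (X j) x \<partial>lborel) \<longlonglongrightarrow>
      (\<integral>x. indicator {0<..} x * (x powr (c - 1) * exp (- x) / Gamma c * L x) \<partial>lborel)"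
    proof (rule integral_dominated_convergence[OF _ _ D])
      have "(\<lambda>x. (indicator {0<..} x * L x) * (x powr (c - 1) * exp (- x) / Gamma c)) \<in> borel_measurable borel"
        using L by measurable
      then show "(\<lambda>x. indicator {0<..} x * (x powr (c - 1) * exp (- x) / Gamma c * L x)) \<in> borel_measurable lborel"
        by (simp add: mult_ac)
      show "S (X j) \<in> borel_measurable lborel" for j unfolding S_def by measurable
      show "AE x in lborel. norm (S (X j) x) \<le> D x" for j
        using SD[OF X(1,2)] by simp
      show "AE x in lborel. (\<lambda>j. S (X j) x) \<longlonglongrightarrow>
          indicator {0<..} x * (x powr (c - 1) * exp (- x) / Gamma c * L x)"
      proof (intro AE_I2)
        fix x :: real
        show "(\<lambda>j. S (X j) x) \<longlonglongrightarrow> indicator {0<..} x * (x powr (c - 1) * exp (- x) / Gamma c * L x)"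
        proof (cases "x > 0")
          case True
          have "(\<lambda>j. X j powr c * nb_coeff c (nat \<lfloor>x / X j\<rfloor>) * (1 - X j) ^ nat \<lfloor>x / X j\<rfloor> / X j *
              h (X j) (nat \<lfloor>x / X j\<rfloor>)) \<longlonglongrightarrow> x powr (c - 1) * exp (- x) / Gamma c * L x"
            by (intro tendsto_mult nb_term_limit(3)[OF c X True] lim X True)
          then show ?thesis using True by (simp add: S_def t_def)
        qed (simp add: S_def)
      qed
    qed
    then show ?thesis using S_eq[OF X(1,2)] by simp
  qed
  \<comment> \<open>Dominated convergence works along sequences; restricting to the open unit
    interval makes every term of such a sequence a legal parameter.\<close>
  have ar: "at_right (0 :: real) = at 0 within {0<..<1}"
    by (rule at_within_nhd[of 0 "{..<1}"]) auto
  then show "((\<lambda>\<epsilon>. suminf (t \<epsilon>)) \<longlongrightarrow>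
      (\<integral>x. indicator {0<..} x * (x powr (c - 1) * exp (- x) / Gamma c * L x) \<partial>lborel)) (at_right 0)"
    unfolding ar tendsto_at_iff_sequentially o_def by (intro allI impI seq) auto
qed

section \<open>Mixtures of the levels\<close>

definition scale_point :: "real \<Rightarrow> thoma_point \<Rightarrow> thoma_point" where
  "scale_point r \<omega> = (\<lambda>i. r * fst \<omega> i, \<lambda>i. r * fst (snd \<omega>) i, r)"

lemma scale_point_in_cone:
  assumes "\<omega> \<in> thoma_simplex" "r \<ge> 0"
  shows "scale_point r \<omega> \<in> thoma_cone"
proof -
  obtain \<alpha> \<beta> where w: "\<omega> = (\<alpha>, \<beta>, 1)" "(\<alpha>, \<beta>, 1) \<in> thoma_cone"
    using assms(1) by (auto simp: thoma_simplex_def)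
  have s: "summable \<alpha>" "summable \<beta>" "suminf \<alpha> + suminf \<beta> \<le> 1"
    using w(2) by (auto simp: thoma_cone_def)
  have "r * suminf \<alpha> + r * suminf \<beta> \<le> r"
    using mult_left_mono[OF s(3) assms(2)] by (simp add: distrib_left)
  then show ?thesis
    using w(2) assms(2) s
    by (auto simp: w(1) scale_point_def thoma_cone_def suminf_mult decseq_def mult_left_mono
        intro: summable_mult)
qed

lemma thoma_embed_scale:
  assumes "sum_list \<nu> = n" "n \<ge> 1"
  shows "thoma_embed \<epsilon> \<nu> = scale_point (\<epsilon> * real n) (thoma_embed (1 / real n) \<nu>)"
  using assms by (auto simp: thoma_embed_def scale_point_def fun_eq_iff)

lemma continuous_on_scale_point:
  "continuous_on S (\<lambda>q. scale_point (fst q) (snd q))"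
  unfolding scale_point_def
proof (intro continuous_on_Pair)
  show "continuous_on S (\<lambda>q :: real \<times> thoma_point. \<lambda>i. fst q * fst (snd q) i)"
    "continuous_on S (\<lambda>q :: real \<times> thoma_point. \<lambda>i. fst q * fst (snd (snd q)) i)"
    by (rule continuous_on_coordinatewise_then_product, intro continuous_on_mult continuous_on_fst
        continuous_on_id continuous_on_compose2[OF continuous_on_coordinates(1)[of UNIV]]
        continuous_on_compose2[OF continuous_on_coordinates(2)[of UNIV]] continuous_on_snd subset_UNIV)+
qed (intro continuous_on_fst continuous_on_id)

lemma continuous_on_scaled:
  assumes F: "continuous_on thoma_cone F"
  shows "continuous_on ({0..R} \<times> thoma_simplex) (\<lambda>q. F (scale_point (fst q) (snd q)))"
    and "r \<ge> 0 \<Longrightarrow> continuous_on thoma_simplex (\<lambda>\<omega>. F (scale_point r \<omega>))"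
proof -
  have *: "continuous_on ({0..R} \<times> thoma_simplex) (\<lambda>q. F (scale_point (fst q) (snd q)))" for R
    by (rule continuous_on_compose2[OF F continuous_on_scale_point])
      (auto intro: scale_point_in_cone)
  show "continuous_on ({0..R} \<times> thoma_simplex) (\<lambda>q. F (scale_point (fst q) (snd q)))" by (rule *)
  assume r: "r \<ge> 0"
  have "continuous_on thoma_simplex (\<lambda>\<omega>. (\<lambda>q. F (scale_point (fst q) (snd q))) (r, \<omega>))"
    by (rule continuous_on_compose2[OF *[of r]])
      (use r in \<open>auto intro: continuous_on_Pair continuous_on_const continuous_on_id\<close>)
  then show "continuous_on thoma_simplex (\<lambda>\<omega>. F (scale_point r \<omega>))" by simp
qed

definition level_mean :: "thoma_point measure \<Rightarrow> (thoma_point \<Rightarrow> real) \<Rightarrow> real \<Rightarrow> nat \<Rightarrow> real" where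
  "level_mean P F \<epsilon> n = (\<Sum>\<nu>\<in>partitions_of n. level_measure P \<nu> * F (thoma_embed \<epsilon> \<nu>))"

lemma polynomially_bounded_power:
  assumes "polynomially_bounded F"
  obtains C M where "C \<ge> 0" "\<And>\<omega>. \<omega> \<in> thoma_cone \<Longrightarrow> \<bar>F \<omega>\<bar> \<le> C * (1 + snd (snd \<omega>)) ^ M"
proof -
  obtain C1 C2 where *: "\<forall>(\<alpha>, \<beta>, r)\<in>thoma_cone. \<bar>F (\<alpha>, \<beta>, r)\<bar> \<le> C1 * (1 + r) powr C2"
    using assms by (auto simp: polynomially_bounded_def)
  show ?thesis
  proof (rule that[of "\<bar>C1\<bar>" "nat \<lceil>C2\<rceil>"])
    fix \<omega> assume \<omega>: "\<omega> \<in> thoma_cone"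
    obtain \<alpha> \<beta> r where w: "\<omega> = (\<alpha>, \<beta>, r)" by (cases \<omega>)
    have r: "r \<ge> 0" using \<omega> by (simp add: w thoma_cone_def)
    have "\<bar>F \<omega>\<bar> \<le> C1 * (1 + r) powr C2" using * \<omega> w by auto
    also have "\<dots> \<le> \<bar>C1\<bar> * (1 + r) powr C2" by (intro mult_right_mono) auto
    also have "(1 + r) powr C2 \<le> (1 + r) powr real (nat \<lceil>C2\<rceil>)"
      using r by (intro powr_mono) linarith+
    also have "\<dots> = (1 + r) ^ nat \<lceil>C2\<rceil>" using r by (simp add: powr_realpow)
    finally show "\<bar>F \<omega>\<bar> \<le> \<bar>C1\<bar> * (1 + snd (snd \<omega>)) ^ nat \<lceil>C2\<rceil>"
      by (simp add: w mult_left_mono)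
  qed simp
qed

lemma level_mean_bound:
  assumes adm: "admissible z z'" and P: "is_boundary_z_measure z z' P"
    and F: "\<And>\<omega>. \<omega> \<in> thoma_cone \<Longrightarrow> \<bar>F \<omega>\<bar> \<le> C * (1 + snd (snd \<omega>)) ^ M" and "\<epsilon> \<ge> 0"
  shows "\<bar>level_mean P F \<epsilon> n\<bar> \<le> C * (1 + \<epsilon> * real n) ^ M"
proof -
  have "\<bar>level_mean P F \<epsilon> n\<bar> \<le> (\<Sum>\<nu>\<in>partitions_of n. level_measure P \<nu> * (C * (1 + \<epsilon> * real n) ^ M))"
    unfolding level_mean_def
  proof (rule order_trans[OF sum_abs sum_mono])
    fix \<nu> assume "\<nu> \<in> partitions_of n"
    then have \<nu>: "\<nu> \<in> partitions" "sum_list \<nu> = n" by (auto simp: partitions_of_def)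
    have nn: "level_measure P \<nu> \<ge> 0" by (rule level_measure_nonneg[OF adm P \<nu>(1)])
    have "\<bar>F (thoma_embed \<epsilon> \<nu>)\<bar> \<le> C * (1 + \<epsilon> * real n) ^ M"
      using F[OF thoma_embed_in_cone[OF \<nu>(1) assms(4)]] by (simp add: thoma_embed_def \<nu>(2))
    then show "\<bar>level_measure P \<nu> * F (thoma_embed \<epsilon> \<nu>)\<bar> \<le> level_measure P \<nu> * (C * (1 + \<epsilon> * real n) ^ M)"
      using nn mult_left_mono by (fastforce simp: abs_mult)
  qed
  also have "\<dots> = C * (1 + \<epsilon> * real n) ^ M"
    by (simp only: sum_distrib_right[symmetric] sum_level_measure[OF P] mult_1_left)
  finally show ?thesis .
qed

text \<open>The scale \<open>X j * real (n j)\<close> moves with j, whereas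
  \<open>level_tendsto\<close> treats a fixed function. Uniform continuity on the compact product of
  an interval with the simplex allows the scale to be replaced by its limit.\<close>

lemma level_mean_tendsto:
  assumes adm: "admissible z z'" and P: "is_boundary_z_measure z z' P"
    and F: "continuous_on thoma_cone F"
    and n: "filterlim n at_top sequentially" and X: "(\<lambda>j. X j * real (n j)) \<longlonglongrightarrow> x"
    and pos: "\<And>j. X j > 0" and x: "x > 0"
  shows "(\<lambda>j. level_mean P F (X j) (n j)) \<longlonglongrightarrow> (\<integral>\<omega>. F (scale_point x \<omega>) \<partial>P)"
proof -
  let ?g = "\<lambda>\<omega>. F (scale_point x \<omega>)"
  let ?E = "\<lambda>n. \<Sum>\<nu>\<in>partitions_of n. level_measure P \<nu> * ?g (thoma_embed (1 / real n) \<nu>)"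
  have E: "(\<lambda>j. ?E (n j)) \<longlonglongrightarrow> (\<integral>\<omega>. ?g \<omega> \<partial>P)"
    using filterlim_compose[OF level_tendsto[OF adm P continuous_on_scaled(2)[OF F]] n] x by simp
  have "(\<lambda>j. level_mean P F (X j) (n j) - ?E (n j)) \<longlonglongrightarrow> 0"
  proof (rule LIMSEQ_I)
    fix e :: real assume e: "e > 0"
    let ?G = "\<lambda>q. F (scale_point (fst q) (snd q))"
    \<comment> \<open>The interval reaches up to x + 1 so that it contains every scale within
      distance 1 of x.\<close>
    have "uniformly_continuous_on ({0..x + 1} \<times> thoma_simplex) ?G"
      by (intro compact_uniformly_continuous continuous_on_scaled F compact_Times compact_thoma_simplex)
        simp
    then obtain d where d: "d > 0" "\<And>q q'. q \<in> {0..x + 1} \<times> thoma_simplex \<Longrightarrow>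
        q' \<in> {0..x + 1} \<times> thoma_simplex \<Longrightarrow> dist q' q < d \<Longrightarrow> dist (?G q') (?G q) < e / 2"
      using e unfolding uniformly_continuous_on_def by (metis half_gt_zero)
    have "eventually (\<lambda>j. dist (X j * real (n j)) x < min d 1) sequentially"
      using X d(1) by (intro tendstoD) auto
    moreover have "eventually (\<lambda>j. n j \<ge> 1) sequentially"
      using n by (simp add: filterlim_at_top)
    ultimately have "eventually (\<lambda>j. norm (level_mean P F (X j) (n j) - ?E (n j) - 0) < e) sequentially"
    proof eventually_elim
      case (elim j)
      let ?r = "X j * real (n j)"
      have r: "?r \<in> {0..x + 1}" "dist ?r x < d"
        using elim pos[of j] by (auto simp: dist_real_def)
      have "level_mean P F (X j) (n j) - ?E (n j) = (\<Sum>\<nu>\<in>partitions_of (n j). level_measure P \<nu> *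
          (F (thoma_embed (X j) \<nu>) - ?g (thoma_embed (1 / real (n j)) \<nu>)))"
        by (simp add: level_mean_def sum_subtractf right_diff_distrib)
      also have "\<bar>\<dots>\<bar> \<le> (\<Sum>\<nu>\<in>partitions_of (n j). level_measure P \<nu> * (e / 2))"
      proof (rule order_trans[OF sum_abs sum_mono])
        fix \<nu> assume \<nu>: "\<nu> \<in> partitions_of (n j)"
        let ?\<omega> = "thoma_embed (1 / real (n j)) \<nu>"
        have \<omega>: "?\<omega> \<in> thoma_simplex" by (rule thoma_embed_in_simplex[OF \<nu> elim(2)])
        have nn: "level_measure P \<nu> \<ge> 0"
          using level_measure_nonneg[OF adm P] \<nu> by (simp add: partitions_of_def)
        have "F (thoma_embed (X j) \<nu>) = ?G (?r, ?\<omega>)"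
          using thoma_embed_scale[of \<nu> "n j" "X j"] \<nu> elim(2) by (simp add: partitions_of_def)
        moreover have "dist (?G (?r, ?\<omega>)) (?G (x, ?\<omega>)) < e / 2"
          by (rule d(2)) (use r \<omega> x in \<open>auto simp: dist_Pair_Pair\<close>)
        ultimately have "\<bar>F (thoma_embed (X j) \<nu>) - ?g ?\<omega>\<bar> \<le> e / 2"
          by (simp add: dist_real_def)
        from mult_left_mono[OF this nn]
        show "\<bar>level_measure P \<nu> * (F (thoma_embed (X j) \<nu>) - ?g ?\<omega>)\<bar> \<le> level_measure P \<nu> * (e / 2)"
          using nn by (simp only: abs_mult abs_of_nonneg)
      qed
      also have "\<dots> = e / 2"
        by (simp only: sum_distrib_right[symmetric] sum_level_measure[OF P] mult_1_left)
      finally show ?case using e by simp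
    qed
    then show "\<exists>no. \<forall>j\<ge>no. norm (level_mean P F (X j) (n j) - ?E (n j) - 0) < e"
      by (simp add: eventually_sequentially)
  qed
  from tendsto_add[OF this E] show ?thesis by simp
qed

section \<open>Integration against the lifted measure\<close>

lemma gamma_measure_space: "space (gamma_measure c) = {0<..}"
  by (simp add: gamma_measure_def space_restrict_space)

lemma measurable_gamma_measure: "borel_measurable (gamma_measure c) = borel_measurable (restrict_space lborel {0<..})"
  by (rule measurable_cong_sets) (simp_all add: gamma_measure_def)

lemma gamma_measure_integral:
  fixes \<phi> :: "real \<Rightarrow> real"
  assumes c: "c > 0" and \<phi>: "\<phi> \<in> borel_measurable (gamma_measure c)"
  shows "integrable (gamma_measure c) \<phi> \<longleftrightarrow>
      integrable lborel (\<lambda>x. indicator {0<..} x * (x powr (c - 1) * exp (- x) / Gamma c * \<phi> x))"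
    and "(\<integral>x. \<phi> x \<partial>gamma_measure c) =
      (\<integral>x. indicator {0<..} x * (x powr (c - 1) * exp (- x) / Gamma c * \<phi> x) \<partial>lborel)"
proof -
  let ?g = "\<lambda>x :: real. x powr (c - 1) * exp (- x) / Gamma c"
  let ?R = "restrict_space lborel {0<..} :: real measure"
  have g: "?g \<in> borel_measurable ?R" by (rule measurable_restrict_space1) measurable
  have nn: "AE x in ?R. 0 \<le> ?g x"
    using Gamma_real_pos[OF c] by (intro AE_I2) simp
  have \<phi>': "\<phi> \<in> borel_measurable ?R" using \<phi> by (simp add: measurable_gamma_measure)
  show "integrable (gamma_measure c) \<phi> \<longleftrightarrow>
      integrable lborel (\<lambda>x. indicator {0<..} x * (?g x * \<phi> x))"
    unfolding gamma_measure_def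
    by (subst integrable_density[OF \<phi>' g nn], subst integrable_restrict_space) (auto simp: mult_ac)
  show "(\<integral>x. \<phi> x \<partial>gamma_measure c) = (\<integral>x. indicator {0<..} x * (?g x * \<phi> x) \<partial>lborel)"
    unfolding gamma_measure_def
    by (subst integral_density[OF \<phi>' g nn], subst integral_restrict_space) (auto simp: mult_ac)
qed

text \<open>The majorant of the discrete sums also dominates the Gamma density times a polynomial,
  so it is reused.\<close>

lemma integrable_gamma_power:
  assumes c: "c > 0"
  shows "integrable (gamma_measure c) (\<lambda>x. (1 + x) ^ M)"
proof -
  have meas: "(\<lambda>x. (1 + x) ^ M) \<in> borel_measurable (gamma_measure c)"
    unfolding measurable_gamma_measure by (rule measurable_restrict_space1) measurable
  have "integrable lborel (\<lambda>x. nb_majorant c M x / Gamma c)"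
    by (intro integrable_divide integrable_nb_majorant c)
  then have "integrable lborel (\<lambda>x. indicator {0<..} x * (x powr (c - 1) * exp (- x) / Gamma c * (1 + x) ^ M))"
  proof (rule Bochner_Integration.integrable_bound, goal_cases)
    case 2
    show ?case
    proof (intro AE_I2)
      fix x :: real
      show "norm (indicator {0<..} x * (x powr (c - 1) * exp (- x) / Gamma c * (1 + x) ^ M)) \<le>
          norm (nb_majorant c M x / Gamma c)"
      proof (cases "x > 0")
        case True
        let ?q = "if c < 1 then x powr (c - 1) else (x + 1) powr (c - 1)"
        have q: "x powr (c - 1) \<le> ?q" using True by (auto intro!: powr_mono2)
        have "x powr (c - 1) * ((1 + x) ^ M * exp (- x) / Gamma c) \<le> ?q * ((1 + x) ^ M * exp (- x) / Gamma c)"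
          using True Gamma_real_pos[OF c] by (intro mult_right_mono q) auto
        moreover have "nb_majorant c M x / Gamma c = ?q * ((1 + x) ^ M * exp (- x) / Gamma c)"
          using True by (simp add: nb_majorant_def)
        moreover have "indicator {0<..} x * (x powr (c - 1) * exp (- x) / Gamma c * (1 + x) ^ M) =
            x powr (c - 1) * ((1 + x) ^ M * exp (- x) / Gamma c)"
          using True by simp
        moreover have "0 \<le> x powr (c - 1) * ((1 + x) ^ M * exp (- x) / Gamma c)"
          using True Gamma_real_pos[OF c] by simp
        ultimately show ?thesis by (simp only: real_norm_def)
      qed (simp add: nb_majorant_def)
    qed
  qed measurable
  then show ?thesis using gamma_measure_integral(1)[OF c meas] by simp
qed

lemma finite_measure_gamma:
  assumes "c > 0"
  shows "finite_measure (gamma_measure c)"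
proof (rule finite_measureI)
  have "integrable (gamma_measure c) (\<lambda>x. 1 :: real)"
    using integrable_gamma_power[OF assms, of 0] by simp
  then show "emeasure (gamma_measure c) (space (gamma_measure c)) \<noteq> \<infinity>"
    by (auto simp: integrable_iff_bounded)
qed

text \<open>Fubini with the simplex integrated first: the inner integral at scale x is the limit of
  the level means in \<open>level_mean_tendsto\<close>. The growth bound depends on r only, so Gamma
  moments give integrability uniformly over the simplex.\<close>

lemma lift_integral:
  assumes P: "is_boundary_z_measure z z' P" and c: "c > 0"
    and F: "continuous_on thoma_cone F"
    and bound: "\<And>\<omega>. \<omega> \<in> thoma_cone \<Longrightarrow> \<bar>F \<omega>\<bar> \<le> C * (1 + snd (snd \<omega>)) ^ M"
  defines "L \<equiv> \<lambda>x. \<integral>\<omega>. F (scale_point x \<omega>) \<partial>P"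
  shows "integrable (thoma_lift c P) F"
    and "(\<integral>\<omega>. F \<omega> \<partial>thoma_lift c P) =
      (\<integral>x. indicator {0<..} x * (x powr (c - 1) * exp (- x) / Gamma c * L x) \<partial>lborel)"
    and "(\<lambda>x. indicator {0<..} x * L x) \<in> borel_measurable borel"
proof -
  let ?\<gamma> = "gamma_measure c"
  let ?T = "\<lambda>(\<omega>, r). scale_point r \<omega>"
  interpret P: prob_space P using P by (simp add: is_boundary_z_measure_def)
  interpret G: finite_measure ?\<gamma> by (rule finite_measure_gamma[OF c])
  interpret pair_sigma_finite P ?\<gamma> ..
  have sP: "sets P = sets (restrict_space borel thoma_simplex)"
    using P by (simp add: is_boundary_z_measure_def)
  have coord: "(\<lambda>\<omega>. fst \<omega> i) \<in> borel_measurable P" "(\<lambda>\<omega>. fst (snd \<omega>) i) \<in> borel_measurable P" for i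
    unfolding measurable_cong_sets[OF sP refl]
    by (intro borel_measurable_continuous_on_restrict continuous_on_coordinates)+
  have id: "(\<lambda>r. r) \<in> borel_measurable ?\<gamma>"
    unfolding measurable_gamma_measure by (rule measurable_restrict_space1) measurable
  have snd_meas: "(\<lambda>q. snd q) \<in> borel_measurable (P \<Otimes>\<^sub>M ?\<gamma>)"
    by (rule measurable_compose[OF measurable_snd id])
  \<comment> \<open>The source carries a product sigma-algebra, so measurability is checked
    coordinate by coordinate.\<close>
  have "?T \<in> borel_measurable (P \<Otimes>\<^sub>M ?\<gamma>)"
  proof -
    have "(\<lambda>q. \<lambda>i. snd q * fst (fst q) i) \<in> borel_measurable (P \<Otimes>\<^sub>M ?\<gamma>)"
      by (rule measurable_coordinatewise_then_product)
        (intro borel_measurable_times snd_meas measurable_compose[OF measurable_fst coord(1)])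
    moreover have "(\<lambda>q. \<lambda>i. snd q * fst (snd (fst q)) i) \<in> borel_measurable (P \<Otimes>\<^sub>M ?\<gamma>)"
      by (rule measurable_coordinatewise_then_product)
        (intro borel_measurable_times snd_meas measurable_compose[OF measurable_fst coord(2)])
    ultimately have "(\<lambda>q. (\<lambda>i. snd q * fst (fst q) i, \<lambda>i. snd q * fst (snd (fst q)) i, snd q))
        \<in> borel_measurable (P \<Otimes>\<^sub>M ?\<gamma>)"
      by (intro borel_measurable_Pair snd_meas)
    then show ?thesis by (simp add: scale_point_def case_prod_beta)
  qed
  then have T: "?T \<in> measurable (P \<Otimes>\<^sub>M ?\<gamma>) (restrict_space borel thoma_cone)"
    by (intro measurable_restrict_space2)
      (auto simp: space_pair_measure space_boundary[OF P] gamma_measure_space intro!: scale_point_in_cone)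
  have Fm: "F \<in> borel_measurable (restrict_space borel thoma_cone)"
    by (rule borel_measurable_continuous_on_restrict[OF F])
  have map_eq: "(\<lambda>((\<alpha>, \<beta>, _), r). (\<lambda>i. r * \<alpha> i, \<lambda>i. r * \<beta> i, r)) = ?T"
    by (auto simp: scale_point_def fun_eq_iff)
  have lift: "thoma_lift c P = distr (P \<Otimes>\<^sub>M ?\<gamma>) (restrict_space borel thoma_cone) ?T"
    unfolding thoma_lift_def map_eq ..
  define f where "f = (\<lambda>(\<omega>, r). F (scale_point r \<omega>))"
  have f_eq: "(\<lambda>q. F (?T q)) = f" by (auto simp: f_def)
  have fm: "f \<in> borel_measurable (P \<Otimes>\<^sub>M ?\<gamma>)"
    using measurable_compose[OF T Fm] unfolding f_eq .
  have pow: "integrable ?\<gamma> (\<lambda>x. C * (1 + x) ^ M)"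
    by (intro integrable_mult_right integrable_gamma_power c)
  have fb: "norm (f (\<omega>, r)) \<le> C * (1 + r) ^ M" if "\<omega> \<in> space P" "r \<in> space ?\<gamma>" for \<omega> r
    using bound[OF scale_point_in_cone, of \<omega> r] that
    by (simp add: f_def space_boundary[OF P] gamma_measure_space scale_point_def)
  have int2: "integrable ?\<gamma> (\<lambda>r. f (\<omega>, r))" if \<omega>: "\<omega> \<in> space P" for \<omega>
  proof (rule Bochner_Integration.integrable_bound[OF pow])
    show "(\<lambda>r. f (\<omega>, r)) \<in> borel_measurable ?\<gamma>"
      using measurable_compose[OF measurable_Pair1'[OF \<omega>] fm] .
    show "AE r in ?\<gamma>. norm (f (\<omega>, r)) \<le> norm (C * (1 + r) ^ M)"
      using fb[OF \<omega>] by (intro AE_I2) (force intro: order_trans)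
  qed
  have int: "integrable (P \<Otimes>\<^sub>M ?\<gamma>) f"
  proof (rule Fubini_integrable[OF fm])
    show "integrable P (\<lambda>\<omega>. \<integral>r. norm (f (\<omega>, r)) \<partial>?\<gamma>)"
    proof (rule P.integrable_const_bound)
      show "AE \<omega> in P. norm (\<integral>r. norm (f (\<omega>, r)) \<partial>?\<gamma>) \<le> (\<integral>r. C * (1 + r) ^ M \<partial>?\<gamma>)"
      proof (rule AE_I2)
        fix \<omega> assume \<omega>: "\<omega> \<in> space P"
        have "(\<integral>r. norm (f (\<omega>, r)) \<partial>?\<gamma>) \<le> (\<integral>r. C * (1 + r) ^ M \<partial>?\<gamma>)"
          by (rule integral_mono) (use int2[OF \<omega>] pow fb[OF \<omega>] in auto)
        moreover have "0 \<le> (\<integral>r. norm (f (\<omega>, r)) \<partial>?\<gamma>)" by (rule Bochner_Integration.integral_nonneg) simp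
        ultimately show "norm (\<integral>r. norm (f (\<omega>, r)) \<partial>?\<gamma>) \<le> (\<integral>r. C * (1 + r) ^ M \<partial>?\<gamma>)"
          by simp
      qed
      show "(\<lambda>\<omega>. \<integral>r. norm (f (\<omega>, r)) \<partial>?\<gamma>) \<in> borel_measurable P"
        using fm by measurable
    qed
    show "AE \<omega> in P. integrable ?\<gamma> (\<lambda>r. f (\<omega>, r))"
      using int2 by (rule AE_I2)
  qed
  then have int': "integrable (P \<Otimes>\<^sub>M ?\<gamma>) (case_prod (\<lambda>\<omega> r. f (\<omega>, r)))" by simp
  show "integrable (thoma_lift c P) F"
    unfolding lift integrable_distr_eq[OF T Fm] f_eq by (rule int)
  have Lf: "L = (\<lambda>r. \<integral>\<omega>. f (\<omega>, r) \<partial>P)" by (simp add: L_def f_def)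
  have Lm: "L \<in> borel_measurable ?\<gamma>"
    unfolding Lf using integrable_snd[OF int'] by (rule borel_measurable_integrable)
  have "(\<integral>\<omega>. F \<omega> \<partial>thoma_lift c P) = (\<integral>q. f q \<partial>(P \<Otimes>\<^sub>M ?\<gamma>))"
    unfolding lift integral_distr[OF T Fm] f_eq ..
  also have "\<dots> = (\<integral>r. L r \<partial>?\<gamma>)"
    unfolding Lf using integral_snd[OF int'] by simp
  also have "\<dots> = (\<integral>x. indicator {0<..} x * (x powr (c - 1) * exp (- x) / Gamma c * L x) \<partial>lborel)"
    by (rule gamma_measure_integral(2)[OF c Lm])
  finally show "(\<integral>\<omega>. F \<omega> \<partial>thoma_lift c P) =
      (\<integral>x. indicator {0<..} x * (x powr (c - 1) * exp (- x) / Gamma c * L x) \<partial>lborel)" .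
  have "L \<in> borel_measurable (restrict_space lborel {0<..})"
    using Lm by (simp add: measurable_gamma_measure)
  then show "(\<lambda>x. indicator {0<..} x * L x) \<in> borel_measurable borel"
    by (subst (asm) borel_measurable_restrict_space_iff) (auto simp: mult.commute)
qed

lemma mixture_limit:
  assumes adm: "admissible z z'" and P: "is_boundary_z_measure z z' P" and c: "c > 0"
    and F: "continuous_on thoma_cone F" "polynomially_bounded F"
  defines "t \<equiv> \<lambda>\<epsilon> n. \<epsilon> powr c * nb_coeff c n * (1 - \<epsilon>) ^ n * level_mean P F \<epsilon> n"
  shows "integrable (thoma_lift c P) F"
    and "((\<lambda>\<epsilon>. suminf (t \<epsilon>)) \<longlongrightarrow> (\<integral>\<omega>. F \<omega> \<partial>thoma_lift c P)) (at_right 0)"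
    and "\<And>\<epsilon>. 0 < \<epsilon> \<Longrightarrow> \<epsilon> < 1 \<Longrightarrow> summable (\<lambda>n. \<bar>t \<epsilon> n\<bar>)"
proof -
  obtain C M where C: "C \<ge> 0" "\<And>\<omega>. \<omega> \<in> thoma_cone \<Longrightarrow> \<bar>F \<omega>\<bar> \<le> C * (1 + snd (snd \<omega>)) ^ M"
    using polynomially_bounded_power[OF F(2)] by blast
  have lift: "integrable (thoma_lift c P) F"
    "(\<integral>\<omega>. F \<omega> \<partial>thoma_lift c P) = (\<integral>x. indicator {0<..} x *
      (x powr (c - 1) * exp (- x) / Gamma c * (\<integral>\<omega>. F (scale_point x \<omega>) \<partial>P)) \<partial>lborel)"
    "(\<lambda>x. indicator {0<..} x * (\<integral>\<omega>. F (scale_point x \<omega>) \<partial>P)) \<in> borel_measurable borel"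
    by (rule lift_integral[OF P c F(1)], rule C(2), assumption)+
  have lim: "(\<lambda>j. level_mean P F (X j) (nat \<lfloor>x / X j\<rfloor>)) \<longlonglongrightarrow> (\<integral>\<omega>. F (scale_point x \<omega>) \<partial>P)"
    if "\<And>j. 0 < X j" "\<And>j. X j < 1" "X \<longlonglongrightarrow> 0" "x > 0" for X x
    by (rule level_mean_tendsto[OF adm P F(1) nb_term_limit(1,2)[OF c that] that(1,4)])
  have bd: "\<bar>level_mean P F \<epsilon> n\<bar> \<le> C * (1 + \<epsilon> * real n) ^ M" if "0 < \<epsilon>" "\<epsilon> < 1" for \<epsilon> n
    by (rule level_mean_bound[OF adm P C(2)]) (use that in auto)
  note N = negative_binomial_to_gamma[of c C "level_mean P F" M, OF c C(1) bd lift(3) lim]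
  show "integrable (thoma_lift c P) F" by (rule lift(1))
  show "((\<lambda>\<epsilon>. suminf (t \<epsilon>)) \<longlongrightarrow> (\<integral>\<omega>. F \<omega> \<partial>thoma_lift c P)) (at_right 0)"
    unfolding t_def lift(2) by (rule N(2); assumption)
  show "summable (\<lambda>n. \<bar>t \<epsilon> n\<bar>)" if "0 < \<epsilon>" "\<epsilon> < 1" for \<epsilon>
    unfolding t_def by (rule N(1); (assumption | rule that))
qed

section \<open>Summation over all partitions by levels\<close>

lemma has_sum_partitions:
  fixes f :: "nat list \<Rightarrow> real"
  assumes "summable (\<lambda>n. \<Sum>\<nu>\<in>partitions_of n. \<bar>f \<nu>\<bar>)"
  shows "f summable_on partitions" "infsum f partitions = (suminf (\<lambda>n. \<Sum>\<nu>\<in>partitions_of n. f \<nu>))"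
proof -
  let ?S = "SIGMA n:UNIV. partitions_of n"
  have bij: "bij_betw snd ?S partitions"
    by (auto simp: bij_betw_def inj_on_def partitions_of_def image_iff)
  have "(\<lambda>q. \<bar>f (snd q)\<bar>) summable_on ?S"
  proof (rule summable_on_SigmaI[where g = "\<lambda>n. \<Sum>\<nu>\<in>partitions_of n. \<bar>f \<nu>\<bar>"])
    show "((\<lambda>\<nu>. \<bar>f (snd (n, \<nu>))\<bar>) has_sum (\<Sum>\<nu>\<in>partitions_of n. \<bar>f \<nu>\<bar>)) (partitions_of n)" for n
      using has_sum_finite[OF finite_partitions_of] by simp
    show "(\<lambda>n. \<Sum>\<nu>\<in>partitions_of n. \<bar>f \<nu>\<bar>) summable_on UNIV"
      using assms by (subst summable_on_UNIV_nonneg_real_iff) (auto intro: sum_nonneg)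
  qed auto
  then have "(\<lambda>q. norm (f (snd q))) summable_on ?S" by simp
  then have s: "(\<lambda>q. f (snd q)) summable_on ?S" by (rule abs_summable_summable)
  then show "f summable_on partitions"
    using summable_on_reindex_bij_betw[OF bij, of f] by simp
  have s': "(\<lambda>(n, \<nu>). f \<nu>) summable_on ?S" using s by (simp add: case_prod_unfold)
  have "infsum f partitions = infsum (\<lambda>(n, \<nu>). f \<nu>) ?S"
    using infsum_reindex_bij_betw[OF bij, of f] by (simp add: case_prod_unfold)
  also have "\<dots> = infsum (\<lambda>n. infsum f (partitions_of n)) UNIV"
    by (rule infsum_Sigma'_banach[OF s', symmetric])
  also have "\<dots> = infsum (\<lambda>n. \<Sum>\<nu>\<in>partitions_of n. f \<nu>) UNIV"
    by (simp add: finite_partitions_of)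
  also have "\<dots> = suminf (\<lambda>n. \<Sum>\<nu>\<in>partitions_of n. f \<nu>)"
  proof -
    have "summable (\<lambda>n. norm (\<Sum>\<nu>\<in>partitions_of n. f \<nu>))"
      by (rule summable_comparison_test_ev[OF _ assms]) (auto intro: always_eventually sum_abs)
    then have "(\<lambda>n. \<Sum>\<nu>\<in>partitions_of n. f \<nu>) summable_on UNIV"
      by (rule norm_summable_imp_summable_on)
    then have "((\<lambda>n. \<Sum>\<nu>\<in>partitions_of n. f \<nu>) has_sum
        infsum (\<lambda>n. \<Sum>\<nu>\<in>partitions_of n. f \<nu>) UNIV) UNIV"
      by simp
    then show ?thesis by (rule has_sum_imp_sums[THEN sums_unique])
  qed
  finally show "infsum f partitions = suminf (\<lambda>n. \<Sum>\<nu>\<in>partitions_of n. f \<nu>)" .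
qed

theorem theorem5p28:
  fixes z z' :: complex
    and P :: "thoma_point measure"
    and F :: "thoma_point \<Rightarrow> real"
  assumes "admissible z z'"
    and "is_boundary_z_measure z z' P"
    and "continuous_on thoma_cone F"
    and "polynomially_bounded F"
  shows "(\<forall>\<epsilon>\<in>{0<..<1}.
            (\<lambda>\<nu>. F (thoma_embed \<epsilon> \<nu>) * mixed_z_measure z z' (1 - \<epsilon>) \<nu>) summable_on partitions) \<and>
         integrable (thoma_lift (Re (z * z')) P) F \<and>
         ((\<lambda>\<epsilon>. \<Sum>\<^sub>\<infinity>\<nu>\<in>partitions. F (thoma_embed \<epsilon> \<nu>) * mixed_z_measure z z' (1 - \<epsilon>) \<nu>)
            \<longlongrightarrow> (\<integral>\<omega>. F \<omega> \<partial>thoma_lift (Re (z * z')) P)) (at_right 0)"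
proof -
  obtain c where c: "c > 0" "z * z' = complex_of_real c" by (rule admissible_mult_pos[OF assms(1)])
  have Re: "Re (z * z') = c" by (simp add: c(2))
  let ?m = "\<lambda>\<epsilon> \<nu>. F (thoma_embed \<epsilon> \<nu>) * mixed_z_measure z z' (1 - \<epsilon>) \<nu>"
  let ?t = "\<lambda>F \<epsilon> n. \<epsilon> powr c * nb_coeff c n * (1 - \<epsilon>) ^ n * level_mean P F \<epsilon> n"
  \<comment> \<open>The mixture limit is also applied to the absolute value of \<open>F\<close>:
    convergence of the level sums of \<open>F\<close> alone would not control the unordered sum over
    partitions, because of cancellation within a level.\<close>
  have cont: "continuous_on thoma_cone (\<lambda>\<omega>. \<bar>F \<omega>\<bar>)"
    using assms(3) by (intro continuous_on_rabs)
  have pb: "polynomially_bounded (\<lambda>\<omega>. \<bar>F \<omega>\<bar>)"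
    using assms(4) by (simp add: polynomially_bounded_def)
  have w: "mixed_z_measure z z' (1 - \<epsilon>) \<nu> = \<epsilon> powr c * nb_coeff c n * (1 - \<epsilon>) ^ n * level_measure P \<nu>"
    if "\<nu> \<in> partitions_of n" for \<epsilon> n \<nu>
    using mixed_z_measure_eq[OF assms(1,2) c(2,1) that, of "1 - \<epsilon>"] by (simp add: nb_coeff_def)
  have lev: "(\<Sum>\<nu>\<in>partitions_of n. ?m \<epsilon> \<nu>) = ?t F \<epsilon> n" for \<epsilon> n
    by (simp add: w level_mean_def sum_distrib_left mult_ac)
  have lev_abs: "(\<Sum>\<nu>\<in>partitions_of n. \<bar>?m \<epsilon> \<nu>\<bar>) = ?t (\<lambda>\<omega>. \<bar>F \<omega>\<bar>) \<epsilon> n" if "0 < \<epsilon>" "\<epsilon> < 1" for \<epsilon> n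
    unfolding level_mean_def sum_distrib_left
  proof (intro sum.cong refl)
    fix \<nu> assume \<nu>: "\<nu> \<in> partitions_of n"
    then have "level_measure P \<nu> \<ge> 0"
      using level_measure_nonneg[OF assms(1,2)] by (simp add: partitions_of_def)
    then show "\<bar>?m \<epsilon> \<nu>\<bar> = \<epsilon> powr c * nb_coeff c n * (1 - \<epsilon>) ^ n *
        (level_measure P \<nu> * \<bar>F (thoma_embed \<epsilon> \<nu>)\<bar>)"
      using that nb_coeff_nonneg[OF c(1), of n] by (simp add: w[OF \<nu>] abs_mult)
  qed
  have abs_sum: "summable (\<lambda>n. \<Sum>\<nu>\<in>partitions_of n. \<bar>?m \<epsilon> \<nu>\<bar>)" if "0 < \<epsilon>" "\<epsilon> < 1" for \<epsilon>
  proof -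
    have "summable (\<lambda>n. \<bar>?t (\<lambda>\<omega>. \<bar>F \<omega>\<bar>) \<epsilon> n\<bar>)"
      by (rule mixture_limit(3)[OF assms(1,2) c(1) cont pb that])
    then show ?thesis unfolding lev_abs[OF that] by (rule summable_rabs_cancel)
  qed
  note mix = mixture_limit[OF assms(1,2) c(1) assms(3,4)]
  have "eventually (\<lambda>\<epsilon>. \<epsilon> \<in> {0<..<1}) (at_right (0 :: real))"
    by (rule eventually_at_right_real) simp
  then have "eventually (\<lambda>\<epsilon>. suminf (?t F \<epsilon>) = infsum (?m \<epsilon>) partitions) (at_right 0)"
  proof eventually_elim
    case (elim \<epsilon>)
    then show ?case using has_sum_partitions(2)[OF abs_sum[of \<epsilon>]] by (simp only: lev) simp
  qed
  with mix(2) have "((\<lambda>\<epsilon>. infsum (?m \<epsilon>) partitions) \<longlongrightarrow> (\<integral>\<omega>. F \<omega> \<partial>thoma_lift c P)) (at_right 0)"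
    by (rule Lim_transform_eventually)
  moreover have "\<forall>\<epsilon>\<in>{0<..<1}. ?m \<epsilon> summable_on partitions"
    using has_sum_partitions(1)[OF abs_sum] by auto
  ultimately show ?thesis unfolding Re using mix(1) by blast
qed

end
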